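(* Let $X\subset\mathbf R^m$ and $Y\subset\mathbf R$ be connected open sets equipped with Borel probability measures $\mu$ and $\nu$ respectively. Assume $\nu$ has no atoms and $\mu$ vanishes on each Lipschitz hypersurface. Let $s\in C^{1,1}(X\times Y)$, $s_y=\partial s/\partial y$, and for $y\in Y$ and $k\in\mathbf R$ set $X(y,k)=\{x\in X: s_y(x,y)=k\}$, $X_\le(y,k)=\{x\in X: s_y(x,y)\le k\}$, $X_<(y,k)=X_\le(y,k)\setminus X(y,k)$. (a) Assume $s$ is non-degenerate throughout $X\times Y$. Then for each $y\in Y$ there is a maximal interval $K(y)=[k^-(y),k^+(y)]\neq\emptyset$ such that $\mu[X_\le(y,k)]=\nu[(-\infty,y)]$ for all $k\in K(y)$. Both $k^+$ and $-k^-$ are upper semicontinuous. (b) In addition, assume both maps $y\in Y\mapsto X_\le(y,k^\pm(y))$ are non-decreasing (with respect to inclusion), and moreover that $\int_y^{y'}d\nu>0$ implies $X_\le(y,k^+(y))\subseteq X_<(y',k^-(y'))$. Then $k^+$ is right continuous, $k^-$ is left continuous, and they agree throughout $\operatorname{spt}\nu$ except perhaps at countably many points. Setting $F(x)=y$ for each $x\in X(y,k^+(y))$ defines a map $F:X\to Y$ $\mu$-a.e., and $\gamma=(\mathrm{id}\times F)_\#\mu$ is the unique maximizer of $\int_{X\times Y}s\,d\gamma$ over $\gamma\in\Gamma(\mu,\nu)$. (c) In addition to the assumptions of (a) and (b), assume $\operatorname{spt}\nu$ is connected, say $\operatorname{spt}\nu=[\underline y,\bar y]$. Then $F$ agrees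 $\mu$-a.e. with the continuous function $$\bar F(x)=\begin{cases}\bar y & \text{if } x\notin\bigcup_{y\in(\underline y,\bar y)}X_<(y,k^-(y)),\\ y & \text{if } x\in X_\le(y,k^+(y))\setminus X_<(y,k^-(y))\text{ with } y\in(\underline y,\bar y),\\ \underline y & \text{if } x\in\bigcap_{y\in(\underline y,\bar y)}X_\le(y,k^+(y)).\end{cases}$$ (d) If, in addition to the assumptions of (a), (b), (c), $Y\subset\operatorname{spt}\nu$, then $\bar F:X\to Y$.
   Context: $C^{1,1}(X\times Y)$ denotes $C^1$ functions with bounded values, bounded first derivatives and globally Lipschitz first derivatives. Non-degeneracy: for a Lipschitz function $\phi$ on an open subset of $\mathbf R^m$, the Clarke subdifferential $\partial\phi(x)$ is the convex hull of limits of $D\phi(x_i)$ along sequences $x_i\to x$ of differentiability points. $s$ is non-degenerate at $(\bar x,\bar y)\in X\times Y$ if there is a unit vector $e\in\mathbf R^m$ such that, for $\phi(x)=s_y(x,\bar y)$, every $p\in\partial\phi(\bar x)$ satisfies $p\cdot e\ne0$. (If $s\in C^2$ this says $D_xs_y(\bar x,\bar y)\neq0$.) $\Gamma(\mu,\nu)$ is the set of nonnegative Borel measures on $X\times Y$ with marginals $\mu$ and $\nu$; $F_\#\mu(V)=\mu[F^{-1}(V)]$; $\operatorname{spt}\nu\subset\overline Y$ is the smallest closed set carrying the full mass of $\nu$.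
   Formalization: Part (d) is false pointwise (X=(0,10), Y=(0,1), s=xy, μ uniform on (0,1), ν uniform on Y give F̄(5)=1∉Y); what is proved instead is that F̄(x) lies in Y for μ-a.e. x and in the closure of Y (in the extended reals) for every x in X. *)

theory Defs
  imports "HOL-Probability.Probability"
begin

section \<open>Regularity and non-degeneracy\<close>

definition C11_on :: "'a::euclidean_space set \<Rightarrow> ('a \<Rightarrow> real) \<Rightarrow> bool" where
  "C11_on W f \<longleftrightarrow> bounded (f ` W) \<and>
     (\<exists>G. (\<forall>z\<in>W. GDERIV f z :> G z) \<and> continuous_on W G \<and> bounded (G ` W) \<and>
          (\<exists>L. L-lipschitz_on W G))"

definition dy :: "('a \<times> real \<Rightarrow> real) \<Rightarrow> 'a \<Rightarrow> real \<Rightarrow> real" where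
  "dy s x y = deriv (\<lambda>t. s (x, t)) y"

definition clarke_subdifferential ::
    "'a::euclidean_space set \<Rightarrow> ('a \<Rightarrow> real) \<Rightarrow> 'a \<Rightarrow> 'a set" where
  "clarke_subdifferential W f x =
     convex hull {p. \<exists>z g. (\<forall>i::nat. z i \<in> W \<and> GDERIV f (z i) :> g i) \<and>
                          z \<longlonglongrightarrow> x \<and> g \<longlonglongrightarrow> p}"

definition nondegenerate_at ::
    "'a::euclidean_space set \<Rightarrow> ('a \<times> real \<Rightarrow> real) \<Rightarrow> 'a \<Rightarrow> real \<Rightarrow> bool" where
  "nondegenerate_at X s x y \<longleftrightarrow>
     (\<exists>e. norm e = 1 \<and>
          (\<forall>p \<in> clarke_subdifferential X (\<lambda>x'. dy s x' y) x. p \<bullet> e \<noteq> 0))"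

text \<open>A set that near each of its points is, in suitable orthonormal coordinates, the graph of a
  Lipschitz function over a hyperplane. Such a set is locally closed, hence Borel.\<close>

definition lipschitz_hypersurface :: "'a::euclidean_space set \<Rightarrow> bool" where
  "lipschitz_hypersurface S \<longleftrightarrow>
     (\<forall>p\<in>S. \<exists>U e g L. open U \<and> p \<in> U \<and> norm e = 1 \<and> L-lipschitz_on {z. z \<bullet> e = 0} g \<and>
        S \<inter> U = {x \<in> U. x \<bullet> e = g (x - (x \<bullet> e) *\<^sub>R e)})"

section \<open>Level sets\<close>

text \<open>The level is allowed to be infinite because the endpoints of the interval of admissible
  levels below may be infinite.\<close>

definition level_eq :: "('a \<times> real \<Rightarrow> real) \<Rightarrow> 'a set \<Rightarrow> real \<Rightarrow> ereal \<Rightarrow> 'a set" where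
  "level_eq s X y k = {x \<in> X. ereal (dy s x y) = k}"

definition level_le :: "('a \<times> real \<Rightarrow> real) \<Rightarrow> 'a set \<Rightarrow> real \<Rightarrow> ereal \<Rightarrow> 'a set" where
  "level_le s X y k = {x \<in> X. ereal (dy s x y) \<le> k}"

definition level_less :: "('a \<times> real \<Rightarrow> real) \<Rightarrow> 'a set \<Rightarrow> real \<Rightarrow> ereal \<Rightarrow> 'a set" where
  "level_less s X y k = level_le s X y k - level_eq s X y k"

definition balanced_level ::
    "'a measure \<Rightarrow> real measure \<Rightarrow> ('a \<times> real \<Rightarrow> real) \<Rightarrow> real \<Rightarrow> real \<Rightarrow> bool" where
  "balanced_level \<mu> \<nu> s y k \<longleftrightarrow>
     emeasure \<mu> (level_le s (space \<mu>) y (ereal k)) = emeasure \<nu> {t \<in> space \<nu>. t < y}"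

text \<open>Since \<open>s\<close> has bounded derivatives, the set of balanced levels is unbounded below where
  \<open>\<nu>\<close> gives no mass to \<open>(-\<infinity>, y)\<close> and unbounded above where it gives full mass to
  it, so that its endpoints are extended reals.\<close>

definition k_minus ::
    "'a measure \<Rightarrow> real measure \<Rightarrow> ('a \<times> real \<Rightarrow> real) \<Rightarrow> real \<Rightarrow> ereal" where
  "k_minus \<mu> \<nu> s y = (INF k \<in> {k. balanced_level \<mu> \<nu> s y k}. ereal k)"

definition k_plus ::
    "'a measure \<Rightarrow> real measure \<Rightarrow> ('a \<times> real \<Rightarrow> real) \<Rightarrow> real \<Rightarrow> ereal" where
  "k_plus \<mu> \<nu> s y = (SUP k \<in> {k. balanced_level \<mu> \<nu> s y k}. ereal k)"

definition K_interval ::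
    "'a measure \<Rightarrow> real measure \<Rightarrow> ('a \<times> real \<Rightarrow> real) \<Rightarrow> real \<Rightarrow> real set" where
  "K_interval \<mu> \<nu> s y = {k. k_minus \<mu> \<nu> s y \<le> ereal k \<and> ereal k \<le> k_plus \<mu> \<nu> s y}"

definition usc_on :: "'a::topological_space set \<Rightarrow> ('a \<Rightarrow> ereal) \<Rightarrow> bool" where
  "usc_on S f \<longleftrightarrow> (\<forall>y\<in>S. Limsup (at y within S) f \<le> f y)"

section \<open>Optimal transport\<close>

definition spt :: "'a::topological_space measure \<Rightarrow> 'a set" where
  "spt N = \<Inter> {C. closed C \<and> emeasure N (space N \<inter> C) = emeasure N (space N)}"

definition transport_plans ::
    "'a::topological_space measure \<Rightarrow> 'b::topological_space measure \<Rightarrow> ('a \<times> 'b) measure set" where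
  "transport_plans M N =
     {\<gamma>. sets \<gamma> = sets (restrict_space borel (space M \<times> space N)) \<and>
          distr \<gamma> M fst = M \<and> distr \<gamma> N snd = N}"

definition unique_maximizer ::
    "'a::topological_space measure \<Rightarrow> 'b::topological_space measure \<Rightarrow>
     ('a \<times> 'b \<Rightarrow> real) \<Rightarrow> ('a \<times> 'b) measure \<Rightarrow> bool" where
  "unique_maximizer M N s \<gamma> \<longleftrightarrow>
     \<gamma> \<in> transport_plans M N \<and>
     (\<forall>\<gamma>' \<in> transport_plans M N. integral\<^sup>L \<gamma>' s \<le> integral\<^sup>L \<gamma> s) \<and>
     (\<forall>\<gamma>' \<in> transport_plans M N. integral\<^sup>L \<gamma>' s = integral\<^sup>L \<gamma> s \<longrightarrow> \<gamma>' = \<gamma>)"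

definition graph_plan ::
    "'a::topological_space measure \<Rightarrow> 'b::topological_space measure \<Rightarrow>
     ('a \<Rightarrow> 'b) \<Rightarrow> ('a \<times> 'b) measure" where
  "graph_plan M N F = distr M (restrict_space borel (space M \<times> space N)) (\<lambda>x. (x, F x))"

text \<open>The rule determining the value \<open>F x = y\<close> of the optimal map, and the measurable
  maps that obey it almost everywhere.\<close>

definition F_rule ::
    "'a measure \<Rightarrow> real measure \<Rightarrow> ('a \<times> real \<Rightarrow> real) \<Rightarrow> 'a \<Rightarrow> real \<Rightarrow> bool" where
  "F_rule \<mu> \<nu> s x y \<longleftrightarrow>
     y \<in> space \<nu> \<and> x \<in> level_eq s (space \<mu>) y (k_plus \<mu> \<nu> s y)"

definition matching_map ::
    "'a measure \<Rightarrow> real measure \<Rightarrow> ('a \<times> real \<Rightarrow> real) \<Rightarrow> ('a \<Rightarrow> real) \<Rightarrow> bool" where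
  "matching_map \<mu> \<nu> s F \<longleftrightarrow> F \<in> measurable \<mu> \<nu> \<and> (AE x in \<mu>. F_rule \<mu> \<nu> s x (F x))"

text \<open>The three-case rule for the continuous version of the map; \<open>a\<close> and \<open>b\<close> are the
  endpoints of the support of \<open>\<nu>\<close>, which are infinite if the support is unbounded. It is
  written as a relation since neither exclusiveness nor exhaustiveness of the cases is evident.\<close>

definition Fbar_rule ::
    "'a measure \<Rightarrow> real measure \<Rightarrow> ('a \<times> real \<Rightarrow> real) \<Rightarrow> ereal \<Rightarrow> ereal \<Rightarrow> 'a \<Rightarrow> ereal \<Rightarrow> bool" where
  "Fbar_rule \<mu> \<nu> s a b x v \<longleftrightarrow>
     (let le = (\<lambda>y. level_le s (space \<mu>) y (k_plus \<mu> \<nu> s y));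
          less = (\<lambda>y. level_less s (space \<mu>) y (k_minus \<mu> \<nu> s y));
          I = {y. a < ereal y \<and> ereal y < b}
      in (x \<notin> (\<Union>y\<in>I. less y) \<and> v = b) \<or>
         (\<exists>y\<in>I. x \<in> le y - less y \<and> v = ereal y) \<or>
         (x \<in> (\<Inter>y\<in>I. le y) \<and> v = a))"

definition Fbar ::
    "'a measure \<Rightarrow> real measure \<Rightarrow> ('a \<times> real \<Rightarrow> real) \<Rightarrow> ereal \<Rightarrow> ereal \<Rightarrow> 'a \<Rightarrow> ereal" where
  "Fbar \<mu> \<nu> s a b x = (THE v. Fbar_rule \<mu> \<nu> s a b x v)"

end

theory Submission
  imports Defs
begin

text \<open>
  Non-degeneracy makes \<open>s\<^sub>y(\<cdot>, y)\<close> strictly increasing along a direction: by Rademacher's theorem almost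
  every point is a point of differentiability, and nearby gradients have inner product at least \<open>c > 0\<close>
  with that direction. Hence level sets are Lipschitz hypersurfaces, so they are \<open>\<mu>\<close>-null and the
  mass of a sublevel set depends continuously on the level and on \<open>y\<close>.
  Under the monotonicity assumptions a point \<open>x\<close> is matched with the smallest \<open>y\<close> for which it belongs to
  \<open>X\<^sub>\<le>(y, k\<^sup>+(y))\<close>; the exceptional points lie in countably many null sets. With \<open>v(y)\<close> a primitive of
  \<open>k\<^sup>+\<close>, the function \<open>s(x, y) - v(y)\<close> increases in \<open>y\<close> up to \<open>F(x)\<close> and decreases strictly afterwards, so \<open>v\<close>
  is an optimal dual potential, and boundedness of \<open>s\<close> makes \<open>v\<close> bounded \<open>\<nu>\<close>-almost everywhere.
\<close>

subsection \<open>Differentiability almost everywhere of Lipschitz functions on the line\<close>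

text \<open>The smallest admissible y of a point x satisfies k-(y) \<le> s_y(x,y) \<le> k+(y), and a
  match asks for equality on the right. Equality is automatic where k- and k+ agree, but the
  hypotheses separate only values of y with \<nu>-mass between them, so off the support nothing
  forces agreement. The obstacle is thus to show that almost every smallest value lies in the
  support: over a stretch without \<nu>-mass the sets X_\<le>(y,k+(y)) grow by null sets only. In
  the support, apart from countably many y, different values with k- < k+ yield disjoint non-empty
  open sets k- < s_y < k+; so there are countably many such values, and each concerns a null set of
  points only. Both halves of the differentiability theory, on the line and in several variables,
  rest on one principle: a set is null if around each of its points it leaves a fixed fraction of
  arbitrarily small balls empty.\<close>

lemma negligible_if_deficient_density_bounded:
  fixes S :: "'a::euclidean_space set"
  assumes "bounded S" and c: "0 < c" "c < 1"
    and dens: "\<And>x d. x \<in> S \<Longrightarrow> 0 < d \<Longrightarrow> \<exists>z r U. 0 < r \<and> r < d \<and> x \<in> cball z r \<and> S \<inter> cball z r \<subseteq> U \<and>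
       U \<in> sets lebesgue \<and> emeasure lebesgue U \<le> ennreal c * emeasure lebesgue (cball z r)"
  shows "negligible S"
proof -
  \<comment> \<open>One pass of Vitali's covering theorem: disjoint balls inside \<open>V\<close>
    cover S up to a null set, and in each of them S fits into a set of relative size at most c. The
    sets \<open>U\<close> stand in for S itself, whose measurability is not known.\<close>
  have step: "\<exists>U\<in>sets lebesgue. S \<subseteq> U \<and> emeasure lebesgue U \<le> ennreal c * emeasure lebesgue V"
    if V: "open V" "S \<subseteq> V" for V
  proof -
    define good where "good i U \<longleftrightarrow> 0 < snd i \<and> cball (fst i) (snd i) \<subseteq> V \<and> S \<inter> cball (fst i) (snd i) \<subseteq> U \<and>
       U \<in> sets lebesgue \<and> emeasure lebesgue U \<le> ennreal c * emeasure lebesgue (cball (fst i) (snd i))"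
      for i :: "'a \<times> real" and U
    define K where "K = {i. \<exists>U. good i U}"
    have fine: "\<exists>i. i \<in> K \<and> x \<in> cball (fst i) (snd i) \<and> snd i < d" if x: "x \<in> S" and d: "0 < d" for x d
    proof -
      obtain e where e: "e > 0" "ball x e \<subseteq> V" using V x open_contains_ball by blast
      \<comment> \<open>The ball merely contains x, so it may reach up to 2 r from x; hence the
        bound e/2 on its radius.\<close>
      obtain z r U where *: "0 < r" "r < min d (e/2)" "x \<in> cball z r" "S \<inter> cball z r \<subseteq> U"
       "U \<in> sets lebesgue" "emeasure lebesgue U \<le> ennreal c * emeasure lebesgue (cball z r)"
        using dens[OF x, of "min d (e/2)"] d e by auto
      have "cball z r \<subseteq> ball x e"
      proof
        fix y assume "y \<in> cball z r"
        then have "dist x y \<le> r + r" using *(3) dist_triangle[of x y z]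
          by (simp add: dist_commute)
        then show "y \<in> ball x e" using *(2) by simp
      qed
      then have "good (z, r) U" using * e unfolding good_def by auto
      then show ?thesis using * unfolding K_def by (intro exI[of _ "(z,r)"]) auto
    qed
    have rpos: "0 < snd i" if "i \<in> K" for i
      using that unfolding K_def good_def by blast
    obtain C where C: "countable C" "C \<subseteq> K"
      "pairwise (\<lambda>i j. disjnt (cball (fst i) (snd i)) (cball (fst j) (snd j))) C"
      "negligible (S - (\<Union>i\<in>C. cball (fst i) (snd i)))"
      by (rule Vitali_covering_theorem_cballs[of K snd S fst, OF rpos fine])
    define W where "W i = (SOME U. good i U) \<inter> cball (fst i) (snd i)" for i
    have W: "good i (SOME U. good i U)" if "i \<in> C" for i
      using that C(2) unfolding K_def by (auto intro: someI_ex)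
    have CV: "cball (fst i) (snd i) \<subseteq> V" and SW: "S \<inter> cball (fst i) (snd i) \<subseteq> W i"
      and meas: "W i \<in> sets lebesgue"
      if "i \<in> C" for i
      using W[OF that] unfolding good_def W_def by auto
    have le: "emeasure lebesgue (W i) \<le> ennreal c * emeasure lebesgue (cball (fst i) (snd i))"
      if "i \<in> C" for i
    proof -
      have "emeasure lebesgue (W i) \<le> emeasure lebesgue (SOME U. good i U)"
        using W[OF that] unfolding W_def good_def by (intro emeasure_mono) auto
      then show ?thesis using W[OF that] unfolding good_def by (blast intro: order_trans)
    qed
    have disjC: "disjoint_family_on (\<lambda>i. cball (fst i) (snd i)) C"
      using C(3) unfolding disjoint_family_on_def pairwise_def disjnt_def by blast
    then have disjW: "disjoint_family_on W C"
      unfolding disjoint_family_on_def W_def by blast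
    let ?N = "S - (\<Union>i\<in>C. cball (fst i) (snd i))"
    define U where "U = (\<Union>i\<in>C. W i) \<union> ?N"
    have N: "?N \<in> null_sets lebesgue" using C(4) negligible_iff_null_sets by blast
    have UW: "(\<Union>i\<in>C. W i) \<in> sets lebesgue" using meas C(1) by (intro sets.countable_UN') auto
    have "emeasure lebesgue U = emeasure lebesgue (\<Union>i\<in>C. W i)"
      unfolding U_def using N UW by (simp add: emeasure_Un_null_set)
    also have "\<dots> = (\<integral>\<^sup>+i. emeasure lebesgue (W i) \<partial>count_space C)"
      by (rule emeasure_UN_countable) (use meas C(1) disjW in auto)
    also have "\<dots> \<le> (\<integral>\<^sup>+i. ennreal c * emeasure lebesgue (cball (fst i) (snd i)) \<partial>count_space C)"
      using le by (intro nn_integral_mono) simp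
    also have "\<dots> = ennreal c * (\<integral>\<^sup>+i. emeasure lebesgue (cball (fst i) (snd i)) \<partial>count_space C)"
      by (rule nn_integral_cmult) auto
    also have "(\<integral>\<^sup>+i. emeasure lebesgue (cball (fst i) (snd i)) \<partial>count_space C)
       = emeasure lebesgue (\<Union>i\<in>C. cball (fst i) (snd i))"
      by (rule emeasure_UN_countable[symmetric]) (use C(1) disjC in auto)
    also have "\<dots> \<le> emeasure lebesgue V"
      using CV V by (intro emeasure_mono) auto
    finally have "emeasure lebesgue U \<le> ennreal c * emeasure lebesgue V"
      by (simp add: mult_left_mono)
    moreover have "S \<subseteq> U"
      using SW unfolding U_def by blast
    moreover have "U \<in> sets lebesgue" unfolding U_def using UW N by auto
    ultimately show ?thesis by blast
  qed
  obtain E where E: "E \<in> sets lebesgue" "S \<subseteq> E" "outer_measure_of lebesgue S = emeasure lebesgue E"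
    using outer_measure_of_attain[of S lebesgue] by auto
  obtain R where R: "S \<subseteq> ball 0 R" using \<open>bounded S\<close> bounded_subset_ballD by blast
  have "emeasure lebesgue E \<le> emeasure lebesgue (ball 0 R :: 'a set)"
    unfolding E(3)[symmetric] outer_measure_of_def using R by (intro INF_lower) auto
  also have "\<dots> < \<infinity>" using emeasure_bounded_finite[of "ball 0 R :: 'a set"] by simp
  finally have fin: "E \<in> lmeasurable" using E by (simp add: fmeasurable_def)
  have "measure lebesgue E = 0"
  proof (rule ccontr)
    assume "measure lebesgue E \<noteq> 0"
    then have m: "measure lebesgue E > 0" using zero_less_measure_iff by blast
    \<comment> \<open>The excess is chosen such that |V| < |E| / c. A cover of S of measure at most
      c |V| contradicts this, because |E| is the outer measure of S.\<close>
    obtain V where V: "open V" "E \<subseteq> V" "V - E \<in> lmeasurable"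
      "emeasure lebesgue (V - E) < ennreal (measure lebesgue E * (1 / c - 1))"
      using sets_lebesgue_outer_open[OF E(1), of "measure lebesgue E * (1 / c - 1)"] m c by auto
    have VE: "V = E \<union> (V - E)" using V by auto
    have lV: "V \<in> lmeasurable" using VE V(3) fin fmeasurable.Un by metis
    have "measure lebesgue V \<le> measure lebesgue E + measure lebesgue (V - E)"
      using VE measure_Un_le[of E lebesgue "V - E"] fin V(3) by (metis fmeasurableD)
    also have "\<dots> < measure lebesgue E + measure lebesgue E * (1 / c - 1)"
      using V(3,4) m c by (simp add: emeasure_eq_measure2 ennreal_less_iff)
    also have "\<dots> = measure lebesgue E / c" by (simp add: algebra_simps)
    finally have less: "c * measure lebesgue V < measure lebesgue E" using c by (simp add: field_simps)
    obtain U where U: "U \<in> sets lebesgue" "S \<subseteq> U" "emeasure lebesgue U \<le> ennreal c * emeasure lebesgue V"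
      using step[OF V(1) order_trans[OF E(2) V(2)]] by metis
    have "emeasure lebesgue E \<le> emeasure lebesgue U"
      unfolding E(3)[symmetric] outer_measure_of_def using U by (intro INF_lower) auto
    also note U(3)
    finally have "ennreal (measure lebesgue E) \<le> ennreal (c * measure lebesgue V)"
      using fin lV c by (simp add: emeasure_eq_measure2 ennreal_mult)
    then have "measure lebesgue E \<le> c * measure lebesgue V" using c by (subst (asm) ennreal_le_iff) auto
    then show False using less by simp
  qed
  then have "negligible E" using fin by (simp add: negligible_iff_measure0)
  then show ?thesis using E negligible_subset by blast
qed

lemma negligible_if_deficient_density:
  fixes S :: "'a::euclidean_space set"
  assumes c: "0 < c" "c < 1"
    and dens: "\<And>x d. x \<in> S \<Longrightarrow> 0 < d \<Longrightarrow> \<exists>z r U. 0 < r \<and> r < d \<and> x \<in> cball z r \<and> S \<inter> cball z r \<subseteq> U \<and>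
       U \<in> sets lebesgue \<and> emeasure lebesgue U \<le> ennreal c * emeasure lebesgue (cball z r)"
  shows "negligible S"
proof -
  have "negligible (S \<inter> ball 0 (real n))" for n
  proof (rule negligible_if_deficient_density_bounded[OF _ c])
    fix x :: 'a and d :: real assume "x \<in> S \<inter> ball 0 (real n)" "0 < d"
    then show "\<exists>z r U. 0 < r \<and> r < d \<and> x \<in> cball z r \<and> S \<inter> ball 0 (real n) \<inter> cball z r \<subseteq> U \<and>
       U \<in> sets lebesgue \<and> emeasure lebesgue U \<le> ennreal c * emeasure lebesgue (cball z r)"
      using dens[of x d] by blast
  qed (simp add: bounded_Int)
  then have "negligible (\<Union>n. S \<inter> ball 0 (real n))" by (intro negligible_Union_nat) auto
  moreover have "(\<Union>n. S \<inter> ball 0 (real n)) = S" by (auto simp: reals_Archimedean2)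
  ultimately show ?thesis by simp
qed

lemma cball_eq_Icc_min_max:
  fixes x y :: real
  shows "cball ((x + y) / 2) (\<bar>y - x\<bar> / 2) = {min x y..max x y}"
  unfolding cball_eq_atLeastAtMost by (auto simp: min_def max_def abs_if field_simps)

lemma min_max_slope:
  fixes f :: "real \<Rightarrow> real"
  assumes "x \<noteq> y"
  shows "f (max x y) - f (min x y) = (f y - f x) / (y - x) * \<bar>y - x\<bar>"
  using assms by (cases "x < y") (auto simp: min_def max_def abs_if field_simps)

text \<open>A small slope at x gives an interval [a,b] with end point x, as short as desired, over
  which f grows by at most p (b - a). Inside it, the points with slopes above q are covered, up to a
  null set, by disjoint intervals over which f grows by at least q times their length. These growths
  add up to at most p (b - a), so the intervals fill at most the fraction p/q of [a,b].\<close>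

lemma negligible_slope_gap:
  fixes f :: "real \<Rightarrow> real"
  assumes mono: "\<And>x y. x \<le> y \<Longrightarrow> f x \<le> f y" and cont: "continuous_on UNIV f" and pq: "0 < p" "p < q"
  shows "negligible {x. (\<exists>\<^sub>F y in at x. (f y - f x) / (y - x) < p) \<and>
                        (\<exists>\<^sub>F y in at x. (f y - f x) / (y - x) > q)}" (is "negligible ?E")
proof (rule negligible_if_deficient_density[of "p / q"])
  fix x d :: real assume x: "x \<in> ?E" and d: "0 < d"
  obtain y where y: "y \<noteq> x" "\<bar>y - x\<bar> < d" "(f y - f x) / (y - x) < p"
    using x d unfolding frequently_at dist_real_def by blast
  define a b where "a = min x y" and "b = max x y"
  have ab: "a < b" "b - a = \<bar>y - x\<bar>" using y(1) by (auto simp: a_def b_def min_def max_def)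
  have inc: "f b - f a \<le> p * (b - a)"
  proof -
    have "f b - f a = (f y - f x) / (y - x) * \<bar>y - x\<bar>"
      unfolding a_def b_def using y(1) by (intro min_max_slope) simp
    also have "\<dots> \<le> p * \<bar>y - x\<bar>" using y(3) by (intro mult_right_mono) auto
    finally show ?thesis using ab by simp
  qed
  define K where "K = {i :: real \<times> real. 0 < snd i \<and> cball (fst i) (snd i) \<subseteq> {a..b} \<and>
      f (fst i + snd i) - f (fst i - snd i) \<ge> q * (2 * snd i)}"
  \<comment> \<open>Open, so that the intervals of the fine cover fit into [a,b]; the end points are
    put back through \<open>?N\<close>.\<close>
  let ?T = "?E \<inter> {a<..<b}"
  have fine: "\<exists>i. i \<in> K \<and> x' \<in> cball (fst i) (snd i) \<and> snd i < d'"
    if x': "x' \<in> ?T" and d': "0 < d'" for x' d'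
  proof -
    have "0 < min d' (min (x' - a) (b - x'))" using x' d' by simp
    then obtain y' where y': "y' \<noteq> x'" "\<bar>y' - x'\<bar> < min d' (min (x' - a) (b - x'))"
        "(f y' - f x') / (y' - x') > q"
      using x' unfolding frequently_at dist_real_def by blast
    define i where "i = ((x' + y') / 2, \<bar>y' - x'\<bar> / 2)"
    have cb: "cball (fst i) (snd i) = {min x' y'..max x' y'}"
      unfolding i_def by (simp add: cball_eq_Icc_min_max)
    have fs: "fst i + snd i = max x' y'" "fst i - snd i = min x' y'"
      unfolding i_def by (auto simp: min_def max_def abs_if field_simps)
    have "f (max x' y') - f (min x' y') \<ge> q * \<bar>y' - x'\<bar>"
      unfolding min_max_slope[OF y'(1)[symmetric]]
      using y'(3) by (intro mult_right_mono) auto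
    then have "i \<in> K"
      unfolding K_def mem_Collect_eq fs cb using y' x' by (auto simp: i_def min_def max_def abs_if split: if_splits)
    moreover have "x' \<in> cball (fst i) (snd i)" unfolding cb by auto
    moreover have "snd i < d'" using y' by (auto simp: i_def)
    ultimately show ?thesis by blast
  qed
  have rpos: "0 < snd i" if "i \<in> K" for i using that unfolding K_def by blast
  obtain C where C: "countable C" "C \<subseteq> K"
      "pairwise (\<lambda>i j. disjnt (cball (fst i) (snd i)) (cball (fst j) (snd j))) C"
      "negligible (?T - (\<Union>i\<in>C. cball (fst i) (snd i)))"
    by (rule Vitali_covering_theorem_cballs[of K snd ?T fst, OF rpos fine])
  have disj: "disjoint_family_on (\<lambda>i. cball (fst i) (snd i)) C"
    using C(3) unfolding disjoint_family_on_def pairwise_def disjnt_def by blast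
  let ?V = "\<Union>i\<in>C. cball (fst i) (snd i)"
  let ?N = "(?T - ?V) \<union> {a, b}"
  define U where "U = ?V \<union> ?N"
  \<comment> \<open>The Stieltjes measure of f turns the sum of the growths over countably many
    disjoint intervals into the mass of their union.\<close>
  let ?F = "interval_measure f"
  have V: "?V \<in> sets borel" using C(1) by (intro sets.countable_UN') auto
  have N: "?N \<in> null_sets lebesgue"
    using C(4) by (auto simp: negligible_iff_null_sets[symmetric] intro!: negligible_Un)
  have le: "emeasure lebesgue (cball (fst i) (snd i)) \<le> ennreal (1 / q) * emeasure ?F (cball (fst i) (snd i))"
    if "i \<in> C" for i
  proof -
    have i: "0 < snd i" "f (fst i + snd i) - f (fst i - snd i) \<ge> q * (2 * snd i)"
      using that C(2) unfolding K_def by auto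
    have "emeasure lebesgue (cball (fst i) (snd i)) = ennreal (2 * snd i)"
      using i by (simp add: cball_eq_atLeastAtMost)
    also have "\<dots> \<le> ennreal (1 / q * (f (fst i + snd i) - f (fst i - snd i)))"
      using i pq by (intro ennreal_leI) (simp add: field_simps)
    also have "\<dots> = ennreal (1 / q) * ennreal (f (fst i + snd i) - f (fst i - snd i))"
      using pq by (intro ennreal_mult') simp
    also have "ennreal (f (fst i + snd i) - f (fst i - snd i)) = emeasure ?F (cball (fst i) (snd i))"
      using i mono cont by (simp add: cball_eq_atLeastAtMost emeasure_interval_measure_Icc)
    finally show ?thesis .
  qed
  have "emeasure lebesgue U = emeasure lebesgue ?V"
    unfolding U_def using N V by (intro emeasure_Un_null_set) auto
  also have "\<dots> = (\<integral>\<^sup>+i. emeasure lebesgue (cball (fst i) (snd i)) \<partial>count_space C)"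
    by (rule emeasure_UN_countable) (use C(1) disj in auto)
  also have "\<dots> \<le> (\<integral>\<^sup>+i. ennreal (1 / q) * emeasure ?F (cball (fst i) (snd i)) \<partial>count_space C)"
    using le by (intro nn_integral_mono) simp
  also have "\<dots> = ennreal (1 / q) * (\<integral>\<^sup>+i. emeasure ?F (cball (fst i) (snd i)) \<partial>count_space C)"
    by (rule nn_integral_cmult) auto
  also have "(\<integral>\<^sup>+i. emeasure ?F (cball (fst i) (snd i)) \<partial>count_space C) = emeasure ?F ?V"
    by (rule emeasure_UN_countable[symmetric]) (use C(1) disj in auto)
  also have "\<dots> \<le> emeasure ?F {a..b}"
    using C(2) unfolding K_def by (intro emeasure_mono) auto
  also have "\<dots> = f b - f a"
    using ab mono cont by (simp add: emeasure_interval_measure_Icc)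
  also have "ennreal (1 / q) * ennreal (f b - f a) = ennreal (1 / q * (f b - f a))"
    using pq by (intro ennreal_mult'[symmetric]) simp
  also have "\<dots> \<le> ennreal (p / q * (b - a))"
    using divide_right_mono[OF inc, of q] pq by (intro ennreal_leI) simp
  finally have U: "emeasure lebesgue U \<le> ennreal (p / q * (b - a))" by (simp add: mult_left_mono)
  have cb: "cball ((x + y) / 2) (\<bar>y - x\<bar> / 2) = {a..b}"
    unfolding a_def b_def by (rule cball_eq_Icc_min_max)
  have "emeasure lebesgue U \<le> ennreal (p / q) * emeasure lebesgue (cball ((x + y) / 2) (\<bar>y - x\<bar> / 2))"
  proof -
    have "ennreal (p / q * (b - a)) = ennreal (p / q) * ennreal (b - a)"
      using pq ab(1) by (intro ennreal_mult) auto
    then show ?thesis using U ab(1) unfolding cb by simp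
  qed
  moreover have "?E \<inter> cball ((x + y) / 2) (\<bar>y - x\<bar> / 2) \<subseteq> U"
    unfolding cb U_def by (auto simp: less_le)
  moreover have "x \<in> cball ((x + y) / 2) (\<bar>y - x\<bar> / 2)" unfolding cb by (simp add: a_def b_def)
  moreover have "U \<in> sets lebesgue"
    unfolding U_def using V by (intro sets.Un null_setsD2[OF N]) simp
  moreover have "0 < \<bar>y - x\<bar> / 2" "\<bar>y - x\<bar> / 2 < d" using y by auto
  ultimately show "\<exists>z r U. 0 < r \<and> r < d \<and> x \<in> cball z r \<and> ?E \<inter> cball z r \<subseteq> U \<and>
       U \<in> sets lebesgue \<and> emeasure lebesgue U \<le> ennreal (p / q) * emeasure lebesgue (cball z r)"
    by (intro exI[of _ "(x + y) / 2"] exI[of _ "\<bar>y - x\<bar> / 2"] exI[of _ U]) blast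
qed (use pq in auto)

text \<open>Adding L x makes f non-decreasing with slopes in [0, 2 L]. Where the lower and the upper
  limit of the slope differ, two positive rationals lie strictly between them, so the points of
  non-differentiability lie in countably many of the sets of
  \<open>negligible_slope_gap\<close>.\<close>

lemma negligible_lipschitz_not_differentiable_real:
  fixes f :: "real \<Rightarrow> real"
  assumes f: "L-lipschitz_on UNIV f"
  shows "negligible {x. \<not> (\<exists>D. (f has_real_derivative D) (at x))}" (is "negligible ?N")
proof -
  have L: "0 \<le> L" using f lipschitz_on_nonneg by blast
  have fL: "\<bar>f y - f x\<bar> \<le> L * \<bar>y - x\<bar>" for x y
    using lipschitz_onD[OF f, of y x] by (simp add: dist_real_def)
  define g where "g x = f x + L * x" for x
  have mono: "g x \<le> g y" if "x \<le> y" for x y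
    using fL[of y x] that by (simp add: g_def algebra_simps)
  have cont: "continuous_on UNIV g"
    unfolding g_def by (intro continuous_intros lipschitz_on_continuous_on[OF f])
  define E where "E = (\<lambda>p q. {x. (\<exists>\<^sub>F y in at x. (g y - g x) / (y - x) < p) \<and>
                        (\<exists>\<^sub>F y in at x. (g y - g x) / (y - x) > q)})"
  have "?N \<subseteq> (\<Union>(p,q) \<in> {(p,q). p \<in> \<rat> \<and> q \<in> \<rat> \<and> 0 < p \<and> p < q}. E p q)"
  proof (rule ccontr)
    assume "\<not> ?thesis"
    then obtain x where x: "x \<in> ?N" and nE: "\<And>p q. p \<in> \<rat> \<Longrightarrow> q \<in> \<rat> \<Longrightarrow> 0 < p \<Longrightarrow> p < q \<Longrightarrow> x \<notin> E p q"
      by blast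
    define \<sigma> where "\<sigma> y = (g y - g x) / (y - x)" for y
    have s0: "0 \<le> \<sigma> y" for y
      using mono[of x y] mono[of y x] unfolding \<sigma>_def by (cases "x \<le> y") (auto intro: divide_nonpos_nonpos)
    have s1: "\<sigma> y \<le> 2 * L" for y
    proof (cases "y = x")
      case False
      have "\<bar>g y - g x\<bar> \<le> 2 * L * \<bar>y - x\<bar>"
      proof -
        have "\<bar>g y - g x\<bar> \<le> \<bar>f y - f x\<bar> + \<bar>L * (y - x)\<bar>"
          using abs_triangle_ineq[of "f y - f x" "L * (y - x)"] by (simp add: g_def algebra_simps)
        then show ?thesis using fL[of y x] L by (simp add: abs_mult)
      qed
      then have "\<bar>\<sigma> y\<bar> \<le> 2 * L" using False unfolding \<sigma>_def by (simp add: abs_divide field_simps)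
      then show ?thesis by simp
    qed (use L in \<open>simp add: \<sigma>_def\<close>)
    let ?li = "Liminf (at x) (\<lambda>y. ereal (\<sigma> y))" and ?ls = "Limsup (at x) (\<lambda>y. ereal (\<sigma> y))"
    have li: "0 \<le> ?li" using s0 by (intro Liminf_bounded) auto
    have ls: "?ls \<le> ereal (2 * L)" using s1 by (intro Limsup_bounded) auto
    have lils: "?li \<le> ?ls" by (rule Liminf_le_Limsup) simp
    have "?ls \<le> ?li"
    proof (rule ccontr)
      assume "\<not> ?thesis"
      then obtain r1 where r1: "?li < ereal r1" "ereal r1 < ?ls" by (metis ereal_dense2 not_le)
      then obtain r2 where r2: "r1 < r2" "ereal r2 < ?ls" by (metis ereal_dense2 ereal_less_eq(3) less_ereal.simps(1))
      obtain p where p: "p \<in> \<rat>" "r1 < p" "p < (r1 + r2) / 2" using Rats_dense_in_real[of r1 "(r1+r2)/2"] r2 by auto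
      obtain q where q: "q \<in> \<rat>" "(r1 + r2) / 2 < q" "q < r2" using Rats_dense_in_real[of "(r1+r2)/2" r2] r2 by auto
      have "0 < r1" using li r1(1) by (metis ereal_less(2) le_less_trans)
      then have "x \<notin> E p q" using nE p q by auto
      then have "(\<forall>\<^sub>F y in at x. p \<le> \<sigma> y) \<or> (\<forall>\<^sub>F y in at x. \<sigma> y \<le> q)"
        unfolding E_def \<sigma>_def by (simp add: not_frequently not_less)
      then show False
      proof
        assume "\<forall>\<^sub>F y in at x. p \<le> \<sigma> y"
        then have "ereal p \<le> ?li" by (intro Liminf_bounded) simp
        then show False using r1(1) p(2) by (meson ereal_less_eq(3) less_le_not_le order.strict_trans1 order_trans less_imp_le)
      next
        assume "\<forall>\<^sub>F y in at x. \<sigma> y \<le> q"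
        then have "?ls \<le> ereal q" by (intro Limsup_bounded) simp
        then show False using r2(2) q(3) by (meson ereal_less_eq(3) less_le_not_le order_trans less_imp_le)
      qed
    qed
    with lils have eq: "?li = ?ls" by simp
    obtain D where D: "?ls = ereal D"
      using li ls lils by (cases ?ls) auto
    have "((\<lambda>y. ereal (\<sigma> y)) \<longlongrightarrow> ereal D) (at x)"
      using eq D by (intro Liminf_eq_Limsup) auto
    then have "(\<sigma> \<longlongrightarrow> D) (at x)" by simp
    then have "(g has_real_derivative D) (at x)"
      unfolding has_field_derivative_iff \<sigma>_def .
    then have "((\<lambda>y. g y - L * y) has_real_derivative D - L) (at x)"
      by (auto intro!: derivative_eq_intros)
    then show False using x by (auto simp: g_def)
  qed
  moreover have "negligible (\<Union>(p,q) \<in> {(p,q). p \<in> \<rat> \<and> q \<in> \<rat> \<and> 0 < p \<and> p < q}. E p q)"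
  proof -
    have "countable ({(p,q). p \<in> \<rat> \<and> q \<in> \<rat> \<and> 0 < p \<and> p < q} :: (real \<times> real) set)"
      by (rule countable_subset[of _ "\<rat> \<times> \<rat>"]) (auto simp: countable_rat)
    then show ?thesis
      unfolding negligible_iff_null_sets
      by (rule null_sets_UN')
        (use negligible_slope_gap[OF mono cont] in \<open>auto simp: E_def negligible_iff_null_sets\<close>)
  qed
  ultimately show ?thesis using negligible_subset by blast
qed

subsection \<open>Rademacher's theorem\<close>

text \<open>Fubini without coordinates: averaging over the translations by t b with 0 \<le> t \<le>
  1 leaves the measure of N unchanged, and after exchanging the integrals the inner one runs along a
  line.\<close>

lemma null_sets_lborel_if_null_on_lines:
  fixes N :: "'a::euclidean_space set"
  assumes N: "N \<in> sets borel" and lines: "\<And>x. {t. x + t *\<^sub>R b \<in> N} \<in> null_sets lborel"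
  shows "N \<in> null_sets lborel"
proof -
  have [measurable]: "N \<in> sets borel" by (fact N)
  have shift: "(\<integral>\<^sup>+x. indicator N (x + t *\<^sub>R b) \<partial>lborel) = emeasure lborel N" for t
  proof -
    have "emeasure lborel N = (\<integral>\<^sup>+x. indicator N x \<partial>distr lborel borel ((+) (t *\<^sub>R b)))"
      by (simp add: lborel_distr_plus)
    also have "\<dots> = (\<integral>\<^sup>+x. indicator N (t *\<^sub>R b + x) \<partial>lborel)"
      by (subst nn_integral_distr) auto
    finally show ?thesis by (simp add: add.commute)
  qed
  have "emeasure lborel N = (\<integral>\<^sup>+t. emeasure lborel N * indicator {0..1::real} t \<partial>lborel)"
    by (simp add: nn_integral_cmult)
  also have "\<dots> = (\<integral>\<^sup>+t. (\<integral>\<^sup>+x. indicator N (x + t *\<^sub>R b) * indicator {0..1::real} t \<partial>lborel) \<partial>lborel)"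
    by (simp add: shift nn_integral_multc)
  also have "\<dots> = (\<integral>\<^sup>+x. (\<integral>\<^sup>+t. indicator N (x + t *\<^sub>R b) * indicator {0..1::real} t \<partial>lborel) \<partial>lborel)"
    by (rule lborel_pair.Fubini') measurable
  also have "\<dots> = (\<integral>\<^sup>+x. 0 \<partial>(lborel :: 'a measure))"
  proof (rule nn_integral_cong)
    fix x :: 'a
    have "(\<integral>\<^sup>+t. indicator N (x + t *\<^sub>R b) * indicator {0..1::real} t \<partial>lborel)
        \<le> (\<integral>\<^sup>+t. indicator {t. x + t *\<^sub>R b \<in> N} t \<partial>lborel)"
      by (intro nn_integral_mono) (auto split: split_indicator)
    also have "\<dots> = 0" using lines[of x] by auto
    finally show "(\<integral>\<^sup>+t. indicator N (x + t *\<^sub>R b) * indicator {0..1::real} t \<partial>lborel) = 0" by simp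
  qed
  finally show ?thesis by auto
qed

text \<open>Each line meets the exceptional set in a null set, by the one-dimensional result. For
  Fubini that set must also be Borel: the Cauchy criterion for difference quotients describes its
  complement through the closed sets \<open>A k j\<close> by countable unions and
  intersections.\<close>

lemma negligible_no_directional_derivative:
  fixes f :: "'a::euclidean_space \<Rightarrow> real"
  assumes f: "L-lipschitz_on UNIV f"
  shows "negligible {x. \<not> (\<exists>D. ((\<lambda>t. f (x + t *\<^sub>R b)) has_real_derivative D) (at 0))}"
proof -
  define \<sigma> where "\<sigma> t x = (f (x + t *\<^sub>R b) - f x) / t" for t x
  define A where "A k j = {x. \<forall>s t. s \<noteq> 0 \<and> t \<noteq> 0 \<and> \<bar>s\<bar> < 1 / Suc j \<and> \<bar>t\<bar> < 1 / Suc j \<longrightarrow>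
      \<bar>\<sigma> s x - \<sigma> t x\<bar> \<le> 1 / Suc k}" for k j
  define N where "N = - (\<Inter>k. \<Union>j. A k j)"
  have contf: "continuous_on UNIV f" by (rule lipschitz_on_continuous_on[OF f])
  have "closed (A k j)" for k j
  proof -
    have "A k j = (\<Inter>(s,t)\<in>{(s,t). s \<noteq> 0 \<and> t \<noteq> 0 \<and> \<bar>s\<bar> < 1 / Suc j \<and> \<bar>t\<bar> < 1 / Suc j}. {x. \<bar>\<sigma> s x - \<sigma> t x\<bar> \<le> 1 / Suc k})"
      unfolding A_def by auto
    moreover have "closed {x. \<bar>\<sigma> s x - \<sigma> t x\<bar> \<le> 1 / Suc k}" if "s \<noteq> 0" "t \<noteq> 0" for s t
      unfolding \<sigma>_def using that
      by (intro closed_Collect_le continuous_intros continuous_on_compose2[OF contf]) auto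
    ultimately show ?thesis by (auto intro!: closed_INT)
  qed
  then have N: "N \<in> sets borel" unfolding N_def by auto
  have lim_iff: "x \<notin> N \<longleftrightarrow> (\<exists>D. ((\<lambda>t. \<sigma> t x) \<longlongrightarrow> D) (at 0))" for x
  proof
    assume "x \<notin> N"
    then have "\<forall>k. \<exists>j. x \<in> A k j" unfolding N_def by blast
    then obtain j where j: "\<And>k. x \<in> A k (j k)" by metis
    have jD: "\<bar>\<sigma> s x - \<sigma> t x\<bar> \<le> 1 / Suc k" if "s \<noteq> 0" "t \<noteq> 0" "\<bar>s\<bar> < 1 / Suc (j k)" "\<bar>t\<bar> < 1 / Suc (j k)" for k s t
      using j[of k] that unfolding A_def by blast
    \<comment> \<open>Only a candidate for the limit: these quotients form a Cauchy sequence, and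
      its limit is then shown to be that of all difference quotients.\<close>
    define y where "y n = \<sigma> (1 / Suc n) x" for n
    have ylt: "\<bar>1 / real (Suc n)\<bar> < 1 / Suc (j k)" if "n > j k" for n k
      using that by (simp add: field_simps)
    have "Cauchy y"
    proof (rule metric_CauchyI)
      fix e :: real assume "0 < e"
      then obtain k where k: "1 / Suc k < e" using nat_approx_posE by blast
      show "\<exists>M. \<forall>m\<ge>M. \<forall>n\<ge>M. dist (y m) (y n) < e"
      proof (intro exI allI impI)
        fix m n assume "m \<ge> Suc (j k)" "n \<ge> Suc (j k)"
        then have "\<bar>y m - y n\<bar> \<le> 1 / Suc k" unfolding y_def by (intro jD ylt) auto
        then show "dist (y m) (y n) < e" using k by (simp add: dist_real_def)
      qed
    qed
    then obtain D where D: "y \<longlonglongrightarrow> D" using Cauchy_convergent convergent_def by blast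
    have lim: "\<bar>\<sigma> t x - D\<bar> \<le> 1 / Suc k" if t: "t \<noteq> 0" "\<bar>t\<bar> < 1 / Suc (j k)" for k t
    proof (rule Lim_bounded)
      show "(\<lambda>n. \<bar>\<sigma> t x - y n\<bar>) \<longlonglongrightarrow> \<bar>\<sigma> t x - D\<bar>" by (intro tendsto_intros D)
      show "\<forall>n\<ge>Suc (j k). \<bar>\<sigma> t x - y n\<bar> \<le> 1 / Suc k"
        unfolding y_def using t by (intro allI impI jD ylt) auto
    qed
    have "((\<lambda>t. \<sigma> t x) \<longlongrightarrow> D) (at 0)"
      unfolding tendsto_iff eventually_at dist_real_def
    proof (intro allI impI)
      fix e :: real assume "0 < e"
      then obtain k where k: "1 / Suc k < e" using nat_approx_posE by blast
      show "\<exists>d>0. \<forall>t\<in>UNIV. t \<noteq> 0 \<and> \<bar>t - 0\<bar> < d \<longrightarrow> \<bar>\<sigma> t x - D\<bar> < e"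
      proof (intro exI[of _ "1 / Suc (j k)"] conjI ballI impI)
        fix t :: real assume "t \<noteq> 0 \<and> \<bar>t - 0\<bar> < 1 / Suc (j k)"
        then show "\<bar>\<sigma> t x - D\<bar> < e" using lim[of t k] k by simp
      qed simp
    qed
    then show "\<exists>D. ((\<lambda>t. \<sigma> t x) \<longlongrightarrow> D) (at 0)" by blast
  next
    assume "\<exists>D. ((\<lambda>t. \<sigma> t x) \<longlongrightarrow> D) (at 0)"
    then obtain D where D: "((\<lambda>t. \<sigma> t x) \<longlongrightarrow> D) (at 0)" by blast
    have "\<exists>j. x \<in> A k j" for k
    proof -
      define \<epsilon> where "\<epsilon> = 1 / Suc k"
      obtain d where d: "d > 0" "\<And>t. t \<noteq> 0 \<Longrightarrow> \<bar>t\<bar> < d \<Longrightarrow> \<bar>\<sigma> t x - D\<bar> < \<epsilon> / 2"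
        using D[unfolded tendsto_iff eventually_at dist_real_def, rule_format, of "\<epsilon> / 2"]
        by (auto simp: \<epsilon>_def)
      obtain j where j: "1 / Suc j < d" using d nat_approx_posE by blast
      have "x \<in> A k j" unfolding A_def \<epsilon>_def[symmetric]
      proof (clarify)
        fix s t :: real assume *: "s \<noteq> 0" "t \<noteq> 0" "\<bar>s\<bar> < 1 / Suc j" "\<bar>t\<bar> < 1 / Suc j"
        then have "\<bar>\<sigma> s x - D\<bar> < \<epsilon> / 2" "\<bar>\<sigma> t x - D\<bar> < \<epsilon> / 2" using d(2) j by auto
        then show "\<bar>\<sigma> s x - \<sigma> t x\<bar> \<le> \<epsilon>" by linarith
      qed
      then show ?thesis ..
    qed
    then show "x \<notin> N" unfolding N_def by blast
  qed
  have deriv_iff: "(\<exists>D. ((\<lambda>t. f (x + t *\<^sub>R b)) has_real_derivative D) (at 0)) \<longleftrightarrow> x \<notin> N" for x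
    unfolding lim_iff has_field_derivative_iff \<sigma>_def by simp
  have "N \<in> null_sets lborel"
  proof (rule null_sets_lborel_if_null_on_lines[OF N])
    fix x
    define g where "g t = f (x + t *\<^sub>R b)" for t
    have "(L * norm b)-lipschitz_on UNIV g"
    proof (rule lipschitz_onI)
      fix s t :: real
      have "dist (g s) (g t) \<le> L * dist (x + s *\<^sub>R b) (x + t *\<^sub>R b)"
        unfolding g_def by (rule lipschitz_onD[OF f]) auto
      also have "dist (x + s *\<^sub>R b) (x + t *\<^sub>R b) = norm b * dist s t"
        by (simp add: dist_norm flip: scaleR_diff_left)
      finally show "dist (g s) (g t) \<le> L * norm b * dist s t" by (simp add: mult.assoc)
    qed (use lipschitz_on_nonneg[OF f] in auto)
    then have neg: "negligible {t. \<not> (\<exists>D. (g has_real_derivative D) (at t))}"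
      by (rule negligible_lipschitz_not_differentiable_real)
    have "{t. x + t *\<^sub>R b \<in> N} \<subseteq> {t. \<not> (\<exists>D. (g has_real_derivative D) (at t))}"
    proof clarify
      fix t D assume t: "x + t *\<^sub>R b \<in> N" and D: "(g has_real_derivative D) (at t)"
      have "((\<lambda>u. g (u + t)) has_real_derivative D) (at 0)"
        using D DERIV_shift[of g D 0 t] by simp
      then have "((\<lambda>u. f ((x + t *\<^sub>R b) + u *\<^sub>R b)) has_real_derivative D) (at 0)"
        unfolding g_def by (simp add: algebra_simps)
      then show False using deriv_iff t by blast
    qed
    then have "negligible {t. x + t *\<^sub>R b \<in> N}" using neg negligible_subset by blast
    moreover have "{t. x + t *\<^sub>R b \<in> N} \<in> sets borel"
      using measurable_sets[of "\<lambda>t. x + t *\<^sub>R b" borel borel N] N by (simp add: vimage_def)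
    ultimately show "{t. x + t *\<^sub>R b \<in> N} \<in> null_sets lborel"
      by (simp add: negligible_iff_null_sets null_sets_completion_iff)
  qed
  then have "negligible N" by (simp add: negligible_iff_null_sets null_sets_completionI)
  then show ?thesis using deriv_iff by simp
qed

text \<open>If balls of radius e |y - x| around points y arbitrarily near x miss A, then A has holes
  of fixed relative size at arbitrarily small scales around x. The points with this property for a
  given e thus form a set of deficient density.\<close>

lemma negligible_porous:
  fixes A :: "'a::euclidean_space set"
  shows "negligible {x \<in> A. \<not> (\<forall>e>0. \<exists>d>0. \<forall>y. dist y x < d \<longrightarrow> (\<exists>z\<in>A. dist z y \<le> e * dist y x))}"
proof -
  define P where "P e = {x \<in> A. \<forall>d>0. \<exists>y. dist y x < d \<and> \<not> (\<exists>z\<in>A. dist z y \<le> e * dist y x)}" for e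
  have neg: "negligible (P e)" if e: "0 < e" "e \<le> 1" for e
  proof (rule negligible_if_deficient_density)
    \<comment> \<open>The hole of radius e \<rho> fills the fraction (e/2)^n of the ball of radius 2
      \<rho> around x, where n is the dimension; e \<le> 1 keeps the hole inside that ball.\<close>
    let ?c = "1 - (e / 2) ^ DIM('a)"
    have "(e / 2) ^ DIM('a) \<le> e / 2" using e power_decreasing[of 1 "DIM('a)" "e / 2"]
      by (simp add: Suc_leI)
    then show c: "0 < ?c" using e by simp
    show "?c < 1" using e by simp
    fix x :: 'a and d :: real assume x: "x \<in> P e" and d: "0 < d"
    have "\<forall>d>0. \<exists>y. dist y x < d \<and> \<not> (\<exists>z\<in>A. dist z y \<le> e * dist y x)" using x unfolding P_def by blast
    from this[rule_format, of "d / 2"] obtain y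
      where y: "dist y x < d / 2" "\<not> (\<exists>z\<in>A. dist z y \<le> e * dist y x)"
      using d by auto
    define \<rho> where "\<rho> = dist y x"
    have "y \<noteq> x" using y(2) x unfolding P_def by auto
    then have \<rho>: "0 < \<rho>" "2 * \<rho> < d" using y by (auto simp: \<rho>_def)
    have sub: "cball y (e * \<rho>) \<subseteq> cball x (2 * \<rho>)"
    proof
      fix z assume "z \<in> cball y (e * \<rho>)"
      then have "dist y z \<le> e * \<rho>" by simp
      also have "\<dots> \<le> 1 * \<rho>" using e \<rho> by (intro mult_right_mono) auto
      finally have "dist y z \<le> \<rho>" by simp
      then show "z \<in> cball x (2 * \<rho>)" using dist_triangle[of x z y] by (simp add: \<rho>_def dist_commute)
    qed
    let ?U = "cball x (2 * \<rho>) - cball y (e * \<rho>)"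
    have eq: "(e / 2) ^ DIM('a) * (2 * \<rho>) ^ DIM('a) = (e * \<rho>) ^ DIM('a)"
      unfolding power_mult_distrib[symmetric] by simp
    have "emeasure lebesgue ?U = emeasure lebesgue (cball x (2 * \<rho>)) - emeasure lebesgue (cball y (e * \<rho>))"
      using sub emeasure_bounded_finite[of "cball y (e * \<rho>)"] by (intro emeasure_Diff) auto
    also have "\<dots> = ennreal (unit_ball_vol (DIM('a)) * (2 * \<rho>) ^ DIM('a)) - ennreal (unit_ball_vol (DIM('a)) * (e * \<rho>) ^ DIM('a))"
      using \<rho> e by (simp add: emeasure_cball)
    also have "\<dots> = ennreal (unit_ball_vol (DIM('a)) * (2 * \<rho>) ^ DIM('a) - unit_ball_vol (DIM('a)) * (e * \<rho>) ^ DIM('a))"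
      using \<rho> e by (intro ennreal_minus) auto
    also have "\<dots> = ennreal (?c * (unit_ball_vol (DIM('a)) * (2 * \<rho>) ^ DIM('a)))"
      unfolding eq[symmetric] by (simp add: algebra_simps)
    also have "\<dots> = ennreal ?c * emeasure lebesgue (cball x (2 * \<rho>))"
      using \<rho> c by (simp add: emeasure_cball ennreal_mult')
    finally have "emeasure lebesgue ?U \<le> ennreal ?c * emeasure lebesgue (cball x (2 * \<rho>))" by simp
    moreover have "P e \<inter> cball x (2 * \<rho>) \<subseteq> ?U"
      using y(2) unfolding P_def \<rho>_def by (auto simp: dist_commute)
    moreover have "?U \<in> sets lebesgue" by simp
    ultimately show "\<exists>z r U. 0 < r \<and> r < d \<and> x \<in> cball z r \<and> P e \<inter> cball z r \<subseteq> U \<and>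
       U \<in> sets lebesgue \<and> emeasure lebesgue U \<le> ennreal ?c * emeasure lebesgue (cball z r)"
      using \<rho> by (intro exI[of _ x] exI[of _ "2 * \<rho>"] exI[of _ ?U]) auto
  qed
  have "{x \<in> A. \<not> (\<forall>e>0. \<exists>d>0. \<forall>y. dist y x < d \<longrightarrow> (\<exists>z\<in>A. dist z y \<le> e * dist y x))} \<subseteq> (\<Union>n. P (1 / Suc n))"
  proof
    fix x assume "x \<in> {x \<in> A. \<not> (\<forall>e>0. \<exists>d>0. \<forall>y. dist y x < d \<longrightarrow> (\<exists>z\<in>A. dist z y \<le> e * dist y x))}"
    then obtain e where x: "x \<in> A" "0 < e" "\<not> (\<exists>d>0. \<forall>y. dist y x < d \<longrightarrow> (\<exists>z\<in>A. dist z y \<le> e * dist y x))"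
      by blast
    obtain n where n: "1 / Suc n < e" using x(2) nat_approx_posE by blast
    have le: "1 / Suc n * dist y x \<le> e * dist y x" for y using n by (intro mult_right_mono) auto
    have "\<exists>y. dist y x < d \<and> \<not> (\<exists>z\<in>A. dist z y \<le> 1 / Suc n * dist y x)" if d0: "d > 0" for d
    proof -
      obtain y where "dist y x < d" "\<not> (\<exists>z\<in>A. dist z y \<le> e * dist y x)" using x(3) d0 by blast
      then show ?thesis using le[of y] by (intro exI[of _ y]) force
    qed
    then have "x \<in> P (1 / Suc n)" using x(1) unfolding P_def by blast
    then show "x \<in> (\<Union>n. P (1 / Suc n))" by blast
  qed
  moreover have "negligible (\<Union>n. P (1 / Suc n))" by (intro negligible_Union_nat neg) auto
  ultimately show ?thesis using negligible_subset by blast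
qed

text \<open>Induction over the coordinates already moved. The estimate along the next coordinate is
  available at points of A only, so the current point is replaced by some z in A within \<epsilon>
  |h| of it. Changing the start and the end of the step in this way costs L \<epsilon> |h| each,
  whence the factor 1 + 2 L per coordinate.\<close>

lemma partial_approximations_imp_linear_approximation:
  fixes f :: "'a::euclidean_space \<Rightarrow> real"
  assumes f: "L-lipschitz_on UNIV f"
    and A: "\<And>x i t. x \<in> A \<Longrightarrow> i \<in> Basis \<Longrightarrow> \<bar>t\<bar> < \<delta> \<Longrightarrow> \<bar>f (x + t *\<^sub>R i) - f x - t * (a \<bullet> i)\<bar> \<le> \<epsilon> * \<bar>t\<bar>"
    and \<delta>: "0 < \<delta>" and \<epsilon>: "0 < \<epsilon>"
    and dense: "\<forall>e>0. \<exists>d>0. \<forall>y. dist y x < d \<longrightarrow> (\<exists>z\<in>A. dist z y \<le> e * dist y x)"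
  shows "\<exists>d>0. \<forall>h. norm h < d \<longrightarrow> \<bar>f (x + h) - f x - a \<bullet> h\<bar> \<le> DIM('a) * ((1 + 2 * L) * \<epsilon> * norm h)"
proof -
  have L: "0 \<le> L" using f lipschitz_on_nonneg by blast
  obtain d where d: "d > 0" "\<And>y. dist y x < d \<Longrightarrow> \<exists>z\<in>A. dist z y \<le> \<epsilon> * dist y x"
    using dense \<epsilon> by blast
  have "\<bar>f (x + (\<Sum>i\<in>B. (h \<bullet> i) *\<^sub>R i)) - f x - (\<Sum>i\<in>B. (a \<bullet> i) * (h \<bullet> i))\<bar> \<le> card B * ((1 + 2 * L) * \<epsilon> * norm h)"
    if h: "norm h < min d \<delta>" and B: "B \<subseteq> Basis" for h B
  proof -
    have "finite B" using B finite_subset finite_Basis by blast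
    then show ?thesis using B
    proof (induction B)
      case empty
      then show ?case by simp
    next
      case (insert j B)
      let ?y = "x + (\<Sum>i\<in>B. (h \<bullet> i) *\<^sub>R i)"
      have inner: "(\<Sum>i\<in>B. (h \<bullet> i) *\<^sub>R i) \<bullet> b = (if b \<in> B then h \<bullet> b else 0)" if "b \<in> Basis" for b
        using insert.prems insert.hyps that
        by (simp add: inner_sum_left inner_Basis if_distrib[of "\<lambda>u. _ * u"] subset_iff cong: if_cong sum.cong)
      have dy: "dist ?y x \<le> norm h"
        using norm_le_componentwise[of "\<Sum>i\<in>B. (h \<bullet> i) *\<^sub>R i" h] inner by (simp add: dist_norm)
      then obtain z where z: "z \<in> A" "dist z ?y \<le> \<epsilon> * dist ?y x" using d(2)[of ?y] h by auto
      have zy: "dist z ?y \<le> \<epsilon> * norm h" using z(2) dy \<epsilon> by (smt (verit) mult_left_mono)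
      have j: "j \<in> Basis" using insert.prems by simp
      have hj: "\<bar>h \<bullet> j\<bar> \<le> norm h" using Basis_le_norm[OF j] by blast
      have "\<bar>f (z + (h \<bullet> j) *\<^sub>R j) - f z - (h \<bullet> j) * (a \<bullet> j)\<bar> \<le> \<epsilon> * \<bar>h \<bullet> j\<bar>"
        using A[OF z(1) j] hj h by simp
      then have 1: "\<bar>f (z + (h \<bullet> j) *\<^sub>R j) - f z - (h \<bullet> j) * (a \<bullet> j)\<bar> \<le> \<epsilon> * norm h"
        using hj \<epsilon> by (smt (verit) mult_left_mono)
      have "\<bar>f z - f ?y\<bar> \<le> L * dist z ?y" using lipschitz_onD[OF f, of z ?y] by (simp add: dist_real_def)
      then have 2: "\<bar>f z - f ?y\<bar> \<le> L * \<epsilon> * norm h" using mult_left_mono[OF zy L] by (simp add: mult.assoc)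
      have "\<bar>f (z + (h \<bullet> j) *\<^sub>R j) - f (?y + (h \<bullet> j) *\<^sub>R j)\<bar> \<le> L * dist z ?y"
        using lipschitz_onD[OF f, of "z + (h \<bullet> j) *\<^sub>R j" "?y + (h \<bullet> j) *\<^sub>R j"] by (simp add: dist_real_def)
      then have 3: "\<bar>f (z + (h \<bullet> j) *\<^sub>R j) - f (?y + (h \<bullet> j) *\<^sub>R j)\<bar> \<le> L * \<epsilon> * norm h"
        using mult_left_mono[OF zy L] by (simp add: mult.assoc)
      have 4: "\<bar>f ?y - f x - (\<Sum>i\<in>B. (a \<bullet> i) * (h \<bullet> i))\<bar> \<le> card B * ((1 + 2 * L) * \<epsilon> * norm h)"
        using insert by simp
      have eq: "x + (\<Sum>i\<in>insert j B. (h \<bullet> i) *\<^sub>R i) = ?y + (h \<bullet> j) *\<^sub>R j"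
        using insert.hyps by (simp add: algebra_simps)
      have sum: "(\<Sum>i\<in>insert j B. (a \<bullet> i) * (h \<bullet> i)) = (\<Sum>i\<in>B. (a \<bullet> i) * (h \<bullet> i)) + (h \<bullet> j) * (a \<bullet> j)"
        using insert.hyps by (simp add: algebra_simps)
      have card: "card (insert j B) * ((1 + 2 * L) * \<epsilon> * norm h)
          = card B * ((1 + 2 * L) * \<epsilon> * norm h) + (\<epsilon> * norm h + L * \<epsilon> * norm h + L * \<epsilon> * norm h)"
        using insert.hyps by (simp add: algebra_simps)
      show ?case unfolding eq sum card using 1 2 3 4 by linarith
    qed
  qed
  note this[OF _ order_refl]
  moreover have "(\<Sum>i\<in>Basis. (a \<bullet> i) * (h \<bullet> i)) = a \<bullet> h" for h by (rule euclidean_inner[symmetric])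
  ultimately show ?thesis
    using d(1) \<delta> by (intro exI[of _ "min d \<delta>"]) (simp add: euclidean_representation)
qed

text \<open>Where the partial derivatives exist, \<open>f\<close> is almost linear along the
  coordinate directions uniformly on countably many sets; a point that is not porous for its set can be
  left along successive coordinate directions, each time restarting from a nearby point of the same set.\<close>

theorem negligible_lipschitz_not_GDERIV:
  fixes f :: "'a::euclidean_space \<Rightarrow> real"
  assumes f: "L-lipschitz_on UNIV f"
  shows "negligible {x. \<not> (\<exists>g. GDERIV f x :> g)}"
proof -
  have L: "0 \<le> L" using f lipschitz_on_nonneg by blast
  \<comment> \<open>The same vector a serves all coordinates. It will range over a countable dense
    set, with tolerance and scale among the reciprocals 1/(n+1), so that only countably many sets
    have to be freed of their porous points.\<close>
  define A where "A \<epsilon> a \<delta> = {x. \<forall>i\<in>Basis. \<forall>t. \<bar>t\<bar> < \<delta> \<longrightarrow> \<bar>f (x + t *\<^sub>R i) - f x - t * (a \<bullet> i)\<bar> \<le> \<epsilon> * \<bar>t\<bar>}"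
    for \<epsilon> a \<delta>
  define np where "np A x \<longleftrightarrow> (\<forall>e>0. \<exists>d>0. \<forall>y. dist y x < d \<longrightarrow> (\<exists>z\<in>A. dist z y \<le> e * dist y x))" for A and x :: 'a
  obtain D :: "'a set" where D: "countable D" "\<And>X. open X \<Longrightarrow> X \<noteq> {} \<Longrightarrow> \<exists>d\<in>D. d \<in> X"
    using countable_dense_exists by blast
  define N where "N = (\<Union>i\<in>Basis. {x. \<not> (\<exists>D. ((\<lambda>t. f (x + t *\<^sub>R i)) has_real_derivative D) (at 0))}) \<union>
     (\<Union>(k, a, j) \<in> UNIV \<times> D \<times> UNIV. {x \<in> A (1 / Suc k) a (1 / Suc j). \<not> np (A (1 / Suc k) a (1 / Suc j)) x})"
  have "negligible (\<Union>(k :: nat, a, j :: nat) \<in> UNIV \<times> D \<times> UNIV. {x \<in> A (1 / Suc k) a (1 / Suc j). \<not> np (A (1 / Suc k) a (1 / Suc j)) x})"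
    unfolding negligible_iff_null_sets using D(1) negligible_porous
    by (intro null_sets_UN') (auto simp: np_def negligible_iff_null_sets[symmetric])
  moreover have "negligible (\<Union>i\<in>Basis. {x. \<not> (\<exists>D. ((\<lambda>t. f (x + t *\<^sub>R i)) has_real_derivative D) (at 0))})"
    by (intro negligible_Union) (auto simp del: not_ex intro: negligible_no_directional_derivative[OF f])
  ultimately have neg: "negligible N" unfolding N_def by (rule negligible_Un[rotated])
  have main: "\<exists>g. GDERIV f x :> g" if x: "x \<notin> N" for x
  proof -
    have "\<forall>i\<in>Basis. \<exists>D. ((\<lambda>t. f (x + t *\<^sub>R i)) has_real_derivative D) (at 0)"
      using x unfolding N_def by blast
    then obtain pd where pd: "\<And>i. i \<in> Basis \<Longrightarrow> ((\<lambda>t. f (x + t *\<^sub>R i)) has_real_derivative pd i) (at 0)"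
      by metis
    define g where "g = (\<Sum>i\<in>Basis. pd i *\<^sub>R i)"
    have g: "g \<bullet> i = pd i" if "i \<in> Basis" for i using that by (simp add: g_def inner_sum_left_Basis)
    have "\<exists>d>0. \<forall>y. norm (y - x) < d \<longrightarrow> norm (f y - f x - (y - x) \<bullet> g) \<le> e * norm (y - x)" if e: "e > 0" for e
    proof -
      \<comment> \<open>The dimension times 1 + 2 L is the loss in the coordinatewise argument; the
        additional 1 pays for passing from a back to g.\<close>
      define C where "C = DIM('a) * (1 + 2 * L) + 1"
      have C: "C > 0" unfolding C_def using L by (intro add_nonneg_pos) auto
      obtain k where k: "1 / Suc k < e / C" using nat_approx_posE[of "e / C"] e C by auto
      define \<epsilon> where "\<epsilon> = 1 / Suc k"
      have \<epsilon>: "0 < \<epsilon>" "C * \<epsilon> \<le> e" using k C unfolding \<epsilon>_def by (auto simp: field_simps)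
      \<comment> \<open>The distance of a from the candidate gradient g uses up half of the
        tolerance, the error of the partial derivatives of f the other half.\<close>
      obtain a where a: "a \<in> D" "dist g a < \<epsilon> / 2"
        using D(2)[of "ball g (\<epsilon> / 2)"] \<epsilon> by auto
      have ga: "norm (g - a) < \<epsilon> / 2" using a by (simp add: dist_norm)
      have "\<exists>d>0. \<forall>t. \<bar>t\<bar> < d \<longrightarrow> \<bar>f (x + t *\<^sub>R i) - f x - t * pd i\<bar> \<le> \<epsilon> / 2 * \<bar>t\<bar>" if "i \<in> Basis" for i
        using pd[OF that] \<epsilon> unfolding has_field_derivative_def has_derivative_at_alt
        by (force simp: mult.commute dest!: spec[of _ "\<epsilon> / 2"])
      then obtain d where d: "\<And>i. i \<in> Basis \<Longrightarrow> 0 < d i"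
          "\<And>i t. i \<in> Basis \<Longrightarrow> \<bar>t\<bar> < d i \<Longrightarrow> \<bar>f (x + t *\<^sub>R i) - f x - t * pd i\<bar> \<le> \<epsilon> / 2 * \<bar>t\<bar>"
        by metis
      define m where "m = Min (d ` Basis)"
      have m: "0 < m" "\<And>i. i \<in> Basis \<Longrightarrow> m \<le> d i" unfolding m_def using d(1) by auto
      obtain j where j: "1 / Suc j < m" using nat_approx_posE m(1) by blast
      have xA: "x \<in> A \<epsilon> a (1 / Suc j)" unfolding A_def
      proof (intro CollectI ballI allI impI)
        fix i :: 'a and t :: real assume i: "i \<in> Basis" and t: "\<bar>t\<bar> < 1 / Suc j"
        have 1: "\<bar>f (x + t *\<^sub>R i) - f x - t * pd i\<bar> \<le> \<epsilon> / 2 * \<bar>t\<bar>" using d(2)[OF i] t j m(2)[OF i] by simp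
        have "\<bar>(g - a) \<bullet> i\<bar> \<le> \<epsilon> / 2" using Basis_le_norm[OF i, of "g - a"] ga by simp
        then have "\<bar>t\<bar> * \<bar>pd i - a \<bullet> i\<bar> \<le> \<bar>t\<bar> * (\<epsilon> / 2)" using g[OF i] by (intro mult_left_mono) (auto simp: inner_diff_left)
        then have 2: "\<bar>t * pd i - t * (a \<bullet> i)\<bar> \<le> \<epsilon> / 2 * \<bar>t\<bar>" by (simp add: abs_mult[symmetric] algebra_simps)
        show "\<bar>f (x + t *\<^sub>R i) - f x - t * (a \<bullet> i)\<bar> \<le> \<epsilon> * \<bar>t\<bar>" using 1 2 by linarith
      qed
      have "x \<notin> {x \<in> A (1 / Suc k) a (1 / Suc j). \<not> np (A (1 / Suc k) a (1 / Suc j)) x}"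
        using x a(1) unfolding N_def by blast
      then have np: "np (A \<epsilon> a (1 / Suc j)) x" using xA unfolding \<epsilon>_def by blast
      have "\<exists>d>0. \<forall>h. norm h < d \<longrightarrow> \<bar>f (x + h) - f x - a \<bullet> h\<bar> \<le> DIM('a) * ((1 + 2 * L) * \<epsilon> * norm h)"
        using np \<epsilon>(1) unfolding np_def
        by (intro partial_approximations_imp_linear_approximation[OF f, of "A \<epsilon> a (1 / Suc j)" "1 / Suc j"])
          (auto simp: A_def)
      then obtain d where d: "d > 0" "\<And>h. norm h < d \<Longrightarrow> \<bar>f (x + h) - f x - a \<bullet> h\<bar> \<le> DIM('a) * ((1 + 2 * L) * \<epsilon> * norm h)"
        by blast
      show ?thesis
      proof (intro exI[of _ d] conjI allI impI)
        fix y assume y: "norm (y - x) < d"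
        let ?h = "y - x"
        have 1: "\<bar>f y - f x - a \<bullet> ?h\<bar> \<le> DIM('a) * ((1 + 2 * L) * \<epsilon> * norm ?h)" using d(2)[OF y] by simp
        have "\<bar>(g - a) \<bullet> ?h\<bar> \<le> norm (g - a) * norm ?h" by (rule Cauchy_Schwarz_ineq2)
        also have "\<dots> \<le> \<epsilon> * norm ?h" using ga \<epsilon> by (intro mult_right_mono) auto
        finally have 2: "\<bar>?h \<bullet> g - a \<bullet> ?h\<bar> \<le> \<epsilon> * norm ?h" by (simp add: inner_diff_left inner_commute)
        have "\<bar>f y - f x - ?h \<bullet> g\<bar> \<le> C * \<epsilon> * norm ?h" using 1 2 unfolding C_def by (simp add: algebra_simps)
        also have "\<dots> \<le> e * norm ?h" using \<epsilon> by (intro mult_right_mono) auto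
        finally show "norm (f y - f x - ?h \<bullet> g) \<le> e * norm ?h" by simp
      qed (rule d(1))
    qed
    then have "GDERIV f x :> g"
      unfolding gderiv_def has_derivative_at_alt by (auto intro: bounded_linear_inner_left)
    then show ?thesis ..
  qed
  show ?thesis
  proof (rule negligible_subset[OF neg], rule subsetI)
    fix x assume "x \<in> {x. \<not> (\<exists>g. GDERIV f x :> g)}"
    then show "x \<in> N" using main[of x] by (cases "x \<in> N") simp_all
  qed
qed

subsection \<open>Level sets of non-degenerate Lipschitz functions\<close>

lemma GDERIV_imp_DERIV_line:
  assumes "GDERIV f x :> g"
  shows "((\<lambda>t. f (x + t *\<^sub>R e)) has_real_derivative g \<bullet> e) (at 0)"
proof -
  have "((\<lambda>t. x + t *\<^sub>R e) has_derivative (\<lambda>t. t *\<^sub>R e)) (at 0)"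
    by (auto intro!: derivative_eq_intros)
  moreover have "(f has_derivative (\<lambda>h. h \<bullet> g)) (at (x + 0 *\<^sub>R e))" using assms by (simp add: gderiv_def)
  ultimately have "((\<lambda>t. f (x + t *\<^sub>R e)) has_derivative (\<lambda>t. (t *\<^sub>R e) \<bullet> g)) (at 0)"
    by (rule has_derivative_compose)
  moreover have "(\<lambda>t. (t *\<^sub>R e) \<bullet> g) = (*) (g \<bullet> e)" by (auto simp: inner_commute)
  ultimately show ?thesis unfolding has_field_derivative_def by simp
qed

lemma GDERIV_difference_quotient:
  assumes "GDERIV f x :> g" "h \<longlonglongrightarrow> 0" "\<And>n. h n \<noteq> (0::real)"
  shows "(\<lambda>n. (f (x + h n *\<^sub>R e) - f x) / h n) \<longlonglongrightarrow> g \<bullet> e"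
proof -
  have "((\<lambda>t. (f (x + t *\<^sub>R e) - f x) / t) \<longlongrightarrow> g \<bullet> e) (at 0)"
    using GDERIV_imp_DERIV_line[OF assms(1), of e] unfolding has_field_derivative_iff by simp
  then show ?thesis
    using assms(2,3) unfolding tendsto_at_iff_sequentially comp_def by auto
qed

text \<open>The segment from x to x + t e may consist of points of non-differentiability. The
  integral over translates y in a small ball B remedies this: for each s, almost every x + s e + y
  is a point of differentiability, so by dominated convergence \<open>g\<close> is differentiable
  everywhere with derivative at least c |B|. Divided by |B|, it differs from f on the segment by at
  most L times the radius of B.\<close>

lemma increase_along_direction_of_gradients:
  fixes f :: "'a::euclidean_space \<Rightarrow> real"
  assumes f: "L-lipschitz_on UNIV f"
    and grad: "\<And>z g. z \<in> ball x0 r \<Longrightarrow> GDERIV f z :> g \<Longrightarrow> c \<le> g \<bullet> e"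
    and x: "x \<in> ball x0 r" "x + t *\<^sub>R e \<in> ball x0 r" and t: "0 \<le> t"
  shows "f x + c * t \<le> f (x + t *\<^sub>R e)"
proof (rule field_le_epsilon)
  fix \<epsilon> :: real assume \<epsilon>: "0 < \<epsilon>"
  have L: "0 \<le> L" using f lipschitz_on_nonneg by blast
  have fL: "\<bar>f y - f z\<bar> \<le> L * norm (y - z)" for y z
    using lipschitz_onD[OF f, of y z] by (simp add: dist_norm)
  have contf: "continuous_on UNIV f" by (rule lipschitz_on_continuous_on[OF f])
  then have [measurable]: "f \<in> borel_measurable borel" by (rule borel_measurable_continuous_onI)
  \<comment> \<open>The first bound keeps the translates of both end points, hence of the segment,
    in the ball; the second makes the total error 2 L \<rho> at most \<epsilon>.\<close>
  define \<rho> where "\<rho> = min (r - max (dist x0 x) (dist x0 (x + t *\<^sub>R e))) (\<epsilon> / (2 * L + 1))"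
  have \<rho>: "0 < \<rho>" using x \<epsilon> L by (simp add: \<rho>_def)
  have \<rho>L: "2 * L * \<rho> \<le> \<epsilon>"
  proof -
    have "2 * L * \<rho> \<le> (2 * L + 1) * (\<epsilon> / (2 * L + 1))"
      using L \<rho> by (intro mult_mono) (auto simp: \<rho>_def)
    then show ?thesis using L by simp
  qed
  define B where "B = ball (0::'a) \<rho>"
  have B[measurable]: "B \<in> sets borel" and Bpos: "measure lborel B > 0" and Bfin: "emeasure lborel B < \<infinity>"
    using \<rho> content_ball_pos[of \<rho> "0::'a"] emeasure_bounded_finite[of "ball (0::'a) \<rho>"] by (auto simp: B_def)
  have seg: "x + s *\<^sub>R e + y \<in> ball x0 r" if s: "0 \<le> s" "s \<le> t" and y: "y \<in> B" for s y
  proof -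
    have 1: "x + y \<in> ball x0 r" and 2: "x + t *\<^sub>R e + y \<in> ball x0 r"
      using norm_triangle_ineq[of "x - x0" y] norm_triangle_ineq[of "x + t *\<^sub>R e - x0" y] y
      by (auto simp: B_def \<rho>_def dist_norm norm_minus_commute algebra_simps)
    show ?thesis
    proof (cases "t = 0")
      case True then show ?thesis using 1 s by simp
    next
      case False
      have "(1 - s / t) *\<^sub>R (x + y) + (s / t) *\<^sub>R (x + t *\<^sub>R e + y) = x + s *\<^sub>R e + y"
        using False by (simp add: algebra_simps)
      moreover have "(1 - s / t) *\<^sub>R (x + y) + (s / t) *\<^sub>R (x + t *\<^sub>R e + y) \<in> ball x0 r"
        using s t False by (intro convexD[OF convex_ball 1 2]) auto
      ultimately show ?thesis by metis
    qed
  qed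
  define q where "q h z = (f (z + h *\<^sub>R e) - f z) / h" for h z
  have [measurable]: "q h \<in> borel_measurable borel" for h unfolding q_def by measurable
  have qb: "\<bar>q h z\<bar> \<le> L * norm e" for h z
  proof (cases "h = 0")
    case False
    have "\<bar>f (z + h *\<^sub>R e) - f z\<bar> \<le> L * norm e * \<bar>h\<bar>" using fL[of "z + h *\<^sub>R e" z] by (simp add: ac_simps)
    then show ?thesis using False by (simp add: q_def abs_divide field_simps)
  qed (use L in \<open>simp add: q_def\<close>)
  \<comment> \<open>Taken as a limit along one sequence for the sake of measurability; where f is
    differentiable, it is the inner product of the gradient with e.\<close>
  define G where "G z = lim (\<lambda>n. q (1 / Suc n) z)" for z
  have [measurable]: "G \<in> borel_measurable borel" unfolding G_def by measurable
  have inv0: "(\<lambda>n. 1 / real (Suc n)) \<longlonglongrightarrow> 0" by (rule LIMSEQ_Suc[OF lim_1_over_n])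
  have G: "G z = g \<bullet> e" if "GDERIV f z :> g" for z g
    unfolding G_def q_def by (rule limI, rule GDERIV_difference_quotient[OF that inv0]) simp
  have AEd: "AE y in lborel. \<exists>g. GDERIV f (w + y) :> g" for w
  proof -
    have "{y. \<not> (\<exists>g. GDERIV f (w + y) :> g)} \<subseteq> (+) (- w) ` {z. \<not> (\<exists>g. GDERIV f z :> g)}"
    proof
      fix y assume "y \<in> {y. \<not> (\<exists>g. GDERIV f (w + y) :> g)}"
      then show "y \<in> (+) (- w) ` {z. \<not> (\<exists>g. GDERIV f z :> g)}" by (intro image_eqI[of _ _ "w + y"]) auto
    qed
    then have "negligible {y. \<not> (\<exists>g. GDERIV f (w + y) :> g)}"
      using negligible_translation[OF negligible_lipschitz_not_GDERIV[OF f]] negligible_subset by blast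
    then have "AE y in lebesgue. \<exists>g. GDERIV f (w + y) :> g"
      unfolding negligible_iff_null_sets by (rule AE_I') auto
    then show ?thesis by (simp add: AE_completion_iff)
  qed
  have intB: "integrable lborel (\<lambda>y. indicator B y *\<^sub>R u y)"
    if "u \<in> borel_measurable borel" "\<And>y. y \<in> B \<Longrightarrow> \<bar>u y\<bar> \<le> b" for u :: "'a \<Rightarrow> real" and b
    using that Bfin by (intro integrableI_bounded_set_indicator[where B = b]) auto
  define g where "g s = (\<integral>y. indicator B y *\<^sub>R f (x + s *\<^sub>R e + y) \<partial>lborel)" for s
  have fB: "\<bar>f (w + y) - f w\<bar> \<le> L * \<rho>" if "y \<in> B" for w y
    using fL[of "w + y" w] that L mult_left_mono[of "norm y" \<rho> L] by (auto simp: B_def)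
  have intf: "integrable lborel (\<lambda>y. indicator B y *\<^sub>R f (w + y))" for w
  proof (rule intB)
    show "\<bar>f (w + y)\<bar> \<le> \<bar>f w\<bar> + L * \<rho>" if "y \<in> B" for y using fB[OF that, of w] by linarith
  qed measurable
  have deriv: "\<exists>D. (g has_real_derivative D) (at s) \<and> c * measure lborel B \<le> D" if s: "0 \<le> s" "s \<le> t" for s
  proof (intro exI conjI)
    let ?D = "\<integral>y. indicator B y *\<^sub>R G (x + s *\<^sub>R e + y) \<partial>lborel"
    have G_ae: "AE y in lborel. y \<in> B \<longrightarrow> c \<le> G (x + s *\<^sub>R e + y) \<and> \<bar>G (x + s *\<^sub>R e + y)\<bar> \<le> L * norm e"
      using AEd[of "x + s *\<^sub>R e"]
    proof eventually_elim
      case (elim y)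
      then obtain d where d: "GDERIV f (x + s *\<^sub>R e + y) :> d" by blast
      have "(\<lambda>n. q (1 / Suc n) (x + s *\<^sub>R e + y)) \<longlonglongrightarrow> d \<bullet> e"
        unfolding q_def by (rule GDERIV_difference_quotient[OF d inv0]) simp
      then have "(\<lambda>n. \<bar>q (1 / Suc n) (x + s *\<^sub>R e + y)\<bar>) \<longlonglongrightarrow> \<bar>d \<bullet> e\<bar>" by (rule tendsto_rabs)
      then have "\<bar>d \<bullet> e\<bar> \<le> L * norm e" using qb by (intro LIMSEQ_le_const2) auto
      then show ?case using grad[OF seg[OF s] d] G[OF d] by simp
    qed
    show "(g has_real_derivative ?D) (at s)"
      unfolding has_field_derivative_iff tendsto_at_iff_sequentially comp_def
    proof (intro allI impI)
      fix X assume X: "\<forall>i. X i \<in> UNIV - {s}" "X \<longlonglongrightarrow> s"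
      define h where "h i = X i - s" for i
      have h: "h \<longlonglongrightarrow> 0" "\<And>i. h i \<noteq> 0" using X LIM_zero[OF X(2)] by (auto simp: h_def[abs_def])
      have eq: "(g (X i) - g s) / (X i - s) = (\<integral>y. indicator B y *\<^sub>R q (h i) (x + s *\<^sub>R e + y) \<partial>lborel)" for i
      proof -
        have "indicator B y *\<^sub>R q (h i) (x + s *\<^sub>R e + y) =
            (indicator B y *\<^sub>R f (x + X i *\<^sub>R e + y) - indicator B y *\<^sub>R f (x + s *\<^sub>R e + y)) / h i" for y
        proof -
          have shift: "x + s *\<^sub>R e + y + h i *\<^sub>R e = x + X i *\<^sub>R e + y" by (simp add: h_def algebra_simps)
          show ?thesis unfolding q_def shift by (simp add: right_diff_distrib)
        qed
        then show ?thesis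
          unfolding g_def using intf[of "x + X i *\<^sub>R e"] intf[of "x + s *\<^sub>R e"] by (simp add: h_def)
      qed
      show "(\<lambda>i. (g (X i) - g s) / (X i - s)) \<longlonglongrightarrow> ?D"
        unfolding eq
      proof (rule integral_dominated_convergence[where w = "\<lambda>y. indicator B y *\<^sub>R (L * norm e)"])
        show "integrable lborel (\<lambda>y. indicator B y *\<^sub>R (L * norm e))"
          using L by (intro intB[of _ "L * norm e"]) auto
        show "AE y in lborel. (\<lambda>i. indicator B y *\<^sub>R q (h i) (x + s *\<^sub>R e + y)) \<longlonglongrightarrow> indicator B y *\<^sub>R G (x + s *\<^sub>R e + y)"
          using AEd[of "x + s *\<^sub>R e"]
        proof eventually_elim
          case (elim y)
          then obtain d where d: "GDERIV f (x + s *\<^sub>R e + y) :> d" by blast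
          show ?case unfolding G[OF d] q_def
            by (intro tendsto_scaleR tendsto_const GDERIV_difference_quotient[OF d h])
        qed
        show "AE y in lborel. norm (indicator B y *\<^sub>R q (h i) (x + s *\<^sub>R e + y)) \<le> indicator B y *\<^sub>R (L * norm e)" for i
          using qb by (intro AE_I2) (simp add: indicator_def)
      qed measurable
    qed
    have "c * measure lborel B = (\<integral>y. indicator B y *\<^sub>R c \<partial>lborel)" using Bfin by simp
    also have "\<dots> \<le> ?D"
    proof (rule integral_mono_AE)
      show "integrable lborel (\<lambda>y. indicator B y *\<^sub>R c)" by (intro intB[of _ "\<bar>c\<bar>"]) auto
      show "integrable lborel (\<lambda>y. indicator B y *\<^sub>R G (x + s *\<^sub>R e + y))"
      proof (rule Bochner_Integration.integrable_bound)
        show "integrable lborel (\<lambda>y. indicator B y *\<^sub>R (L * norm e))"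
          using L by (intro intB[of _ "L * norm e"]) auto
        show "AE y in lborel. norm (indicator B y *\<^sub>R G (x + s *\<^sub>R e + y)) \<le> norm (indicator B y *\<^sub>R (L * norm e))"
          using G_ae by eventually_elim (auto simp: indicator_def)
      qed measurable
      show "AE y in lborel. indicator B y *\<^sub>R c \<le> indicator B y *\<^sub>R G (x + s *\<^sub>R e + y)"
        using G_ae by eventually_elim (auto simp: indicator_def)
    qed
    finally show "c * measure lborel B \<le> ?D" .
  qed
  let ?m = "measure lborel B"
  have "g 0 - c * ?m * 0 \<le> g t - c * ?m * t"
  proof (rule DERIV_nonneg_imp_nondecreasing[OF t])
    fix s assume "0 \<le> s" "s \<le> t"
    then obtain D where "(g has_real_derivative D) (at s)" "c * ?m \<le> D" using deriv by blast
    then show "\<exists>D. ((\<lambda>s. g s - c * ?m * s) has_real_derivative D) (at s) \<and> 0 \<le> D"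
      by (intro exI[of _ "D - c * ?m"]) (auto intro!: derivative_eq_intros)
  qed
  moreover have "\<bar>g s - ?m * f (x + s *\<^sub>R e)\<bar> \<le> ?m * (L * \<rho>)" for s
  proof -
    let ?w = "x + s *\<^sub>R e"
    have "g s - ?m * f ?w = (\<integral>y. indicator B y *\<^sub>R (f (?w + y) - f ?w) \<partial>lborel)"
      using intf[of ?w] intB[of "\<lambda>_. f ?w" "\<bar>f ?w\<bar>"] Bfin unfolding g_def by (simp add: right_diff_distrib)
    also have "\<bar>\<dots>\<bar> \<le> (\<integral>y. indicator B y *\<^sub>R (L * \<rho>) \<partial>lborel)"
    proof (rule order_trans[OF integral_abs_bound integral_mono])
      show "integrable lborel (\<lambda>y. \<bar>indicator B y *\<^sub>R (f (?w + y) - f ?w)\<bar>)"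
        using fB[of _ ?w] by (intro integrable_abs intB[of _ "L * \<rho>"]) auto
      show "integrable lborel (\<lambda>y. indicator B y *\<^sub>R (L * \<rho>))"
        using L \<rho> by (intro intB[of _ "L * \<rho>"]) auto
      show "\<bar>indicator B y *\<^sub>R (f (?w + y) - f ?w)\<bar> \<le> indicator B y *\<^sub>R (L * \<rho>)" for y
        using fB[of y ?w] by (auto simp: indicator_def)
    qed
    also have "\<dots> = ?m * (L * \<rho>)" using Bfin by simp
    finally show ?thesis .
  qed
  from this[of 0] this[of t] have "\<bar>g 0 - ?m * f x\<bar> \<le> ?m * (L * \<rho>)" "\<bar>g t - ?m * f (x + t *\<^sub>R e)\<bar> \<le> ?m * (L * \<rho>)" by simp_all
  ultimately have "?m * (f x + c * t) \<le> ?m * (f (x + t *\<^sub>R e) + 2 * L * \<rho>)"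
    by (simp add: algebra_simps)
  then have "f x + c * t \<le> f (x + t *\<^sub>R e) + 2 * L * \<rho>" using Bpos by simp
  then show "f x + c * t \<le> f (x + t *\<^sub>R e) + \<epsilon>" using \<rho>L by linarith
qed

text \<open>McShane's extension, the lower envelope of the cones f z + L |x - z|. It makes
  Rademacher's theorem available for functions on open sets, and extends local graph functions to a
  whole hyperplane.\<close>

lemma lipschitz_extension_real:
  fixes f :: "'a::metric_space \<Rightarrow> real"
  assumes f: "L-lipschitz_on S f"
  obtains F where "L-lipschitz_on UNIV F" "\<And>x. x \<in> S \<Longrightarrow> F x = f x"
proof (cases "S = {}")
  case True
  then show ?thesis using that[of "\<lambda>_. 0"] lipschitz_on_nonneg[OF f] by (simp add: lipschitz_on_def)
next
  case False
  then obtain s where s: "s \<in> S" by blast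
  have L: "0 \<le> L" by (rule lipschitz_on_nonneg[OF f])
  define F where "F x = (INF z\<in>S. f z + L * dist x z)" for x
  have fS: "\<bar>f y - f z\<bar> \<le> L * dist y z" if "y \<in> S" "z \<in> S" for y z
    using lipschitz_onD[OF f that] by (simp add: dist_real_def)
  have bdd: "bdd_below ((\<lambda>z. f z + L * dist x z) ` S)" for x
  proof (rule bdd_belowI2)
    fix z assume "z \<in> S"
    have "L * dist s z \<le> L * (dist x s + dist x z)"
      using L by (intro mult_left_mono) (metis dist_commute dist_triangle)
    then show "f s - L * dist x s \<le> f z + L * dist x z"
      using fS[OF s \<open>z \<in> S\<close>] by (simp add: algebra_simps)
  qed
  have le: "F x \<le> F y + L * dist x y" for x y
  proof -
    have "F x - L * dist x y \<le> F y"
      unfolding F_def[of y]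
    proof (rule cINF_greatest[OF False])
      fix z assume z: "z \<in> S"
      have "F x \<le> f z + L * dist x z" unfolding F_def by (rule cINF_lower[OF bdd z])
      also have "\<dots> \<le> f z + L * (dist x y + dist y z)"
        using L by (intro add_left_mono mult_left_mono dist_triangle)
      finally show "F x - L * dist x y \<le> f z + L * dist y z" by (simp add: algebra_simps)
    qed
    then show ?thesis by simp
  qed
  have "L-lipschitz_on UNIV F"
  proof (rule lipschitz_onI)
    fix x y :: 'a
    show "dist (F x) (F y) \<le> L * dist x y"
      using le[of x y] le[of y x] by (simp add: dist_real_def dist_commute)
  qed (rule L)
  moreover have "F x = f x" if x: "x \<in> S" for x
  proof (rule antisym)
    show "F x \<le> f x" using cINF_lower[OF bdd x, of x] by (simp add: F_def)
    show "f x \<le> F x" unfolding F_def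
    proof (rule cINF_greatest[OF False])
      fix z assume "z \<in> S"
      then show "f x \<le> f z + L * dist x z" using fS[OF x] by fastforce
    qed
  qed
  ultimately show ?thesis by (rule that)
qed

text \<open>Seen from the difference quotients in the direction of g itself. The bound keeps
  gradients in a compact ball, from which limiting gradients can be extracted.\<close>

lemma GDERIV_norm_le_lipschitz:
  fixes f :: "'a::real_inner \<Rightarrow> real"
  assumes g: "GDERIV f z :> g" and X: "open X" "z \<in> X" and f: "L-lipschitz_on X f"
  shows "norm g \<le> L"
proof (cases "g = 0")
  case True
  then show ?thesis using lipschitz_on_nonneg[OF f] by simp
next
  case False
  show ?thesis
  proof (rule field_le_epsilon)
    fix e :: real assume e: "0 < e"
    obtain d where d: "d > 0" "\<And>y. norm (y - z) < d \<Longrightarrow> norm (f y - f z - (y - z) \<bullet> g) \<le> e * norm (y - z)"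
      using g e unfolding gderiv_def has_derivative_at_alt by blast
    obtain r where r: "r > 0" "ball z r \<subseteq> X" using X open_contains_ball by blast
    define t where "t = min d r / 2 / norm g"
    have t: "t > 0" "t * norm g < d" "t * norm g < r" using d r False by (auto simp: t_def)
    let ?y = "z + t *\<^sub>R g"
    have "?y \<in> X" using t r(2) by (auto simp: dist_norm subset_iff)
    then have 1: "\<bar>f ?y - f z\<bar> \<le> L * (t * norm g)"
      using lipschitz_onD[OF f, of ?y z] X t by (simp add: dist_norm)
    have 2: "\<bar>f ?y - f z - t * (g \<bullet> g)\<bar> \<le> e * (t * norm g)" using d(2)[of ?y] t by simp
    have "t * (g \<bullet> g) \<le> L * (t * norm g) + e * (t * norm g)" using 1 2 by linarith
    then have "(t * norm g) * norm g \<le> (t * norm g) * (L + e)"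
      by (simp add: algebra_simps power2_norm_eq_inner[symmetric] power2_eq_square)
    then show "norm g \<le> L + e" using t False by simp
  qed
qed

text \<open>The subdifferential is convex, so its inner products with e have one sign, and e or -e
  makes them all positive. Compactness turns this into a uniform lower bound for the gradients near
  x0, and integration along the direction turns the bound into growth.\<close>

lemma nondegenerate_increase:
  fixes f :: "'a::euclidean_space \<Rightarrow> real"
  assumes X: "open X" "x0 \<in> X" and f: "L-lipschitz_on X f"
    and e: "norm e = 1" and nd: "\<And>p. p \<in> clarke_subdifferential X f x0 \<Longrightarrow> p \<bullet> e \<noteq> 0"
  obtains u c r where "norm u = 1" "0 < c" "0 < r" "ball x0 r \<subseteq> X"
    "\<And>x t. x \<in> ball x0 r \<Longrightarrow> x + t *\<^sub>R u \<in> ball x0 r \<Longrightarrow> 0 \<le> t \<Longrightarrow> f x + c * t \<le> f (x + t *\<^sub>R u)"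
proof -
  define G where "G = {p. \<exists>z g. (\<forall>i::nat. z i \<in> X \<and> GDERIV f (z i) :> g i) \<and> z \<longlonglongrightarrow> x0 \<and> g \<longlonglongrightarrow> p}"
  have cl: "clarke_subdifferential X f x0 = convex hull G" unfolding clarke_subdifferential_def G_def ..
  have "(\<forall>p \<in> convex hull G. 0 < p \<bullet> e) \<or> (\<forall>p \<in> convex hull G. p \<bullet> e < 0)"
  proof (rule ccontr)
    assume "\<not> ?thesis"
    then obtain p q where pq: "p \<in> convex hull G" "q \<in> convex hull G" "p \<bullet> e < 0" "0 < q \<bullet> e"
      using nd unfolding cl by (meson linorder_neqE_linordered_idom)
    \<comment> \<open>The weight at which the segment from q to p crosses the hyperplane orthogonal
      to e.\<close>
    define u where "u = q \<bullet> e / (q \<bullet> e - p \<bullet> e)"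
    have u: "0 \<le> u" "u \<le> 1" "u * (q \<bullet> e - p \<bullet> e) = q \<bullet> e" using pq by (auto simp: u_def field_simps)
    have "u *\<^sub>R p + (1 - u) *\<^sub>R q \<in> convex hull G"
      using pq u by (intro convexD[OF convex_convex_hull]) auto
    moreover have "(u *\<^sub>R p + (1 - u) *\<^sub>R q) \<bullet> e = 0" using u(3) by (simp add: inner_add_left algebra_simps)
    ultimately show False using nd unfolding cl by blast
  qed
  then obtain u where u: "norm u = 1" "\<And>p. p \<in> G \<Longrightarrow> 0 < p \<bullet> u"
  proof
    assume *: "\<forall>p \<in> convex hull G. 0 < p \<bullet> e"
    show thesis by (rule that[of e]) (use * e in \<open>auto intro: hull_inc\<close>)
  next
    assume *: "\<forall>p \<in> convex hull G. p \<bullet> e < 0"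
    show thesis by (rule that[of "- e"]) (use * e in \<open>auto intro: hull_inc\<close>)
  qed
  \<comment> \<open>One number 1/(n+1) serves both as radius and as lower bound. If every n failed,
    the offending gradients, bounded by L, would accumulate at a limiting gradient whose inner
    product with u is at most 0.\<close>
  have "\<exists>n. \<forall>z g. z \<in> X \<and> dist z x0 < 1 / Suc n \<and> GDERIV f z :> g \<longrightarrow> 1 / Suc n \<le> g \<bullet> u"
  proof (rule ccontr)
    assume "\<not> ?thesis"
    then have "\<forall>n. \<exists>z g. z \<in> X \<and> dist z x0 < 1 / Suc n \<and> GDERIV f z :> g \<and> g \<bullet> u < 1 / Suc n"
      unfolding not_ex not_all not_imp not_le conj_assoc .
    then have "\<exists>z g. \<forall>n. z n \<in> X \<and> dist (z n) x0 < 1 / Suc n \<and> GDERIV f (z n) :> g n \<and> g n \<bullet> u < 1 / Suc n"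
      unfolding choice_iff .
    then obtain z g where zg: "\<And>n. z n \<in> X" "\<And>n. dist (z n) x0 < 1 / Suc n" "\<And>n. GDERIV f (z n) :> g n"
        "\<And>n. g n \<bullet> u < 1 / Suc n"
      by blast
    have "g n \<in> cball 0 L" for n using GDERIV_norm_le_lipschitz[OF zg(3) X(1) zg(1) f] by simp
    then have "\<forall>n. g n \<in> cball 0 L" by blast
    moreover have "seq_compact (cball (0::'a) L)" by (rule compact_imp_seq_compact[OF compact_cball])
    ultimately obtain p r where pr: "strict_mono r" "(g \<circ> r) \<longlonglongrightarrow> p"
      unfolding seq_compact_def by blast
    have inv0: "(\<lambda>n. 1 / real (Suc n)) \<longlonglongrightarrow> 0" by (rule LIMSEQ_Suc[OF lim_1_over_n])
    have "z \<longlonglongrightarrow> x0"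
      by (rule metric_tendsto_imp_tendsto[OF inv0]) (use zg(2) in \<open>auto simp: dist_real_def intro!: always_eventually less_imp_le\<close>)
    then have "(z \<circ> r) \<longlonglongrightarrow> x0" using pr(1) LIMSEQ_subseq_LIMSEQ by blast
    then have "p \<in> G" unfolding G_def using pr(2) zg
      by (intro CollectI exI[of _ "z \<circ> r"] exI[of _ "g \<circ> r"]) auto
    moreover have "p \<bullet> u \<le> 0"
    proof (rule LIMSEQ_le)
      show "(\<lambda>n. (g \<circ> r) n \<bullet> u) \<longlonglongrightarrow> p \<bullet> u" by (intro tendsto_intros pr)
      show "((\<lambda>n. 1 / real (Suc n)) \<circ> r) \<longlonglongrightarrow> 0" using pr(1) LIMSEQ_subseq_LIMSEQ[OF inv0] by blast
      show "\<exists>N. \<forall>n\<ge>N. (g \<circ> r) n \<bullet> u \<le> ((\<lambda>n. 1 / real (Suc n)) \<circ> r) n"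
        using zg(4) by (auto simp: less_imp_le)
    qed
    ultimately show False using u(2) by fastforce
  qed
  then obtain n where n: "\<And>z g. z \<in> X \<Longrightarrow> dist z x0 < 1 / Suc n \<Longrightarrow> GDERIV f z :> g \<Longrightarrow> 1 / Suc n \<le> g \<bullet> u"
    by blast
  obtain r0 where r0: "r0 > 0" "ball x0 r0 \<subseteq> X" using X open_contains_ball by blast
  define r where "r = min r0 (1 / Suc n)"
  have r: "0 < r" "ball x0 r \<subseteq> X" using r0 by (auto simp: r_def)
  obtain F where F: "L-lipschitz_on UNIV F" "\<And>x. x \<in> X \<Longrightarrow> F x = f x"
    using lipschitz_extension_real[OF f] by blast
  show thesis
  proof (rule that[OF u(1) _ r])
    show "0 < 1 / real (Suc n)" by simp
    fix x t assume x: "x \<in> ball x0 r" "x + t *\<^sub>R u \<in> ball x0 r" "(0::real) \<le> t"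
    have "F x + 1 / Suc n * t \<le> F (x + t *\<^sub>R u)"
    proof (rule increase_along_direction_of_gradients[OF F(1) _ x])
      fix z g assume z: "z \<in> ball x0 r" and g: "GDERIV F z :> g"
      have "z \<in> X" using z r by blast
      then have "GDERIV f z :> g"
        using g F(2) X(1) unfolding gderiv_def by (rule_tac has_derivative_transform_within_open[of F _ z UNIV X f]) auto
      then show "1 / Suc n \<le> g \<bullet> u" using n[OF \<open>z \<in> X\<close>] z by (simp add: r_def dist_commute)
    qed
    moreover have "F x = f x" "F (x + t *\<^sub>R u) = f (x + t *\<^sub>R u)" using x r by (auto intro!: F(2))
    ultimately show "f x + 1 / real (Suc n) * t \<le> f (x + t *\<^sub>R u)" by simp
  qed
qed

text \<open>An implicit function theorem without derivatives: on each line parallel to u near p, f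
  grows at rate at least c, so the line meets the level set exactly once. Moving the line by d
  changes the values of f by at most L d, hence the height of the crossing by at most (L/c)
  d.\<close>

lemma level_set_lipschitz_hypersurface:
  fixes f :: "'a::euclidean_space \<Rightarrow> real"
  assumes f: "L-lipschitz_on X f"
    and inc: "\<And>x0. x0 \<in> X \<Longrightarrow> \<exists>u c r. norm u = 1 \<and> 0 < c \<and> 0 < r \<and> ball x0 r \<subseteq> X \<and>
       (\<forall>x t. x \<in> ball x0 r \<and> x + t *\<^sub>R u \<in> ball x0 r \<and> 0 \<le> t \<longrightarrow> f x + c * t \<le> f (x + t *\<^sub>R u))"
  shows "lipschitz_hypersurface {x \<in> X. f x = k}"
  unfolding lipschitz_hypersurface_def
proof
  fix p assume p: "p \<in> {x \<in> X. f x = k}"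
  then obtain u c r where u: "norm u = 1" and c: "0 < c" and r: "0 < r" "ball p r \<subseteq> X"
    and inc: "\<And>x t. x \<in> ball p r \<Longrightarrow> x + t *\<^sub>R u \<in> ball p r \<Longrightarrow> 0 \<le> t \<Longrightarrow> f x + c * t \<le> f (x + t *\<^sub>R u)"
    using inc[of p] by blast
  have L: "0 \<le> L" by (rule lipschitz_on_nonneg[OF f])
  have uu: "u \<bullet> u = 1" using u by (simp add: norm_eq_1)
  define \<pi> where "\<pi> x = x - (x \<bullet> u) *\<^sub>R u" for x
  have \<pi>0: "\<pi> x \<bullet> u = 0" for x by (simp add: \<pi>_def inner_diff_left uu)
  have \<pi>x: "\<pi> x + (x \<bullet> u) *\<^sub>R u = x" for x by (simp add: \<pi>_def)
  \<comment> \<open>Half height and radius of a cylinder around p inside the ball. The second bound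
    on \<rho> ensures L \<rho> < c \<eta>: the growth c \<eta> from the centre to the top or bottom
    outweighs the change across the base, so level k is crossed above every point of the
    base.\<close>
  define \<eta> where "\<eta> = r / 4"
  define \<rho> where "\<rho> = min (r / 4) (c * \<eta> / (2 * (L + 1)))"
  have \<eta>: "0 < \<eta>" using r by (simp add: \<eta>_def)
  have "\<rho> \<le> r / 4" unfolding \<rho>_def by (rule min.cobounded1)
  moreover have "0 < \<rho>" using r c L \<eta> by (simp add: \<rho>_def)
  ultimately have \<rho>: "0 < \<rho>" "\<rho> \<le> r / 4" by simp_all
  have \<rho>L: "L * \<rho> < c * \<eta>"
  proof -
    have "L * \<rho> \<le> (L + 1) * (c * \<eta> / (2 * (L + 1)))"
      using L \<rho>(1) by (intro mult_mono) (auto simp: \<rho>_def)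
    also have "\<dots> = c * \<eta> / 2" using L by (simp add: field_simps)
    finally show ?thesis using mult_pos_pos[OF c \<eta>] by linarith
  qed
  let ?w = "\<pi> p" and ?\<tau> = "p \<bullet> u"
  have in_ball: "w + t *\<^sub>R u \<in> ball p r" if "norm (w - ?w) < \<rho>" "\<bar>t - ?\<tau>\<bar> \<le> \<eta>" for w t
  proof -
    have "w + t *\<^sub>R u - p = (w - ?w) + (t - ?\<tau>) *\<^sub>R u" using \<pi>x[of p] by (simp add: algebra_simps)
    then have "norm (w + t *\<^sub>R u - p) = norm ((w - ?w) + (t - ?\<tau>) *\<^sub>R u)" by (rule arg_cong)
    also have "\<dots> \<le> norm (w - ?w) + \<bar>t - ?\<tau>\<bar>"
      using norm_triangle_ineq[of "w - ?w" "(t - ?\<tau>) *\<^sub>R u"] u by simp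
    finally have "norm (w + t *\<^sub>R u - p) \<le> norm (w - ?w) + \<bar>t - ?\<tau>\<bar>" .
    then show ?thesis using that \<rho> r by (simp add: dist_norm norm_minus_commute \<eta>_def)
  qed
  have incr: "f (w + s *\<^sub>R u) + c * (t - s) \<le> f (w + t *\<^sub>R u)"
    if "norm (w - ?w) < \<rho>" "\<bar>s - ?\<tau>\<bar> \<le> \<eta>" "\<bar>t - ?\<tau>\<bar> \<le> \<eta>" "s \<le> t" for w s t
  proof -
    have eq: "w + s *\<^sub>R u + (t - s) *\<^sub>R u = w + t *\<^sub>R u" by (simp add: algebra_simps)
    show ?thesis using inc[of "w + s *\<^sub>R u" "t - s", unfolded eq] in_ball that by simp
  qed
  have lip: "\<bar>f (w + t *\<^sub>R u) - f (w' + t *\<^sub>R u)\<bar> \<le> L * norm (w - w')"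
    if "norm (w - ?w) < \<rho>" "norm (w' - ?w) < \<rho>" "\<bar>t - ?\<tau>\<bar> \<le> \<eta>" for w w' t
    using lipschitz_onD[OF f, of "w + t *\<^sub>R u" "w' + t *\<^sub>R u"] in_ball that r by (auto simp: dist_norm subset_iff)
  define W where "W = {w. w \<bullet> u = 0 \<and> norm (w - ?w) < \<rho>}"
  have ex: "\<exists>t. \<bar>t - ?\<tau>\<bar> \<le> \<eta> \<and> f (w + t *\<^sub>R u) = k" if w: "w \<in> W" for w
  proof -
    have wn: "norm (w - ?w) < \<rho>" "norm (?w - ?w) < \<rho>" using w \<rho> by (auto simp: W_def)
    have fp: "f (?w + ?\<tau> *\<^sub>R u) = k" using p by (simp add: \<pi>x)
    have Lw: "L * norm (w - ?w) \<le> L * \<rho>" using wn L by (intro mult_left_mono) auto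
    have lo: "f (w + (?\<tau> - \<eta>) *\<^sub>R u) \<le> k"
      using incr[OF wn(2), of "?\<tau> - \<eta>" ?\<tau>] lip[OF wn, of "?\<tau> - \<eta>"] fp Lw \<rho>L \<eta> by simp
    have hi: "k \<le> f (w + (?\<tau> + \<eta>) *\<^sub>R u)"
      using incr[OF wn(2), of ?\<tau> "?\<tau> + \<eta>"] lip[OF wn, of "?\<tau> + \<eta>"] fp Lw \<rho>L \<eta> by simp
    have "\<exists>t\<ge>?\<tau> - \<eta>. t \<le> ?\<tau> + \<eta> \<and> f (w + t *\<^sub>R u) = k"
    proof (rule IVT'[of "\<lambda>t. f (w + t *\<^sub>R u)", OF lo hi])
      show "?\<tau> - \<eta> \<le> ?\<tau> + \<eta>" using \<eta> by simp
      have cf: "continuous_on X f" by (rule lipschitz_on_continuous_on[OF f])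
      have sub: "(\<lambda>t. w + t *\<^sub>R u) ` {?\<tau> - \<eta>..?\<tau> + \<eta>} \<subseteq> X"
        using in_ball[OF wn(1)] r(2) by (force simp: abs_le_iff)
      show "continuous_on {?\<tau> - \<eta>..?\<tau> + \<eta>} (\<lambda>t. f (w + t *\<^sub>R u))"
        by (rule continuous_on_compose2[OF cf _ sub]) (intro continuous_intros)
    qed
    then obtain t where "?\<tau> - \<eta> \<le> t" "t \<le> ?\<tau> + \<eta>" "f (w + t *\<^sub>R u) = k" by blast
    then show ?thesis by (intro exI[of _ t]) (simp add: abs_le_iff)
  qed
  define g where "g w = (SOME t. \<bar>t - ?\<tau>\<bar> \<le> \<eta> \<and> f (w + t *\<^sub>R u) = k)" for w
  have g: "\<bar>g w - ?\<tau>\<bar> \<le> \<eta>" "f (w + g w *\<^sub>R u) = k" if "w \<in> W" for w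
    using someI_ex[OF ex[OF that]] unfolding g_def by auto
  have lip_level: "\<bar>t - t'\<bar> \<le> L / c * norm (w - w')"
    if "w \<in> W" "w' \<in> W" "\<bar>t - ?\<tau>\<bar> \<le> \<eta>" "\<bar>t' - ?\<tau>\<bar> \<le> \<eta>" "f (w + t *\<^sub>R u) = k" "f (w' + t' *\<^sub>R u) = k" for w w' t t'
  proof -
    have wn: "norm (w - ?w) < \<rho>" "norm (w' - ?w) < \<rho>" using that by (auto simp: W_def)
    have "c * \<bar>t - t'\<bar> \<le> L * norm (w - w')"
    proof (cases "t \<le> t'")
      case True
      then show ?thesis using incr[OF wn(1) that(3,4) True] lip[OF wn that(4)] that by simp
    next
      case False
      then show ?thesis using incr[OF wn(2) that(4,3)] lip[OF wn that(3)] that by simp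
    qed
    then show ?thesis using c by (simp add: field_simps)
  qed
  have "(L / c)-lipschitz_on W g"
    using g lip_level L c by (intro lipschitz_onI) (auto simp: dist_real_def dist_norm)
  \<comment> \<open>A Lipschitz hypersurface asks for a function on the entire hyperplane, whereas
    \<open>g\<close> is controlled on the patch \<open>W\<close> only.\<close>
  then obtain h where h: "(L / c)-lipschitz_on UNIV h" "\<And>w. w \<in> W \<Longrightarrow> h w = g w"
    using lipschitz_extension_real by blast
  define U where "U = {x. norm (\<pi> x - ?w) < \<rho> \<and> \<bar>x \<bullet> u - ?\<tau>\<bar> < \<eta>}"
  have "open U" unfolding U_def \<pi>_def by (intro open_Collect_conj open_Collect_less continuous_intros)
  moreover have "p \<in> U" using \<rho> \<eta> by (simp add: U_def)
  moreover have "(L / c)-lipschitz_on {z. z \<bullet> u = 0} h" using lipschitz_on_subset[OF h(1)] by blast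
  moreover have "{x \<in> X. f x = k} \<inter> U = {x \<in> U. x \<bullet> u = h (x - (x \<bullet> u) *\<^sub>R u)}"
  proof -
    have "x \<in> X \<and> f x = k \<longleftrightarrow> x \<bullet> u = h (\<pi> x)" if x: "x \<in> U" for x
    proof -
      have W: "\<pi> x \<in> W" and t: "\<bar>x \<bullet> u - ?\<tau>\<bar> \<le> \<eta>" using x \<pi>0 by (auto simp: U_def W_def)
      have "x \<in> ball p r" using in_ball[of "\<pi> x" "x \<bullet> u"] W t by (simp add: \<pi>x W_def)
      then have X: "x \<in> X" using r by blast
      have "x \<bullet> u = g (\<pi> x)" if "f x = k"
        using lip_level[OF W W t g(1)[OF W] _ g(2)[OF W]] that by (simp add: \<pi>x)
      moreover have "f x = k" if "x \<bullet> u = g (\<pi> x)"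
        using g(2)[OF W] \<pi>x[of x] that by simp
      ultimately show ?thesis using X h(2)[OF W] by auto
    qed
    then show ?thesis unfolding \<pi>_def by blast
  qed
  ultimately show "\<exists>U e g L. open U \<and> p \<in> U \<and> norm e = 1 \<and> L-lipschitz_on {z. z \<bullet> e = 0} g \<and>
        {x \<in> X. f x = k} \<inter> U = {x \<in> U. x \<bullet> e = g (x - (x \<bullet> e) *\<^sub>R e)}"
    using u by blast
qed

text \<open>Were the integrals not strictly ordered, the almost everywhere non-negative difference
  would have integral 0 and vanish almost everywhere on (a,b). The strictness is what later makes
  the optimal plan unique.\<close>

lemma set_lebesgue_integral_less:
  fixes f g :: "real \<Rightarrow> real"
  assumes f: "set_integrable lborel {a..b} f" and g: "set_integrable lborel {a..b} g"
    and ab: "a < b" and less: "\<And>t. a < t \<Longrightarrow> t < b \<Longrightarrow> f t < g t"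
  shows "(LINT t:{a..b}|lborel. f t) < (LINT t:{a..b}|lborel. g t)"
proof (rule ccontr)
  assume not_less: "\<not> ?thesis"
  define h where "h t = indicator {a..b} t *\<^sub>R g t - indicator {a..b} t *\<^sub>R f t" for t
  have h: "integrable lborel h" unfolding h_def using f g by (auto simp: set_integrable_def)
  have eq: "integral\<^sup>L lborel h = (LINT t:{a..b}|lborel. g t) - (LINT t:{a..b}|lborel. f t)"
    unfolding h_def set_lebesgue_integral_def using f g by (simp add: set_integrable_def)
  have AE_ne: "AE t in lborel. t \<noteq> a \<and> t \<noteq> b"
    using AE_lborel_singleton[of a] AE_lborel_singleton[of b] by eventually_elim auto
  have nonneg: "AE t in lborel. 0 \<le> h t"
    using AE_ne by eventually_elim (use less in \<open>auto simp: h_def indicator_def less_le\<close>)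
  have "0 \<le> integral\<^sup>L lborel h" by (rule integral_nonneg_AE[OF nonneg])
  then have "integral\<^sup>L lborel h = 0" using eq not_less by simp
  then have "AE t in lborel. h t = 0" using integral_nonneg_eq_0_iff_AE[OF h nonneg] by simp
  then have "AE t in lborel. t \<notin> {a<..<b}"
    by eventually_elim (use less in \<open>force simp: h_def indicator_def\<close>)
  then have "emeasure lborel {t. a < t \<and> t < b} = 0" by (subst (asm) AE_iff_measurable[OF _ refl]) auto
  moreover have "{t. a < t \<and> t < b} = {a<..<b}" by auto
  ultimately have "emeasure lborel {a<..<b} = 0" by simp
  then show False using ab by simp
qed

subsection \<open>Balanced levels\<close>

text \<open>Non-degeneracy enters the transport argument only through its consequences
  \<open>level_null\<close> and \<open>not_local_max\<close>. The bound B is strict, so that neither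
  B nor -B is a value of s_y.\<close>

locale level_transport =
  fixes X :: "'a::euclidean_space set" and Y :: "real set" and \<mu> :: "'a measure" and \<nu> :: "real measure"
    and s :: "'a \<times> real \<Rightarrow> real" and L B :: real
  assumes X: "open X" "connected X" and Y: "open Y" "connected Y"
    and \<mu>: "prob_space \<mu>" "space \<mu> = X" "sets \<mu> = sets (restrict_space borel X)"
    and \<nu>: "prob_space \<nu>" "space \<nu> = Y" "sets \<nu> = sets (restrict_space borel Y)"
    and no_atoms: "y \<in> Y \<Longrightarrow> emeasure \<nu> {y} = 0"
    and s_continuous: "continuous_on (X \<times> Y) s" and s_bounded: "bounded (s ` (X \<times> Y))"
    and s_deriv: "x \<in> X \<Longrightarrow> y \<in> Y \<Longrightarrow> ((\<lambda>t. s (x, t)) has_real_derivative dy s x y) (at y)"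
    and dy_bound: "x \<in> X \<Longrightarrow> y \<in> Y \<Longrightarrow> \<bar>dy s x y\<bar> < B"
    and dy_lipschitz: "x \<in> X \<Longrightarrow> y \<in> Y \<Longrightarrow> x' \<in> X \<Longrightarrow> y' \<in> Y \<Longrightarrow>
      \<bar>dy s x y - dy s x' y'\<bar> \<le> L * (dist x x' + dist y y')"
    and level_null: "y \<in> Y \<Longrightarrow> emeasure \<mu> {x \<in> X. dy s x y = k} = 0"
    and not_local_max: "x \<in> X \<Longrightarrow> y \<in> Y \<Longrightarrow> 0 < e \<Longrightarrow> \<exists>x'\<in>X. dist x' x < e \<and> dy s x y < dy s x' y"
begin

sublocale \<mu>: prob_space \<mu> by (rule \<mu>(1))
sublocale \<nu>: prob_space \<nu> by (rule \<nu>(1))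

abbreviation kp where "kp \<equiv> k_plus \<mu> \<nu> s"
abbreviation km where "km \<equiv> k_minus \<mu> \<nu> s"

definition H where "H y k = measure \<mu> {x \<in> X. dy s x y \<le> k}"
definition G where "G y = measure \<nu> {t \<in> Y. t < y}"

lemma sets_\<nu>_iff: "A \<in> sets \<nu> \<longleftrightarrow> A \<subseteq> Y \<and> A \<in> sets borel"
  using Y(1) unfolding \<nu>(3) by (subst sets_restrict_space_iff) auto

lemma interval_Y: "a \<in> Y \<Longrightarrow> b \<in> Y \<Longrightarrow> a \<le> t \<Longrightarrow> t \<le> b \<Longrightarrow> t \<in> Y"
  using Y(2) connectedD_interval by blast

lemma L_nonneg: "0 \<le> L"
proof -
  obtain x where x: "x \<in> X" using \<mu>.not_empty \<mu>(2) by blast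
  obtain y where y: "y \<in> Y" using \<nu>.not_empty \<nu>(2) by blast
  obtain r where "r > 0" "cball y r \<subseteq> Y" using Y(1) y open_contains_cball by blast
  then have "y + r \<in> Y" "r > 0" by (auto simp: subset_iff dist_real_def)
  then show ?thesis using dy_lipschitz[OF x y x, of "y + r"] by (simp add: dist_real_def) (smt (verit) mult_neg_pos)
qed

lemma dy_lipschitz_x: "x \<in> X \<Longrightarrow> x' \<in> X \<Longrightarrow> y \<in> Y \<Longrightarrow> \<bar>dy s x y - dy s x' y\<bar> \<le> L * dist x x'"
  using dy_lipschitz[of x y x' y] by simp

lemma dy_lipschitz_y: "x \<in> X \<Longrightarrow> y \<in> Y \<Longrightarrow> y' \<in> Y \<Longrightarrow> \<bar>dy s x y - dy s x y'\<bar> \<le> L * \<bar>y - y'\<bar>"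
  using dy_lipschitz[of x y x y'] by (simp add: dist_real_def)

lemma continuous_on_dy_x: "y \<in> Y \<Longrightarrow> continuous_on X (\<lambda>x. dy s x y)"
  by (rule lipschitz_on_continuous_on[of L], rule lipschitz_onI)
    (use dy_lipschitz_x L_nonneg in \<open>auto simp: dist_real_def\<close>)

lemma continuous_on_dy_y: "x \<in> X \<Longrightarrow> continuous_on Y (\<lambda>y. dy s x y)"
  by (rule lipschitz_on_continuous_on[of L], rule lipschitz_onI)
    (use dy_lipschitz_y L_nonneg in \<open>auto simp: dist_real_def\<close>)

lemma tendsto_dy_y: "x \<in> X \<Longrightarrow> y \<in> Y \<Longrightarrow> ((\<lambda>y. dy s x y) \<longlongrightarrow> dy s x y) (at y)"
  using continuous_on_dy_y[of x] Y(1) by (simp add: continuous_on_eq_continuous_at isCont_def)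

lemma dy_connected: "y \<in> Y \<Longrightarrow> connected ((\<lambda>x. dy s x y) ` X)"
  using X(2) continuous_on_dy_x by (rule connected_continuous_image[rotated])

lemma dy_value_between:
  assumes "y \<in> Y" "x1 \<in> X" "x2 \<in> X" "dy s x1 y \<le> k" "k \<le> dy s x2 y"
  shows "\<exists>x\<in>X. dy s x y = k"
proof -
  have "k \<in> (\<lambda>x. dy s x y) ` X"
    using assms by (intro connectedD_interval[OF dy_connected imageI[of x1] imageI[of x2]]) auto
  then show ?thesis by auto
qed

lemma measurable_dy_x: "y \<in> Y \<Longrightarrow> (\<lambda>x. dy s x y) \<in> borel_measurable \<mu>"
  using borel_measurable_continuous_on_restrict[OF continuous_on_dy_x]
  by (subst measurable_cong_sets[OF \<mu>(3) refl])

lemma sublevel_sets: "y \<in> Y \<Longrightarrow> {x \<in> X. dy s x y \<le> k} \<in> sets \<mu>"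
  using measurable_dy_x[of y] \<mu>(2) by (auto simp: borel_measurable_iff_le)

lemma ray_sets: "{t \<in> Y. t < y} \<in> sets \<nu>"
  unfolding sets_\<nu>_iff using Y(1) by (auto intro!: borel_open open_Collect_conj simp: open_Collect_less)

lemma null_sets_level: "y \<in> Y \<Longrightarrow> {x \<in> X. dy s x y = k} \<in> null_sets \<mu>"
proof -
  assume y: "y \<in> Y"
  have "{x \<in> space \<mu>. dy s x y = k} \<in> sets \<mu>" using measurable_dy_x[OF y] by measurable
  then show ?thesis using level_null[OF y] by (auto simp: \<mu>(2))
qed

lemma balanced_level_iff: "y \<in> Y \<Longrightarrow> balanced_level \<mu> \<nu> s y k \<longleftrightarrow> H y k = G y"
  unfolding balanced_level_def level_le_def H_def G_def \<mu>(2) \<nu>(2)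
  by (simp add: \<mu>.emeasure_eq_measure \<nu>.emeasure_eq_measure)

lemma H_mono: "y \<in> Y \<Longrightarrow> k \<le> k' \<Longrightarrow> H y k \<le> H y k'"
  unfolding H_def by (intro \<mu>.finite_measure_mono sublevel_sets) auto

lemma G_mono: "y \<le> y' \<Longrightarrow> G y \<le> G y'"
  unfolding G_def by (intro \<nu>.finite_measure_mono ray_sets) auto

lemma H_eq_0: "y \<in> Y \<Longrightarrow> k \<le> - B \<Longrightarrow> H y k = 0"
proof -
  assume "y \<in> Y" "k \<le> - B"
  then have "{x \<in> X. dy s x y \<le> k} = {}" using dy_bound by fastforce
  then show ?thesis unfolding H_def by (metis measure_empty)
qed

lemma H_eq_1: "y \<in> Y \<Longrightarrow> (\<And>x. x \<in> X \<Longrightarrow> dy s x y \<le> k) \<Longrightarrow> H y k = 1"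
proof -
  assume "\<And>x. x \<in> X \<Longrightarrow> dy s x y \<le> k"
  then have "{x \<in> X. dy s x y \<le> k} = space \<mu>" using \<mu>(2) by auto
  then show ?thesis unfolding H_def by (metis \<mu>.prob_space)
qed

lemma H_le_1: "H y k \<le> 1" unfolding H_def by (rule \<mu>.prob_le_1)
lemma G_le_1: "G y \<le> 1" unfolding G_def by (rule \<nu>.prob_le_1)
lemma H_nonneg: "0 \<le> H y k" unfolding H_def by simp
lemma G_nonneg: "0 \<le> G y" unfolding G_def by simp

text \<open>The indicators converge at every x off the level set where s_y(x,y) = k, and this set is
  null; dominated convergence does the rest.\<close>

lemma H_tendsto:
  assumes y: "y \<in> Y" "\<And>n. u n \<in> Y" "u \<longlonglongrightarrow> y" and k: "v \<longlonglongrightarrow> k"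
  shows "(\<lambda>n. H (u n) (v n)) \<longlonglongrightarrow> H y k"
proof -
  have "(\<lambda>n. \<integral>x. indicator {x \<in> X. dy s x (u n) \<le> v n} x \<partial>\<mu>) \<longlonglongrightarrow> (\<integral>x. indicator {x \<in> X. dy s x y \<le> k} x \<partial>\<mu> :: real)"
  proof (rule integral_dominated_convergence[where w = "\<lambda>_. 1"])
    show "AE x in \<mu>. (\<lambda>n. indicator {x \<in> X. dy s x (u n) \<le> v n} x :: real) \<longlonglongrightarrow> indicator {x \<in> X. dy s x y \<le> k} x"
    proof (rule AE_I'[OF null_sets_level[OF y(1), of k]], clarsimp simp: \<mu>(2))
      fix x assume x: "x \<in> X" and ne: "\<not> (\<lambda>n. indicator {x \<in> X. dy s x (u n) \<le> v n} x :: real) \<longlonglongrightarrow> indicator {x \<in> X. dy s x y \<le> k} x"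
      have lim: "(\<lambda>n. dy s x (u n)) \<longlonglongrightarrow> dy s x y"
        using continuous_on_tendsto_compose[OF continuous_on_dy_y[OF x] y(3,1)] y(2) by simp
      show "dy s x y = k"
      proof (rule ccontr)
        assume "dy s x y \<noteq> k"
        then have "\<forall>\<^sub>F n in sequentially. (dy s x (u n) \<le> v n) = (dy s x y \<le> k)"
        proof (cases "dy s x y < k")
          case True
          have "((\<lambda>n. v n - dy s x (u n)) \<longlongrightarrow> k - dy s x y) sequentially" by (intro tendsto_diff k lim)
          then have ev: "\<forall>\<^sub>F n in sequentially. 0 < v n - dy s x (u n)" using True by (intro order_tendstoD(1)) auto
          show ?thesis by (rule eventually_mono[OF ev]) (use True in auto)
        next
          case False
          have "((\<lambda>n. v n - dy s x (u n)) \<longlongrightarrow> k - dy s x y) sequentially" by (intro tendsto_diff k lim)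
          then have ev: "\<forall>\<^sub>F n in sequentially. v n - dy s x (u n) < 0"
            using False \<open>dy s x y \<noteq> k\<close> by (intro order_tendstoD(2)) auto
          show ?thesis by (rule eventually_mono[OF ev]) (use False \<open>dy s x y \<noteq> k\<close> in auto)
        qed
        then have "\<forall>\<^sub>F n in sequentially. (indicator {x \<in> X. dy s x (u n) \<le> v n} x :: real) = indicator {x \<in> X. dy s x y \<le> k} x"
          by eventually_elim (auto simp: indicator_def)
        from tendsto_eventually[OF this] ne show False by simp
      qed
    qed
  qed (use sublevel_sets y in \<open>auto split: split_indicator\<close>)
  then show ?thesis unfolding H_def using sublevel_sets y by simp
qed

lemma G_tendsto:
  assumes y: "y \<in> Y" "u \<longlonglongrightarrow> y"
  shows "(\<lambda>n. G (u n)) \<longlonglongrightarrow> G y"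
proof -
  have "(\<lambda>n. \<integral>t. indicator {t \<in> Y. t < u n} t \<partial>\<nu>) \<longlonglongrightarrow> (\<integral>t. indicator {t \<in> Y. t < y} t \<partial>\<nu> :: real)"
  proof (rule integral_dominated_convergence[where w = "\<lambda>_. 1"])
    have null: "{y} \<in> null_sets \<nu>" using no_atoms y by (auto simp: sets_\<nu>_iff)
    show "AE t in \<nu>. (\<lambda>n. indicator {t \<in> Y. t < u n} t :: real) \<longlonglongrightarrow> indicator {t \<in> Y. t < y} t"
    proof (rule AE_I'[OF null], rule subsetI, rule ccontr)
      fix t assume t: "t \<in> {t \<in> space \<nu>. \<not> (\<lambda>n. indicator {t \<in> Y. t < u n} t :: real) \<longlonglongrightarrow> indicator {t \<in> Y. t < y} t}" "t \<notin> {y}"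
      have "\<forall>\<^sub>F n in sequentially. (t < u n) = (t < y)"
      proof (cases "t < y")
        case True
        show ?thesis by (rule eventually_mono[OF order_tendstoD(1)[OF y(2) True]]) (use True in auto)
      next
        case False
        then have "y < t" using t by auto
        then show ?thesis by (intro eventually_mono[OF order_tendstoD(2)[OF y(2)]]) (use False in auto)
      qed
      then have "\<forall>\<^sub>F n in sequentially. (indicator {t \<in> Y. t < u n} t :: real) = indicator {t \<in> Y. t < y} t"
        by eventually_elim (auto simp: indicator_def)
      from tendsto_eventually[OF this] t show False by simp
    qed
  qed (use ray_sets in \<open>auto split: split_indicator\<close>)
  then show ?thesis unfolding G_def using ray_sets by simp
qed

lemma balanced_exists: "y \<in> Y \<Longrightarrow> \<exists>k. H y k = G y"
proof -
  assume y: "y \<in> Y"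
  obtain x where x: "x \<in> X" using \<mu>.not_empty \<mu>(2) by blast
  then have B: "0 < B" using dy_bound[OF x y] by linarith
  have "\<exists>k\<ge>-B. k \<le> B \<and> H y k = G y"
  proof (rule IVT')
    show "H y (- B) \<le> G y" using H_eq_0[OF y] G_nonneg by simp
    have "dy s x y \<le> B" if "x \<in> X" for x using dy_bound[OF that y] by linarith
    then show "G y \<le> H y B" using H_eq_1[OF y] G_le_1 by simp
    show "continuous_on {- B..B} (H y)"
      unfolding continuous_on_sequentially comp_def using H_tendsto[OF y, of "\<lambda>_. y"] y by auto
  qed (use B in auto)
  then show ?thesis by blast
qed

text \<open>Together with \<open>km_le_iff\<close> this takes the place of the definitions by
  supremum and infimum: comparing an end point, finite or not, with a real level becomes a
  comparison of the continuous functions H and G.\<close>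

lemma le_kp_iff: assumes y: "y \<in> Y" shows "ereal k \<le> kp y \<longleftrightarrow> H y k \<le> G y"
proof
  assume "H y k \<le> G y"
  obtain k0 where k0: "H y k0 = G y" using balanced_exists[OF y] by blast
  have "H y (max k k0) = G y"
  proof (cases "k \<le> k0")
    case False
    then show ?thesis using H_mono[OF y, of k0 k] \<open>H y k \<le> G y\<close> k0 by simp
  qed (simp add: k0 max_absorb2)
  then have "ereal (max k k0) \<le> kp y"
    unfolding k_plus_def using y by (intro SUP_upper) (simp add: balanced_level_iff)
  then show "ereal k \<le> kp y" by (meson ereal_less_eq(3) max.cobounded1 order_trans)
next
  assume le: "ereal k \<le> kp y"
  have less: "H y k' \<le> G y" if "k' < k" for k'
  proof -
    have "ereal k' < kp y" using that le by (metis ereal_less(2) less_ereal.simps(1) less_le_trans)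
    then obtain k'' where "k' < k''" "H y k'' = G y"
      unfolding k_plus_def less_SUP_iff using y by (auto simp: balanced_level_iff)
    then show ?thesis using H_mono[OF y, of k' k''] by simp
  qed
  \<comment> \<open>A supremum need not be attained, so balanced levels above k are known only for
    smaller k; continuity of \<open>H y\<close> closes the gap.\<close>
  have "(\<lambda>n. k - 1 / real (Suc n)) \<longlonglongrightarrow> k - 0"
    by (intro tendsto_diff tendsto_const LIMSEQ_Suc[OF lim_1_over_n])
  then have "(\<lambda>n. H y (k - 1 / real (Suc n))) \<longlonglongrightarrow> H y k"
    using y by (intro H_tendsto) auto
  then show "H y k \<le> G y" by (rule LIMSEQ_le_const2) (auto intro!: less)
qed

lemma km_le_iff: assumes y: "y \<in> Y" shows "km y \<le> ereal k \<longleftrightarrow> G y \<le> H y k"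
proof
  assume "G y \<le> H y k"
  obtain k0 where k0: "H y k0 = G y" using balanced_exists[OF y] by blast
  have "H y (min k k0) = G y"
  proof (cases "k0 \<le> k")
    case False
    then show ?thesis using H_mono[OF y, of k k0] \<open>G y \<le> H y k\<close> k0 by simp
  qed (simp add: k0 min_absorb2)
  then have "km y \<le> ereal (min k k0)"
    unfolding k_minus_def using y by (intro INF_lower) (simp add: balanced_level_iff)
  then show "km y \<le> ereal k" by (meson ereal_less_eq(3) min.cobounded1 order_trans)
next
  assume le: "km y \<le> ereal k"
  have less: "G y \<le> H y k'" if "k < k'" for k'
  proof -
    have "km y < ereal k'" using that le by (metis less_ereal.simps(1) le_less_trans)
    then obtain k'' where "k'' < k'" "H y k'' = G y"
      unfolding k_minus_def INF_less_iff using y by (auto simp: balanced_level_iff)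
    then show ?thesis using H_mono[OF y, of k'' k'] by simp
  qed
  have "(\<lambda>n. k + 1 / real (Suc n)) \<longlonglongrightarrow> k + 0"
    by (intro tendsto_add tendsto_const LIMSEQ_Suc[OF lim_1_over_n])
  then have "(\<lambda>n. H y (k + 1 / real (Suc n))) \<longlonglongrightarrow> H y k"
    using y by (intro H_tendsto) auto
  then show "G y \<le> H y k" by (rule LIMSEQ_le_const) (auto intro!: less)
qed

lemma K_interval_iff: "y \<in> Y \<Longrightarrow> k \<in> K_interval \<mu> \<nu> s y \<longleftrightarrow> balanced_level \<mu> \<nu> s y k"
  unfolding K_interval_def by (auto simp: le_kp_iff km_le_iff balanced_level_iff)

lemma km_le_kp: "y \<in> Y \<Longrightarrow> km y \<le> kp y"
  using balanced_exists[of y] le_kp_iff[of y] km_le_iff[of y] by (metis order_refl order_trans)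

text \<open>By \<open>le_kp_iff\<close> the inequality says G y < H y k, an open condition on y
  since both sides are continuous. This openness is the upper semicontinuity of k+.\<close>

lemma kp_less_eventually:
  assumes y: "y \<in> Y" and less: "kp y < ereal k"
  shows "\<forall>\<^sub>F t in at y. t \<in> Y \<and> kp t < ereal k"
proof -
  have "((\<lambda>t. H t k - G t) \<longlongrightarrow> H y k - G y) (at y within Y)"
    unfolding tendsto_at_iff_sequentially comp_def
    by (auto intro!: tendsto_diff H_tendsto G_tendsto y)
  moreover have "0 < H y k - G y" using less le_kp_iff[OF y, of k] by auto
  ultimately have "\<forall>\<^sub>F t in at y within Y. 0 < H t k - G t" by (rule order_tendstoD(1))
  moreover have "\<forall>\<^sub>F t in at y within Y. t \<in> Y" by (auto simp: eventually_at_filter)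
  ultimately have "\<forall>\<^sub>F t in at y within Y. t \<in> Y \<and> kp t < ereal k"
    by eventually_elim (metis le_kp_iff diff_gt_0_iff_gt not_le)
  then show ?thesis using at_within_open[OF y Y(1)] by simp
qed

lemma less_km_eventually:
  assumes y: "y \<in> Y" and less: "ereal k < km y"
  shows "\<forall>\<^sub>F t in at y. t \<in> Y \<and> ereal k < km t"
proof -
  have "((\<lambda>t. G t - H t k) \<longlongrightarrow> G y - H y k) (at y within Y)"
    unfolding tendsto_at_iff_sequentially comp_def
    by (auto intro!: tendsto_diff H_tendsto G_tendsto y)
  moreover have "0 < G y - H y k" using less km_le_iff[OF y, of k] by auto
  ultimately have "\<forall>\<^sub>F t in at y within Y. 0 < G t - H t k" by (rule order_tendstoD(1))
  moreover have "\<forall>\<^sub>F t in at y within Y. t \<in> Y" by (auto simp: eventually_at_filter)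
  ultimately have "\<forall>\<^sub>F t in at y within Y. t \<in> Y \<and> ereal k < km t"
    by eventually_elim (metis km_le_iff diff_gt_0_iff_gt not_le)
  then show ?thesis using at_within_open[OF y Y(1)] by simp
qed

lemma usc_kp: "usc_on Y kp"
  unfolding usc_on_def
proof
  fix y assume y: "y \<in> Y"
  show "Limsup (at y within Y) kp \<le> kp y"
    unfolding Limsup_le_iff
  proof (intro allI impI)
    fix c assume c: "kp y < c"
    obtain k where k: "kp y < ereal k" "ereal k < c" using ereal_dense2[OF c] by blast
    show "\<forall>\<^sub>F t in at y within Y. kp t < c"
      unfolding at_within_open[OF y Y(1)]
      by (rule eventually_mono[OF kp_less_eventually[OF y k(1)]]) (use k(2) in auto)
  qed
qed

lemma usc_uminus_km: "usc_on Y (\<lambda>y. - km y)"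
  unfolding usc_on_def
proof
  fix y assume y: "y \<in> Y"
  show "Limsup (at y within Y) (\<lambda>y. - km y) \<le> - km y"
    unfolding Limsup_le_iff
  proof (intro allI impI)
    fix c assume "- km y < c"
    then have c: "- c < km y" by (simp add: ereal_uminus_less_reorder)
    obtain k where k: "- c < ereal k" "ereal k < km y" using ereal_dense2[OF c] by blast
    have "- km t < c" if "ereal k < km t" for t
      using less_trans[OF k(1) that] by (simp add: ereal_uminus_less_reorder)
    then show "\<forall>\<^sub>F t in at y within Y. - km t < c"
      unfolding at_within_open[OF y Y(1)]
      by (intro eventually_mono[OF less_km_eventually[OF y k(2)]]) blast
  qed
qed

end

subsection \<open>The matching map\<close>

locale monotone_level_transport = level_transport +
  assumes level_le_kp_mono: "y \<in> Y \<Longrightarrow> y' \<in> Y \<Longrightarrow> y \<le> y' \<Longrightarrow> level_le s X y (kp y) \<subseteq> level_le s X y' (kp y')"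
    and level_le_km_mono: "y \<in> Y \<Longrightarrow> y' \<in> Y \<Longrightarrow> y \<le> y' \<Longrightarrow> level_le s X y (km y) \<subseteq> level_le s X y' (km y')"
    and level_strict: "y \<in> Y \<Longrightarrow> y' \<in> Y \<Longrightarrow> 0 < emeasure \<nu> {y..y'} \<Longrightarrow>
      level_le s X y (kp y) \<subseteq> level_less s X y' (km y')"
begin

abbreviation matched where "matched \<equiv> F_rule \<mu> \<nu> s"
abbreviation matching where "matching \<equiv> matching_map \<mu> \<nu> s"
abbreviation plans where "plans \<equiv> transport_plans \<mu> \<nu>"
abbreviation graph where "graph \<equiv> graph_plan \<mu> \<nu>"

text \<open>\<open>S y\<close> is X_\<le>(y,k+(y)) and \<open>D y\<close> is X_<(y,k-(y)). Up to a
  null set, \<open>S y\<close> will consist of the points that are matched with a value at most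
  y.\<close>

definition S where "S y = {x \<in> X. ereal (dy s x y) \<le> kp y}"
definition D where "D y = {x \<in> X. ereal (dy s x y) < km y}"

lemma level_le_kp: "level_le s X y (kp y) = S y"
  by (simp add: level_le_def S_def)

lemma level_less_km: "level_less s X y (km y) = D y"
  unfolding level_less_def level_le_def level_eq_def D_def by auto

lemma S_mono: "y \<in> Y \<Longrightarrow> y' \<in> Y \<Longrightarrow> y \<le> y' \<Longrightarrow> S y \<subseteq> S y'"
  using level_le_kp_mono unfolding level_le_kp .

lemma less_km_mono:
  assumes "y \<in> Y" "y' \<in> Y" "y \<le> y'" "x \<in> X" "km y' < ereal (dy s x y')"
  shows "km y < ereal (dy s x y)"
  using level_le_km_mono[OF assms(1-3)] assms(4,5) unfolding level_le_def by (auto simp: not_le[symmetric])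

lemma G_diff_le: assumes "y \<in> Y" "y' \<in> Y" shows "G y' - G y \<le> measure \<nu> {y..y'}"
proof -
  have sets: "{y..y'} \<in> sets \<nu>" using interval_Y[OF assms] by (auto simp: sets_\<nu>_iff)
  have "G y' \<le> measure \<nu> ({t \<in> Y. t < y} \<union> {y..y'})"
    unfolding G_def using ray_sets sets by (intro \<nu>.finite_measure_mono) auto
  also have "\<dots> \<le> G y + measure \<nu> {y..y'}"
    unfolding G_def using ray_sets sets by (intro measure_Un_le) auto
  finally show ?thesis by simp
qed

lemma S_subset_D: assumes "y \<in> Y" "y' \<in> Y" "G y < G y'" shows "S y \<subseteq> D y'"
proof -
  have "0 < measure \<nu> {y..y'}" using G_diff_le[OF assms(1,2)] assms(3) by linarith
  then have "0 < emeasure \<nu> {y..y'}" by (simp add: \<nu>.emeasure_eq_measure)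
  then show ?thesis using level_strict[OF assms(1,2)] unfolding level_le_kp level_less_km by simp
qed

lemma D_subset_S: "y \<in> Y \<Longrightarrow> D y \<subseteq> S y"
  using km_le_kp[of y] unfolding D_def S_def by (auto dest: less_imp_le order_trans)

section \<open>One-sided continuity of the end points\<close>

text \<open>The upper half is upper semicontinuity. For the lower half, a point x of
  \<open>S y\<close> whose value s_y(x,y) is just below k+(y) stays in \<open>S t\<close> for t > y,
  so k+(t) \<ge> s_y(x,t), which is close to s_y(x,y).\<close>

lemma continuous_kp: assumes y: "y \<in> Y" shows "continuous (at_right y) kp"
  unfolding continuous_within
proof (rule order_tendstoI)
  fix c assume "kp y < c"
  then obtain k where k: "kp y < ereal k" "ereal k < c" using ereal_dense2 by metis
  have "\<forall>\<^sub>F t in at_right y. t \<in> Y \<and> kp t < ereal k"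
    using kp_less_eventually[OF y k(1)] unfolding eventually_at_split by blast
  then show "\<forall>\<^sub>F t in at_right y. kp t < c" by eventually_elim (use k(2) in auto)
next
  fix c assume "c < kp y"
  then obtain k' where k': "c < ereal k'" "ereal k' < kp y" using ereal_dense2 by metis
  obtain k where k: "c < ereal k" "ereal k < ereal k'" using ereal_dense2[OF k'(1)] by blast
  have kk: "k < k'" using k by simp
  have evY: "\<forall>\<^sub>F t in at_right y. t \<in> Y \<and> y < t"
  proof (rule eventually_conj[OF _ eventually_at_right_less])
    show "\<forall>\<^sub>F t in at_right y. t \<in> Y"
      using eventually_at_in_open'[OF Y(1) y] unfolding eventually_at_split by blast
  qed
  have "\<forall>\<^sub>F t in at_right y. ereal k \<le> kp t"
  proof (cases "\<exists>x\<in>X. k < dy s x y \<and> dy s x y \<le> k'")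
    case True
    then obtain x where x: "x \<in> X" "k < dy s x y" "dy s x y \<le> k'" by blast
    have "ereal (dy s x y) \<le> ereal k'" using x by simp
    also have "\<dots> \<le> kp y" using k'(2) by (rule less_imp_le)
    finally have "x \<in> S y" using x unfolding S_def by simp
    have "\<forall>\<^sub>F t in at_right y. k < dy s x t"
      using order_tendstoD(1)[OF tendsto_dy_y[OF x(1) y] x(2)] unfolding eventually_at_split by blast
    then show ?thesis using evY
    proof eventually_elim
      case (elim t)
      then have "x \<in> S t" using \<open>x \<in> S y\<close> S_mono[OF y, of t] by auto
      have "ereal k \<le> ereal (dy s x t)" using elim by simp
      also have "\<dots> \<le> kp t" using \<open>x \<in> S t\<close> unfolding S_def by simp
      finally show ?case .
    qed
  next
    case False
    \<comment> \<open>No value of s_y lies in (k, k'], so by connectedness of X all values lie on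
      one side. If they lie below, G is 1 from y on and every level is below k+; if above, they stay
      above k for nearby t, and level k has mass 0.\<close>
    consider "\<forall>x\<in>X. dy s x y \<le> k'" | "\<forall>x\<in>X. k' < dy s x y"
      using False kk dy_value_between[OF y, of _ _ k'] by (metis less_imp_le not_le order_refl)
    then show ?thesis
    proof cases
      case 1
      have "H y k' \<le> G y" using le_kp_iff[OF y, of k'] less_imp_le[OF k'(2)] by simp
      then have "G y = 1" using H_eq_1[OF y, of k'] 1 G_le_1[of y] by simp
      from evY show ?thesis
      proof eventually_elim
        case (elim t)
        then have "1 \<le> G t" using G_mono[of y t] \<open>G y = 1\<close> by simp
        then show ?case using le_kp_iff[of t k] elim H_le_1[of t k] by simp
      qed
    next
      case 2
      have "((\<lambda>t. k' - L * (t - y)) \<longlongrightarrow> k' - L * (y - y)) (at_right y)" by (intro tendsto_intros)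
      then have "\<forall>\<^sub>F t in at_right y. k < k' - L * (t - y)" using kk by (intro order_tendstoD(1)) auto
      then show ?thesis using evY
      proof eventually_elim
        case (elim t)
        have "k < dy s x t" if "x \<in> X" for x
          using dy_lipschitz_y[OF that y, of t] elim 2 that by (fastforce simp: abs_le_iff algebra_simps)
        then have "{x \<in> X. dy s x t \<le> k} = {}" by force
        then have "H t k = 0" unfolding H_def by (metis measure_empty)
        then show ?case using le_kp_iff[of t k] elim G_nonneg by simp
      qed
    qed
  qed
  then show "\<forall>\<^sub>F t in at_right y. c < kp t" by eventually_elim (rule less_le_trans[OF k(1)])
qed

text \<open>Mirror image of \<open>continuous_kp\<close>: a point with s_y(x,y) just above k-(y)
  stays above k-(t) for t < y, which bounds k-(t) from above by s_y(x,t).\<close>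

lemma continuous_km: assumes y: "y \<in> Y" shows "continuous (at_left y) km"
  unfolding continuous_within
proof (rule order_tendstoI)
  fix c assume "c < km y"
  then obtain k where k: "c < ereal k" "ereal k < km y" using ereal_dense2 by metis
  have "\<forall>\<^sub>F t in at_left y. t \<in> Y \<and> ereal k < km t"
    using less_km_eventually[OF y k(2)] unfolding eventually_at_split by blast
  then show "\<forall>\<^sub>F t in at_left y. c < km t" by eventually_elim (use k(1) in auto)
next
  fix c assume "km y < c"
  then obtain k' where k': "km y < ereal k'" "ereal k' < c" using ereal_dense2 by metis
  obtain k where k: "ereal k' < ereal k" "ereal k < c" using ereal_dense2[OF k'(2)] by blast
  have kk: "k' < k" using k by simp
  have evY: "\<forall>\<^sub>F t in at_left y. t \<in> Y \<and> t < y"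
  proof (rule eventually_conj)
    show "\<forall>\<^sub>F t in at_left y. t \<in> Y"
      using eventually_at_in_open'[OF Y(1) y] unfolding eventually_at_split by blast
    show "\<forall>\<^sub>F t in at_left y. t < y"
      using eventually_at_left_real[of "y - 1" y] by (auto elim: eventually_mono)
  qed
  have "\<forall>\<^sub>F t in at_left y. km t \<le> ereal k"
  proof (cases "\<exists>x\<in>X. k' \<le> dy s x y \<and> dy s x y < k")
    case True
    then obtain x where x: "x \<in> X" "k' \<le> dy s x y" "dy s x y < k" by blast
    note k'(1)
    also have "ereal k' \<le> ereal (dy s x y)" using x by simp
    finally have km: "km y < ereal (dy s x y)" .
    have "\<forall>\<^sub>F t in at_left y. dy s x t < k"
      using order_tendstoD(2)[OF tendsto_dy_y[OF x(1) y] x(3)] unfolding eventually_at_split by blast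
    then show ?thesis using evY
    proof eventually_elim
      case (elim t)
      then have "km t < ereal (dy s x t)" using less_km_mono[OF _ y _ x(1) km, of t] by auto
      also have "\<dots> < ereal k" using elim by simp
      finally show ?case by simp
    qed
  next
    case False
    consider "\<forall>x\<in>X. k' \<le> dy s x y" | "\<forall>x\<in>X. dy s x y < k'"
      using False kk dy_value_between[OF y, of _ _ k'] by (metis less_imp_le not_le order_refl)
    then show ?thesis
    proof cases
      case 1
      \<comment> \<open>Sublevel sets are closed on the right, so the value k' itself may occur
        here; the points attaining it form a level set, which is null.\<close>
      have "H y k' = 0"
      proof -
        have "{x \<in> X. dy s x y \<le> k'} \<subseteq> {x \<in> X. dy s x y = k'}" using 1 by auto
        then have "measure \<mu> {x \<in> X. dy s x y \<le> k'} \<le> measure \<mu> {x \<in> X. dy s x y = k'}"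
          using null_sets_level[OF y] by (intro \<mu>.finite_measure_mono) auto
        also have "\<dots> = 0" by (simp add: measure_def level_null[OF y])
        finally show "H y k' = 0" using H_nonneg[of y k'] unfolding H_def by (rule antisym)
      qed
      moreover have "G y \<le> H y k'" using km_le_iff[OF y, of k'] less_imp_le[OF k'(1)] by simp
      ultimately have "G y = 0" using G_nonneg[of y] by simp
      from evY show ?thesis
      proof eventually_elim
        case (elim t)
        then have "G t \<le> 0" using G_mono[of t y] \<open>G y = 0\<close> by simp
        then show ?case using km_le_iff[of t k] elim H_nonneg[of t k] by simp
      qed
    next
      case 2
      have "((\<lambda>t. k' + L * (y - t)) \<longlongrightarrow> k' + L * (y - y)) (at_left y)" by (intro tendsto_intros)
      then have "\<forall>\<^sub>F t in at_left y. k' + L * (y - t) < k" using kk by (intro order_tendstoD(2)) auto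
      then show ?thesis using evY
      proof eventually_elim
        case (elim t)
        have "dy s x t \<le> k" if "x \<in> X" for x
          using dy_lipschitz_y[OF that y, of t] elim 2 that by (fastforce simp: abs_le_iff algebra_simps)
        then have "H t k = 1" using elim by (intro H_eq_1) auto
        then show ?case using km_le_iff[of t k] elim G_le_1 by simp
      qed
    qed
  qed
  then show "\<forall>\<^sub>F t in at_left y. km t < c" by eventually_elim (rule le_less_trans[OF _ k(2)])
qed

lemma kp_gt_MInf: "y \<in> Y \<Longrightarrow> kp y \<noteq> - \<infinity>"
  using balanced_exists[of y] le_kp_iff[of y] by (metis MInfty_neq_ereal(1) ereal_infty_less_eq(2) order_refl)

lemma km_lt_PInf: "y \<in> Y \<Longrightarrow> km y \<noteq> \<infinity>"
  using balanced_exists[of y] km_le_iff[of y] by (metis PInfty_neq_ereal(1) ereal_infty_less_eq(1) order_refl)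

text \<open>Replaces a possibly infinite k+(y) by a real balanced level, from which measurability
  and mass of \<open>S y\<close> can be read off. If k+(y) is infinite, B serves, because s_y stays
  below B.\<close>

lemma S_eq_sublevel: assumes y: "y \<in> Y" obtains k where "S y = {x \<in> X. dy s x y \<le> k}" "ereal k \<le> kp y" "H y k = G y"
proof (cases "kp y")
  case (real k)
  then have "H y k = G y" using le_kp_iff[OF y, of k] km_le_iff[OF y, of k] km_le_kp[OF y] by simp
  then show ?thesis using that[of k] real by (simp add: S_def)
next
  case PInf
  have XB: "{x \<in> X. dy s x y \<le> B} = X" using dy_bound y by (auto simp: abs_less_iff less_imp_le)
  have "H y B \<le> G y" using le_kp_iff[OF y, of B] PInf by simp
  moreover have "H y B = 1" using XB by (intro H_eq_1 y) auto
  ultimately show ?thesis using that[of B] PInf G_le_1[of y] XB by (simp add: S_def)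
next
  case MInf
  then show ?thesis using kp_gt_MInf[OF y] by simp
qed

lemma S_sets: "y \<in> Y \<Longrightarrow> S y \<in> sets \<mu>"
  by (rule S_eq_sublevel[of y]) (auto simp: sublevel_sets)

lemma measure_S: "y \<in> Y \<Longrightarrow> measure \<mu> (S y) = G y"
  by (rule S_eq_sublevel[of y]) (auto simp: H_def)

text \<open>Both end points cut off the same mass G y, so the band between them is null, and so is
  the lower level itself. This settles the points x for a single y at which k- and k+
  differ.\<close>

lemma null_sets_between: assumes y: "y \<in> Y"
  shows "\<exists>N\<in>null_sets \<mu>. {x \<in> X. km y \<le> ereal (dy s x y) \<and> ereal (dy s x y) \<le> kp y} \<subseteq> N"
proof -
  obtain k where k: "S y = {x \<in> X. dy s x y \<le> k}" "H y k = G y" using S_eq_sublevel[OF y] by blast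
  \<comment> \<open>l stands for k-(y), with -B in place of an infinite value.\<close>
  obtain l where l: "\<And>x. x \<in> X \<Longrightarrow> km y \<le> ereal (dy s x y) \<Longrightarrow> l \<le> dy s x y" "G y \<le> H y l"
  proof (cases "km y")
    case (real l)
    then show ?thesis using that[of l] km_le_iff[OF y, of l] by simp
  next
    case PInf
    then show ?thesis using km_lt_PInf[OF y] by simp
  next
    case MInf
    have "- B \<le> dy s x y" if "x \<in> X" for x using dy_bound[OF that y] by linarith
    then show ?thesis using that[of "- B"] km_le_iff[OF y, of "- B"] MInf by simp
  qed
  let ?A = "{x \<in> X. dy s x y \<le> k} - {x \<in> X. dy s x y \<le> l}"
  have A: "?A \<in> null_sets \<mu>"
  proof (cases "l \<le> k")
    case True
    have "measure \<mu> ?A = H y k - H y l"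
      unfolding H_def using sublevel_sets[OF y] True by (intro \<mu>.finite_measure_Diff) auto
    then have "measure \<mu> ?A \<le> 0" using k(2) l(2) by simp
    then show ?thesis using sublevel_sets[OF y] by (auto simp: null_sets_def \<mu>.emeasure_eq_measure measure_le_0_iff)
  next
    case False
    then have "?A = {}" by auto
    then show ?thesis by (metis null_sets.empty_sets)
  qed
  have "{x \<in> X. km y \<le> ereal (dy s x y) \<and> ereal (dy s x y) \<le> kp y} \<subseteq> ?A \<union> {x \<in> X. dy s x y = l}"
    using k(1) l(1) unfolding S_def by fastforce
  then show ?thesis using null_sets.Un[OF A null_sets_level[OF y, of l]] by blast
qed


section \<open>Flat stretches of the distribution function and the support of \<nu>\<close>

lemma rational_between: "a \<in> Y \<Longrightarrow> b \<in> Y \<Longrightarrow> a < b \<Longrightarrow> \<exists>q\<in>\<rat> \<inter> Y. a < q \<and> q < b"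
  using Rats_dense_in_real[of a b] interval_Y[of a b] by (auto simp: less_imp_le)

lemma below_in_Y: assumes "y \<in> Y" shows "\<exists>a\<in>Y. a < y"
proof -
  obtain e where "e > 0" "cball y e \<subseteq> Y" using Y(1) assms open_contains_cball by blast
  then show ?thesis by (intro bexI[of _ "y - e"]) (auto simp: subset_iff dist_real_def)
qed

lemma above_in_Y: assumes "y \<in> Y" shows "\<exists>b\<in>Y. y < b"
proof -
  obtain e where "e > 0" "cball y e \<subseteq> Y" using Y(1) assms open_contains_cball by blast
  then show ?thesis by (intro bexI[of _ "y + e"]) (auto simp: subset_iff dist_real_def)
qed

lemma null_sets_Ico: assumes "a \<in> Y" "b \<in> Y" "a \<le> b" "G a = G b" shows "{a..<b} \<in> null_sets \<nu>"
proof -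
  have "{a..<b} = {t \<in> Y. t < b} - {t \<in> Y. t < a}" using interval_Y[OF assms(1,2)] by auto
  moreover have "measure \<nu> ({t \<in> Y. t < b} - {t \<in> Y. t < a}) = G b - G a"
    unfolding G_def using ray_sets assms(3) by (intro \<nu>.finite_measure_Diff) auto
  ultimately show ?thesis using ray_sets assms(4) by (auto simp: null_sets_def \<nu>.emeasure_eq_measure)
qed

text \<open>Otherwise the complement of (a,b) would be a closed set of full mass, and the support
  would miss y.\<close>

lemma G_less_if_spt:
  assumes y: "y \<in> Y" "y \<in> spt \<nu>" and ab: "a \<in> Y" "b \<in> Y" "a < y" "y < b"
  shows "G a < G b"
proof (rule ccontr)
  assume "\<not> G a < G b"
  then have "G a = G b" using G_mono[of a b] ab by simp
  then have null: "{a..<b} \<in> null_sets \<nu>" using ab by (intro null_sets_Ico) auto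
  have "{a<..<b} \<in> sets \<nu>" using interval_Y[OF ab(1,2)] by (auto simp: sets_\<nu>_iff)
  then have "{a<..<b} \<in> null_sets \<nu>" by (intro null_sets_subset[OF null]) auto
  then have "emeasure \<nu> (space \<nu> - {a<..<b}) = emeasure \<nu> (space \<nu>)" by (intro emeasure_Diff_null_set) auto
  moreover have "space \<nu> - {a<..<b} = space \<nu> \<inter> - {a<..<b}" by auto
  moreover have "closed (- {a<..<b})" by (simp add: closed_def)
  ultimately have "spt \<nu> \<subseteq> - {a<..<b}" unfolding spt_def by auto
  then show False using y ab by auto
qed

lemma gap_if_not_spt:
  assumes y: "y \<in> Y" "y \<notin> spt \<nu>"
  obtains a b where "a \<in> Y" "b \<in> Y" "a < y" "y < b" "G a = G b"
proof -
  obtain C where C: "closed C" "emeasure \<nu> (space \<nu> \<inter> C) = emeasure \<nu> (space \<nu>)" "y \<notin> C"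
    using y(2) unfolding spt_def by auto
  have "open (Y \<inter> - C)" using C(1) Y(1) by (simp add: open_Int open_Compl)
  moreover have "y \<in> Y \<inter> - C" using C(3) y(1) by simp
  ultimately obtain e where e: "e > 0" "cball y e \<subseteq> Y \<inter> - C" unfolding open_contains_cball by metis
  have CY: "space \<nu> \<inter> C \<in> sets \<nu>" using C(1) Y(1) by (auto simp: sets_\<nu>_iff \<nu>(2))
  have compl: "space \<nu> - (space \<nu> \<inter> C) \<in> sets \<nu>" using CY by (rule sets.compl_sets)
  have eq: "cball y e = {y - e..y + e}" by (simp add: cball_eq_atLeastAtMost)
  have sub: "{y - e..y + e} \<subseteq> space \<nu> - (space \<nu> \<inter> C)" using e unfolding eq \<nu>(2) by blast
  have ab: "y - e \<in> Y" "y + e \<in> Y" using e unfolding eq by auto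
  have "measure \<nu> {y - e..y + e} \<le> measure \<nu> (space \<nu> - (space \<nu> \<inter> C))"
    by (rule \<nu>.finite_measure_mono[OF sub compl])
  also have "\<dots> = measure \<nu> (space \<nu>) - measure \<nu> (space \<nu> \<inter> C)"
    using CY by (intro \<nu>.finite_measure_Diff) auto
  also have "\<dots> = 0" using C(2) by (simp add: measure_def)
  finally have "G (y + e) \<le> G (y - e)" using G_diff_le[OF ab] by simp
  then have "G (y - e) = G (y + e)" using G_mono[of "y - e" "y + e"] e(1) by simp
  then show thesis using e(1) ab by (intro that[of "y - e" "y + e"]) auto
qed

text \<open>Each such y selects a rational in the flat stretch to its right. If y1 < y2 selected the
  same one, y2 would be a support point inside the flat stretch that begins at y1; so the selection
  is injective.\<close>

lemma countable_right_gaps: "countable {y \<in> Y \<inter> spt \<nu>. \<exists>b\<in>Y. y < b \<and> G y = G b}" (is "countable ?A")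
proof -
  have "\<forall>y\<in>?A. \<exists>q. q \<in> \<rat> \<inter> Y \<and> y < q \<and> G y = G q"
  proof
    fix y assume y: "y \<in> ?A"
    obtain b where b: "b \<in> Y" "y < b" "G y = G b" using y by blast
    obtain q where q: "q \<in> \<rat> \<inter> Y" "y < q" "q < b" using rational_between[of y b] y b by blast
    then show "\<exists>q. q \<in> \<rat> \<inter> Y \<and> y < q \<and> G y = G q"
      using G_mono[of y q] G_mono[of q b] b by (intro exI[of _ q]) auto
  qed
  then have "\<exists>q. \<forall>y\<in>?A. q y \<in> \<rat> \<inter> Y \<and> y < q y \<and> G y = G (q y)" by (rule bchoice)
  then obtain q where q: "\<And>y. y \<in> ?A \<Longrightarrow> q y \<in> \<rat> \<inter> Y \<and> y < q y \<and> G y = G (q y)" by blast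
  have less: False if "y1 \<in> ?A" "y2 \<in> ?A" "q y1 = q y2" "y1 < y2" for y1 y2
    using G_less_if_spt[of y2 y1 "q y2"] that q[of y1] q[of y2] by simp
  have "inj_on q ?A"
  proof (rule inj_onI)
    fix y1 y2 assume y: "y1 \<in> ?A" "y2 \<in> ?A" "q y1 = q y2"
    show "y1 = y2" using less[OF y] less[OF y(2,1) y(3)[symmetric]] by (cases y1 y2 rule: linorder_cases) auto
  qed
  moreover have "countable (q ` ?A)" by (rule countable_subset[OF _ countable_rat]) (use q in blast)
  ultimately show ?thesis using countable_image_inj_on by blast
qed

text \<open>There is at most one such point: of two, the smaller would be a support point in the
  interior of a stretch where G vanishes.\<close>

lemma countable_spt_G_eq_0: "countable {y \<in> Y \<inter> spt \<nu>. G y = 0}" (is "countable ?A")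
proof -
  have less: False if y12: "y1 \<in> ?A" "y2 \<in> ?A" "y1 < y2" for y1 y2
  proof -
    obtain a where "a \<in> Y" "a < y1" using below_in_Y[of y1] y12 by blast
    then show False using G_less_if_spt[of y1 a y2] y12 G_nonneg[of a] by simp
  qed
  show ?thesis
  proof (cases "?A = {}")
    case True
    show ?thesis unfolding True by (rule countable_empty)
  next
    case False
    then obtain y0 where y0: "y0 \<in> ?A" by blast
    have "?A \<subseteq> {y0}"
    proof
      fix y assume y: "y \<in> ?A"
      show "y \<in> {y0}" using less[OF y0 y] less[OF y y0] by (cases y y0 rule: linorder_cases) auto
    qed
    then show ?thesis by (rule countable_subset) simp
  qed
qed

text \<open>Away from the two countable sets just treated, the sets \<open>W y\<close> are open and
  non-empty, and they are disjoint because \<open>S y\<close> is contained in \<open>D y'\<close>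
  for y < y'. A family of disjoint non-empty open sets in Euclidean space is countable.\<close>

lemma countable_kp_neq_km: "countable {y \<in> Y \<inter> spt \<nu>. kp y \<noteq> km y}"
proof -
  define Gap where "Gap = {y \<in> Y \<inter> spt \<nu>. \<exists>b\<in>Y. y < b \<and> G y = G b}"
  define Zero where "Zero = {y \<in> Y \<inter> spt \<nu>. G y = 0}"
  define A where "A = {y \<in> Y \<inter> spt \<nu>. kp y \<noteq> km y} - Gap - Zero"
  define W where "W y = {x \<in> X. km y < ereal (dy s x y) \<and> ereal (dy s x y) < kp y}" for y
  have ne: "W y \<noteq> {}" and opn: "open (W y)" if "y \<in> A" for y
  proof -
    have y: "y \<in> Y" "km y < kp y" using that km_le_kp[of y] by (auto simp: A_def less_le)
    have G0: "0 < G y" using that G_nonneg[of y] by (auto simp: A_def Zero_def less_le)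
    \<comment> \<open>With mass strictly between 0 and 1, s_y takes values on both sides of the
      interval between a and b, so connectedness of X yields a point of \<open>W y\<close>. If G y
      were 1, G would be constant to the right of y, and y would belong to
      \<open>Gap\<close>.\<close>
    have G1: "G y < 1"
    proof (rule ccontr)
      assume "\<not> G y < 1"
      obtain b where b: "b \<in> Y" "y < b" using above_in_Y y by blast
      have "G y = G b" using G_mono[of y b] b G_le_1[of b] \<open>\<not> G y < 1\<close> by simp
      then show False using that b unfolding A_def Gap_def by blast
    qed
    obtain a where a: "km y < ereal a" "ereal a < kp y" using ereal_dense2[OF y(2)] by blast
    obtain b where b: "ereal a < ereal b" "ereal b < kp y" using ereal_dense2[OF a(2)] by blast
    have "G y \<le> H y a" using km_le_iff[OF y(1), of a] less_imp_le[OF a(1)] by simp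
    then have "H y a \<noteq> 0" using G0 by simp
    then have "{x \<in> X. dy s x y \<le> a} \<noteq> {}" unfolding H_def by (metis measure_empty)
    then obtain x1 where x1: "x1 \<in> X" "dy s x1 y \<le> a" by blast
    have "H y b \<le> G y" using le_kp_iff[OF y(1), of b] less_imp_le[OF b(2)] by simp
    then have "H y b \<noteq> 1" using G1 by simp
    then obtain x2 where x2: "x2 \<in> X" "b < dy s x2 y" using H_eq_1[OF y(1), of b] by (meson not_le)
    have "\<exists>x\<in>X. dy s x y = a" using x1 x2 b by (intro dy_value_between[OF y(1), of x1 x2]) auto
    then show "W y \<noteq> {}" using a unfolding W_def by auto
    have "open {x \<in> X. dy s x y \<in> {t. km y < ereal t \<and> ereal t < kp y}}"
    proof -
      have "open {t. km y < ereal t \<and> ereal t < kp y}"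
        by (intro open_Collect_conj open_Collect_less continuous_intros)
      then have "open ((\<lambda>x. dy s x y) -` {t. km y < ereal t \<and> ereal t < kp y} \<inter> X)"
        using continuous_on_dy_x[OF y(1)] X(1) continuous_on_open_vimage by blast
      then show ?thesis by (simp add: vimage_def Int_def conj_commute)
    qed
    then show "open (W y)" by (simp add: W_def)
  qed
  have disj: "W y \<inter> W y' = {}" if "y \<in> A" "y' \<in> A" "y < y'" for y y'
  proof -
    have "G y \<noteq> G y'" using that unfolding A_def Gap_def by blast
    then have "S y \<subseteq> D y'" using that G_mono[of y y'] by (intro S_subset_D) (auto simp: A_def)
    then show ?thesis unfolding S_def D_def W_def by (force dest: less_imp_le)
  qed
  have inj: "inj_on W A"
  proof (rule inj_onI)
    fix y y' assume "y \<in> A" "y' \<in> A" "W y = W y'"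
    then show "y = y'" using disj[of y y'] disj[of y' y] ne[of y] by (metis Int_absorb linorder_less_linear)
  qed
  have "countable (W ` A)"
  proof (rule countable_disjoint_open_subsets)
    show "\<And>S. S \<in> W ` A \<Longrightarrow> open S" using opn by blast
    show "disjoint (W ` A)"
      unfolding pairwise_def disjnt_def using disj by (metis (no_types, lifting) Int_commute imageE linorder_less_linear)
  qed
  then have "countable A" using inj countable_image_inj_on by blast
  then have "countable (A \<union> Gap \<union> Zero)"
    using countable_right_gaps countable_spt_G_eq_0 by (simp add: Gap_def Zero_def)
  then show ?thesis by (rule countable_subset[rotated]) (auto simp: A_def)
qed

section \<open>Matched values and the smallest admissible value\<close>

lemma F_rule_iff: "matched x y \<longleftrightarrow> y \<in> Y \<and> x \<in> X \<and> ereal (dy s x y) = kp y"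
  unfolding F_rule_def level_eq_def \<mu>(2) \<nu>(2) by auto

text \<open>Since level sets have no interior, the open set where \<open>s\<^sub>y < k\<^sup>+\<close> stays inside the
  corresponding set for larger \<open>y\<close>. Hence a point matched with two values is matched with everything
  in between, in particular with a rational.\<close>

lemma F_rule_between:
  assumes "matched x y" "matched x y'" "y \<le> q" "q \<le> y'"
  shows "matched x q"
proof -
  have y: "y \<in> Y" "y' \<in> Y" "x \<in> X" "ereal (dy s x y) = kp y" "ereal (dy s x y') = kp y'"
    using assms by (auto simp: F_rule_iff)
  have q: "q \<in> Y" using interval_Y[of y y' q] y assms by auto
  have "x \<in> S q" using S_mono[OF y(1) q assms(3)] y unfolding S_def by auto
  moreover have "\<not> ereal (dy s x q) < kp q"
  proof
    assume less: "ereal (dy s x q) < kp q"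
    obtain k where k: "ereal (dy s x q) < ereal k" "ereal k < kp q" using ereal_dense2[OF less] by blast
    have "((\<lambda>x. dy s x q) \<longlongrightarrow> dy s x q) (at x)"
      using continuous_on_dy_x[OF q] X(1) y(3) by (simp add: continuous_on_eq_continuous_at isCont_def)
    then have "\<forall>\<^sub>F z in at x. dy s z q < k" using k(1) by (intro order_tendstoD(2)) auto
    then obtain e where e: "e > 0" "\<And>z. z \<noteq> x \<Longrightarrow> dist z x < e \<Longrightarrow> dy s z q < k"
      unfolding eventually_at by auto
    \<comment> \<open>Since x sits exactly at the level k+(y'), this z lies outside
      \<open>S y'\<close>; yet it is close enough to x to lie in \<open>S q\<close>, which is
      contained in \<open>S y'\<close>.\<close>
    obtain z where z: "z \<in> X" "dist z x < e" "dy s x y' < dy s z y'" using not_local_max[OF y(3,2) e(1)] by blast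
    have "dy s z q < k" using e(2)[OF _ z(2)] z(3) by auto
    then have "ereal (dy s z q) < ereal k" by simp
    also note k(2)
    finally have "z \<in> S q" using z(1) unfolding S_def by simp
    then have "ereal (dy s z y') \<le> kp y'" using S_mono[OF q y(2) assms(4)] unfolding S_def by auto
    also have "\<dots> = ereal (dy s x y')" using y by simp
    finally show False using z(3) by simp
  qed
  ultimately show ?thesis using q y(3) unfolding F_rule_iff S_def by auto
qed

lemma null_sets_F_rule: "{x \<in> X. matched x y} \<in> null_sets \<mu>"
proof (cases "y \<in> Y")
  case True
  show ?thesis
  proof (cases "kp y")
    case (real k)
    then have "{x \<in> X. matched x y} = {x \<in> X. dy s x y = k}" using True by (auto simp: F_rule_iff)
    then show ?thesis using null_sets_level[OF True, of k] by simp
  qed (auto simp: F_rule_iff)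
qed (auto simp: F_rule_iff)

lemma F_rule_unique_AE: "AE x in \<mu>. \<forall>y y'. matched x y \<longrightarrow> matched x y' \<longrightarrow> y = y'"
proof (rule AE_I')
  show "(\<Union>q\<in>\<rat>. {x \<in> X. matched x q}) \<in> null_sets \<mu>"
    by (rule null_sets_UN'[OF countable_rat null_sets_F_rule])
  have *: "\<exists>q\<in>\<rat>. matched x q" if "matched x y" "matched x y'" "y < y'" for x y y'
    using Rats_dense_in_real[OF that(3)] F_rule_between[OF that(1,2)] by (meson less_imp_le)
  show "{x \<in> space \<mu>. \<not> (\<forall>y y'. matched x y \<longrightarrow> matched x y' \<longrightarrow> y = y')} \<subseteq> (\<Union>q\<in>\<rat>. {x \<in> X. matched x q})"
  proof
    fix x assume "x \<in> {x \<in> space \<mu>. \<not> (\<forall>y y'. matched x y \<longrightarrow> matched x y' \<longrightarrow> y = y')}"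
    then obtain y y' where "x \<in> X" "matched x y" "matched x y'" "y \<noteq> y'" using \<mu>(2) by blast
    then show "x \<in> (\<Union>q\<in>\<rat>. {x \<in> X. matched x q})" using *[of x y y'] *[of x y' y] by (cases "y < y'") auto
  qed
qed

text \<open>Y has no end points and may be bounded or not. Running minima and maxima of an
  enumeration of its rationals approach both ends in every case, and monotone continuity of \<nu>
  applies along them.\<close>

lemma G_small_large: assumes e: "0 < e" shows "\<exists>y\<in>\<rat> \<inter> Y. G y < e" "\<exists>y\<in>\<rat> \<inter> Y. 1 - e < G y"
proof -
  obtain y0 where y0: "y0 \<in> Y" using \<nu>.not_empty \<nu>(2) by blast
  obtain b0 where b0: "b0 \<in> Y" "y0 < b0" using above_in_Y[OF y0] by blast
  have ne: "\<rat> \<inter> Y \<noteq> {}" using rational_between[OF y0 b0] by blast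
  have cnt: "countable (\<rat> \<inter> Y)" using countable_rat by (rule countable_subset[rotated]) auto
  define q where "q = from_nat_into (\<rat> \<inter> Y)"
  have qY: "q n \<in> \<rat> \<inter> Y" for n unfolding q_def by (rule from_nat_into[OF ne])
  have q_surj: "\<exists>n. q n = r" if "r \<in> \<rat> \<inter> Y" for r
    unfolding q_def using from_nat_into_surj[OF cnt that] by blast
  define m where "m n = Min (q ` {..n})" for n
  define M where "M n = Max (q ` {..n})" for n
  have mMq: "m n \<in> q ` {..n}" "M n \<in> q ` {..n}" for n
    unfolding m_def M_def by (rule Min_in Max_in; simp)+
  have mM: "m n \<in> \<rat> \<inter> Y" "M n \<in> \<rat> \<inter> Y" for n
    using mMq[of n] qY by auto
  have mq: "m n \<le> q n" "q n \<le> M n" for n unfolding m_def M_def by auto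
  have dec: "decseq (\<lambda>n. {t \<in> Y. t < m n})"
  proof (unfold decseq_def, intro allI impI)
    fix i j :: nat assume "i \<le> j"
    then have "m j \<le> m i" unfolding m_def by (intro Min_antimono) auto
    then show "{t \<in> Y. t < m j} \<subseteq> {t \<in> Y. t < m i}" by auto
  qed
  have inc: "incseq (\<lambda>n. {t \<in> Y. t < M n})"
  proof (unfold incseq_def, intro allI impI)
    fix i j :: nat assume "i \<le> j"
    then have "M i \<le> M j" unfolding M_def by (intro Max_mono) auto
    then show "{t \<in> Y. t < M i} \<subseteq> {t \<in> Y. t < M j}" by auto
  qed
  have empty: "(\<Inter>n. {t \<in> Y. t < m n}) = {}"
  proof (rule ccontr)
    assume "(\<Inter>n. {t \<in> Y. t < m n}) \<noteq> {}"
    then obtain t where t: "t \<in> Y" "\<And>n. t < m n" by blast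
    obtain a where "a \<in> Y" "a < t" using below_in_Y t by blast
    then obtain r where r: "r \<in> \<rat> \<inter> Y" "r < t" using rational_between t by blast
    then obtain n where "q n = r" using q_surj by blast
    then show False using mq(1)[of n] t(2)[of n] r by simp
  qed
  have full: "(\<Union>n. {t \<in> Y. t < M n}) = space \<nu>"
  proof (rule antisym)
    show "space \<nu> \<subseteq> (\<Union>n. {t \<in> Y. t < M n})"
    proof
      fix t assume "t \<in> space \<nu>"
      then have t: "t \<in> Y" using \<nu>(2) by simp
      obtain b where "b \<in> Y" "t < b" using above_in_Y t by blast
      then obtain r where r: "r \<in> \<rat> \<inter> Y" "t < r" using rational_between t by blast
      then obtain n where "q n = r" using q_surj by blast
      then have "t < M n" using mq(2)[of n] r by simp
      then show "t \<in> (\<Union>n. {t \<in> Y. t < M n})" using t by blast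
    qed
  qed (auto simp: \<nu>(2))
  have "(\<lambda>n. G (m n)) \<longlonglongrightarrow> measure \<nu> (\<Inter>n. {t \<in> Y. t < m n})"
    unfolding G_def by (intro \<nu>.finite_Lim_measure_decseq dec) (auto simp: ray_sets)
  then have "\<forall>\<^sub>F n in sequentially. G (m n) < e"
    using e unfolding empty by (intro order_tendstoD(2)) auto
  then obtain n where "G (m n) < e" by (auto simp: eventually_sequentially)
  then show "\<exists>y\<in>\<rat> \<inter> Y. G y < e" using mM by blast
  have "(\<lambda>n. G (M n)) \<longlonglongrightarrow> measure \<nu> (\<Union>n. {t \<in> Y. t < M n})"
    unfolding G_def by (intro \<nu>.finite_Lim_measure_incseq inc) (auto simp: ray_sets)
  then have "(\<lambda>n. G (M n)) \<longlonglongrightarrow> 1" unfolding full by (simp add: \<nu>.prob_space)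
  then have "\<forall>\<^sub>F n in sequentially. 1 - e < G (M n)"
    using e by (intro order_tendstoD(1)) auto
  then obtain n where "1 - e < G (M n)" by (auto simp: eventually_sequentially)
  then show "\<exists>y\<in>\<rat> \<inter> Y. 1 - e < G y" using mM by blast
qed

text \<open>The two existence conditions make the set non-empty and, by monotonicity of S, bounded
  below. The points violating them turn out to form a null set; an arbitrary element of Y there
  keeps the values of \<open>F0\<close> in Y throughout X.\<close>

definition F0 where "F0 x = (if (\<exists>y\<in>Y. x \<in> S y) \<and> (\<exists>y\<in>Y. x \<notin> S y) then Inf {y \<in> Y. x \<in> S y} else (SOME y. y \<in> Y))"

text \<open>Right continuity of k+ shows that the infimum is attained. Left continuity of k- gives
  the last inequality: for t below \<open>F0 x\<close> the point x lies outside \<open>S t\<close>,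
  hence s_y(x,t) > k+(t) \<ge> k-(t), and t tends to \<open>F0 x\<close>.\<close>

lemma F0_properties:
  assumes x: "x \<in> X" and y1: "y1 \<in> Y" "x \<notin> S y1" and y2: "y2 \<in> Y" "x \<in> S y2"
  shows "F0 x \<in> Y" "\<And>y. y \<in> Y \<Longrightarrow> y < F0 x \<Longrightarrow> x \<notin> S y" "\<And>y. y \<in> Y \<Longrightarrow> F0 x \<le> y \<Longrightarrow> x \<in> S y"
    "km (F0 x) \<le> ereal (dy s x (F0 x))"
proof -
  let ?A = "{y \<in> Y. x \<in> S y}"
  have F0: "F0 x = Inf ?A" using y1 y2 unfolding F0_def by auto
  have lb: "y1 \<le> y" if "y \<in> ?A" for y using that y1 S_mono[of y y1] by (cases "y \<le> y1") auto
  have bdd: "bdd_below ?A" using lb by (meson bdd_belowI)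
  have "y1 \<le> F0 x" "F0 x \<le> y2"
    unfolding F0 using lb y2 by (auto intro!: cInf_greatest cInf_lower bdd)
  then show FY: "F0 x \<in> Y" using interval_Y y1 y2 by blast
  show below: "x \<notin> S y" if "y \<in> Y" "y < F0 x" for y
    using cInf_lower[OF _ bdd, of y] that unfolding F0 by auto
  have above: "x \<in> S y" if y: "y \<in> Y" "F0 x < y" for y
  proof -
    have "?A \<noteq> {}" using y2 by blast
    then obtain a where "a \<in> ?A" "a < y" using y(2) cInf_less_iff[OF _ bdd] unfolding F0 by blast
    then show ?thesis using S_mono[of a y] y by auto
  qed
  have evY: "\<forall>\<^sub>F t in at (F0 x). t \<in> Y" by (rule eventually_at_in_open'[OF Y(1) FY])
  have lim: "((\<lambda>t. ereal (dy s x t)) \<longlongrightarrow> ereal (dy s x (F0 x))) (at (F0 x))"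
    using tendsto_dy_y[OF x FY] by simp
  have "ereal (dy s x (F0 x)) \<le> kp (F0 x)"
  proof (rule tendsto_le)
    show "(kp \<longlongrightarrow> kp (F0 x)) (at_right (F0 x))" using continuous_kp[OF FY] by (simp add: continuous_within)
    show "((\<lambda>t. ereal (dy s x t)) \<longlongrightarrow> ereal (dy s x (F0 x))) (at_right (F0 x))"
      using lim filterlim_at_split by blast
    have "\<forall>\<^sub>F t in at_right (F0 x). t \<in> Y" using evY unfolding eventually_at_split by blast
    then show "\<forall>\<^sub>F t in at_right (F0 x). ereal (dy s x t) \<le> kp t"
      using eventually_at_right_less[of "F0 x"] by eventually_elim (use above S_def in auto)
  qed simp
  then have "x \<in> S (F0 x)" using x by (simp add: S_def)
  then show "x \<in> S y" if "y \<in> Y" "F0 x \<le> y" for y using above[OF that(1)] that(2) by (cases "F0 x = y") auto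
  show "km (F0 x) \<le> ereal (dy s x (F0 x))"
  proof (rule tendsto_le)
    show "(km \<longlongrightarrow> km (F0 x)) (at_left (F0 x))" using continuous_km[OF FY] by (simp add: continuous_within)
    show "((\<lambda>t. ereal (dy s x t)) \<longlongrightarrow> ereal (dy s x (F0 x))) (at_left (F0 x))"
      using lim filterlim_at_split by blast
    have "\<forall>\<^sub>F t in at_left (F0 x). t \<in> Y" using evY unfolding eventually_at_split by blast
    moreover have "\<forall>\<^sub>F t in at_left (F0 x). t < F0 x"
      using eventually_at_left_real[of "F0 x - 1" "F0 x"] by (auto elim: eventually_mono)
    ultimately show "\<forall>\<^sub>F t in at_left (F0 x). km t \<le> ereal (dy s x t)"
    proof eventually_elim
      case (elim t)
      then have "kp t < ereal (dy s x t)" using below[of t] x by (auto simp: S_def)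
      then show ?case using km_le_kp[of t] elim by simp
    qed
  qed simp
qed

text \<open>By the limits of G at the ends of Y, almost every x lies in some \<open>S q\<close> and
  outside another. If \<open>F0 x\<close> were outside the support, two rationals with equal G would
  enclose it, and x would lie in the null difference of their sets S. In the support, k- < k+ at
  \<open>F0 x\<close> would put x in one of countably many null bands; so k- = k+ there, and the
  bounds of \<open>F0_properties\<close> collapse to equality.\<close>

lemma F0_AE:
  "AE x in \<mu>. matched x (F0 x) \<and> (\<forall>y\<in>Y. y < F0 x \<longrightarrow> x \<notin> S y) \<and> (\<forall>y\<in>Y. F0 x \<le> y \<longrightarrow> x \<in> S y)"
proof -
  let ?Q = "\<rat> \<inter> Y"
  have cntQ: "countable ?Q" using countable_rat by (rule countable_subset[rotated]) auto
  have Qne: "?Q \<noteq> {}" using G_small_large(1)[of 1] by auto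
  have AEI: "AE x in \<mu>. P x" if "A \<in> sets \<mu>" "measure \<mu> A \<le> 0" "\<And>x. x \<in> X \<Longrightarrow> x \<notin> A \<Longrightarrow> P x" for A P
    by (rule AE_I'[of A]) (use that \<mu>(2) in \<open>auto simp: null_sets_def \<mu>.emeasure_eq_measure measure_le_0_iff\<close>)
  have S_sets': "(\<Inter>q\<in>?Q. S q) \<in> sets \<mu>" "(\<Union>q\<in>?Q. S q) \<in> sets \<mu>"
    using S_sets cntQ Qne by (auto intro!: sets.countable_UN' sets.countable_INT')
  have 1: "AE x in \<mu>. \<exists>q\<in>?Q. x \<notin> S q"
  proof (rule AEI[OF S_sets'(1)])
    show "measure \<mu> (\<Inter>q\<in>?Q. S q) \<le> 0"
    proof (rule field_le_epsilon)
      fix e :: real assume "0 < e"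
      then obtain q where q: "q \<in> ?Q" "G q < e" using G_small_large(1) by blast
      have "measure \<mu> (\<Inter>q\<in>?Q. S q) \<le> measure \<mu> (S q)" using q(1) S_sets by (intro \<mu>.finite_measure_mono) auto
      then show "measure \<mu> (\<Inter>q\<in>?Q. S q) \<le> 0 + e" using q measure_S[of q] by simp
    qed
  qed blast
  have 2: "AE x in \<mu>. \<exists>q\<in>?Q. x \<in> S q"
  proof (rule AEI)
    show "space \<mu> - (\<Union>q\<in>?Q. S q) \<in> sets \<mu>" using S_sets'(2) by auto
    show "measure \<mu> (space \<mu> - (\<Union>q\<in>?Q. S q)) \<le> 0"
    proof (rule field_le_epsilon)
      fix e :: real assume "0 < e"
      then obtain q where q: "q \<in> ?Q" "1 - e < G q" using G_small_large(2) by blast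
      have "measure \<mu> (S q) \<le> measure \<mu> (\<Union>q\<in>?Q. S q)" using q(1) S_sets'(2) by (intro \<mu>.finite_measure_mono) auto
      then show "measure \<mu> (space \<mu> - (\<Union>q\<in>?Q. S q)) \<le> 0 + e"
        using q measure_S[of q] \<mu>.prob_compl[OF S_sets'(2)] by simp
    qed
  qed (auto simp: \<mu>(2))
  \<comment> \<open>The difference of the two sets has mass G (snd p) - G (fst p) = 0; rational
    pairs keep the union of these null sets countable.\<close>
  have 3: "AE x in \<mu>. \<forall>p\<in>?Q \<times> ?Q. fst p \<le> snd p \<longrightarrow> G (fst p) = G (snd p) \<longrightarrow> x \<in> S (snd p) \<longrightarrow> x \<in> S (fst p)"
  proof (rule AE_ball_countable')
    show "countable (?Q \<times> ?Q)" using cntQ by blast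
    fix p assume p: "p \<in> ?Q \<times> ?Q"
    show "AE x in \<mu>. fst p \<le> snd p \<longrightarrow> G (fst p) = G (snd p) \<longrightarrow> x \<in> S (snd p) \<longrightarrow> x \<in> S (fst p)"
    proof (cases "fst p \<le> snd p \<and> G (fst p) = G (snd p)")
      case True
      show ?thesis
      proof (rule AEI)
        show "S (snd p) - S (fst p) \<in> sets \<mu>" using p S_sets by auto
        have "measure \<mu> (S (snd p) - S (fst p)) = measure \<mu> (S (snd p)) - measure \<mu> (S (fst p))"
          using p S_sets S_mono[of "fst p" "snd p"] True by (intro \<mu>.finite_measure_Diff) auto
        then show "measure \<mu> (S (snd p) - S (fst p)) \<le> 0" using p measure_S True by auto
      qed blast
    qed auto
  qed
  have 4: "AE x in \<mu>. \<forall>y\<in>{y \<in> Y \<inter> spt \<nu>. kp y \<noteq> km y}. \<not> (km y \<le> ereal (dy s x y) \<and> ereal (dy s x y) \<le> kp y)"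
  proof (rule AE_ball_countable'[OF _ countable_kp_neq_km])
    fix y assume "y \<in> {y \<in> Y \<inter> spt \<nu>. kp y \<noteq> km y}"
    then obtain N where N: "N \<in> null_sets \<mu>" "{x \<in> X. km y \<le> ereal (dy s x y) \<and> ereal (dy s x y) \<le> kp y} \<subseteq> N"
      using null_sets_between[of y] by blast
    show "AE x in \<mu>. \<not> (km y \<le> ereal (dy s x y) \<and> ereal (dy s x y) \<le> kp y)"
      by (rule AE_I'[OF N(1)]) (use N(2) \<mu>(2) in auto)
  qed
  have 5: "AE x in \<mu>. x \<in> X" using AE_space[of \<mu>] \<mu>(2) by simp
  from 1 2 3 4 5 show ?thesis
  proof eventually_elim
    case (elim x)
    then obtain y1 y2 where y12: "y1 \<in> Y" "x \<notin> S y1" "y2 \<in> Y" "x \<in> S y2" and x: "x \<in> X" by blast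
    note F = F0_properties[OF x y12]
    have le: "ereal (dy s x (F0 x)) \<le> kp (F0 x)" using F(3)[OF F(1)] by (simp add: S_def)
    have "F0 x \<in> spt \<nu>"
    proof (rule ccontr)
      assume "F0 x \<notin> spt \<nu>"
      then obtain a b where ab: "a \<in> Y" "b \<in> Y" "a < F0 x" "F0 x < b" "G a = G b" using gap_if_not_spt F(1) by metis
      obtain q where q: "q \<in> ?Q" "a < q" "q < F0 x" using rational_between[OF ab(1) F(1) ab(3)] by blast
      obtain r where r: "r \<in> ?Q" "F0 x < r" "r < b" using rational_between[OF F(1) ab(2,4)] by blast
      have "G q = G r" using G_mono[of a q] G_mono[of q r] G_mono[of r b] ab q r by simp
      moreover have "x \<in> S r" "x \<notin> S q" using F(2)[of q] F(3)[of r] q r by auto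
      moreover have "(q, r) \<in> ?Q \<times> ?Q" using q r by blast
      ultimately show False using bspec[OF elim(3), of "(q, r)"] q r by simp
    qed
    then have "kp (F0 x) = km (F0 x)" using elim(4) F(1,4) le by blast
    then have "ereal (dy s x (F0 x)) = kp (F0 x)" using F(4) le by simp
    then show ?case using F x by (auto simp: F_rule_iff)
  qed
qed

lemma F0_in_Y: "x \<in> X \<Longrightarrow> F0 x \<in> Y"
proof (cases "(\<exists>y\<in>Y. x \<in> S y) \<and> (\<exists>y\<in>Y. x \<notin> S y)")
  case False
  have "\<exists>y. y \<in> Y" using \<nu>.not_empty \<nu>(2) by blast
  then show ?thesis using False someI_ex[of "\<lambda>y. y \<in> Y"] unfolding F0_def by auto
qed (use F0_properties(1) in blast)

lemma F0_measurable: "F0 \<in> measurable \<mu> \<nu>"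
proof -
  let ?Q = "\<rat> \<inter> Y"
  have cntQ: "countable ?Q" using countable_rat by (rule countable_subset[rotated]) auto
  define P where "P = (\<Union>q\<in>?Q. S q) - (\<Inter>q\<in>?Q. S q)"
  have Qne: "?Q \<noteq> {}" using G_small_large(1)[of 1] by auto
  have SX: "S q \<subseteq> X" for q by (auto simp: S_def)
  have P: "P \<in> sets \<mu>" unfolding P_def
    using S_sets cntQ Qne by (intro sets.Diff sets.countable_UN' sets.countable_INT') auto
  have P_iff: "x \<in> P \<longleftrightarrow> (\<exists>y\<in>Y. x \<in> S y) \<and> (\<exists>y\<in>Y. x \<notin> S y)" for x
  proof
    assume *: "(\<exists>y\<in>Y. x \<in> S y) \<and> (\<exists>y\<in>Y. x \<notin> S y)"
    then obtain y1 y2 where y: "y1 \<in> Y" "x \<in> S y1" "y2 \<in> Y" "x \<notin> S y2" by blast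
    obtain b where b: "b \<in> Y" "y1 < b" using above_in_Y[OF y(1)] by blast
    obtain q where q: "q \<in> ?Q" "y1 < q" using rational_between[OF y(1) b] by blast
    obtain a where a: "a \<in> Y" "a < y2" using below_in_Y[OF y(3)] by blast
    obtain r where r: "r \<in> ?Q" "r < y2" using rational_between[OF a(1) y(3) a(2)] by blast
    have "x \<in> S q" "x \<notin> S r" using S_mono[of y1 q] S_mono[of r y2] q r y by auto
    then show "x \<in> P" using q r unfolding P_def by blast
  qed (auto simp: P_def)
  have "F0 \<in> borel_measurable \<mu>"
    unfolding borel_measurable_iff_less
  proof
    fix t
    \<comment> \<open>On \<open>P\<close> the infimum is below t exactly if x lies in
      \<open>S q\<close> for a rational q < t; off \<open>P\<close> the map has its constant default
      value.\<close>
    let ?U = "(P \<inter> (\<Union>q\<in>?Q \<inter> {..<t}. S q)) \<union> (if (SOME y. y \<in> Y) < t then space \<mu> - P else {})"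
    have "{x \<in> space \<mu>. F0 x < t} = ?U"
    proof -
      have 1: "F0 x < t \<longleftrightarrow> (\<exists>q\<in>?Q. q < t \<and> x \<in> S q)" if xP: "x \<in> P" for x
      proof -
        have x: "x \<in> X" using xP SX unfolding P_def by auto
        obtain y1 y2 where y: "y1 \<in> Y" "x \<notin> S y1" "y2 \<in> Y" "x \<in> S y2" using xP P_iff by blast
        note F = F0_properties[OF x y]
        show ?thesis
        proof
          assume "F0 x < t"
          obtain b where b: "b \<in> Y" "F0 x < b" using above_in_Y[OF F(1)] by blast
          obtain q where "q \<in> \<rat>" "F0 x < q" "q < min b t"
            using Rats_dense_in_real[of "F0 x" "min b t"] b \<open>F0 x < t\<close> by auto
          then show "\<exists>q\<in>?Q. q < t \<and> x \<in> S q" using F(3)[of q] interval_Y[OF F(1) b(1), of q] by auto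
        next
          assume "\<exists>q\<in>?Q. q < t \<and> x \<in> S q"
          then show "F0 x < t" using F(2) by (meson IntD2 le_less_trans not_le)
        qed
      qed
      have 2: "F0 x = (SOME y. y \<in> Y)" if "x \<notin> P" for x using that P_iff unfolding F0_def by auto
      have PX: "P \<subseteq> X" using SX unfolding P_def by blast
      show ?thesis
      proof (rule set_eqI)
        fix x show "x \<in> {x \<in> space \<mu>. F0 x < t} \<longleftrightarrow> x \<in> ?U"
        proof (cases "x \<in> P")
          case True
          then show ?thesis using 1[OF True] PX unfolding \<mu>(2) by auto
        next
          case False
          then show ?thesis using 2[OF False] unfolding \<mu>(2) by auto
        qed
      qed
    qed
    moreover have "?U \<in> sets \<mu>"
      using P S_sets cntQ by (intro sets.Un sets.Int sets.countable_UN') auto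
    ultimately show "{x \<in> space \<mu>. F0 x < t} \<in> sets \<mu>" by simp
  qed
  then show ?thesis
    unfolding measurable_cong_sets[OF refl \<nu>(3)]
    by (intro measurable_restrict_space2) (use F0_in_Y \<mu>(2) in auto)
qed

lemma matching_map_F0: "matching F0"
  unfolding matching_map_def using F0_measurable F0_AE by (auto elim: eventually_mono)

lemma matching_map_AE_eq: "matching F \<Longrightarrow> AE x in \<mu>. F x = F0 x"
  unfolding matching_map_def using F_rule_unique_AE F0_AE by (auto elim!: eventually_elim2 dest: spec)

lemma F_rule_ex1_AE: "AE x in \<mu>. \<exists>!y. matched x y"
  using F_rule_unique_AE F0_AE by eventually_elim blast

subsection \<open>Optimality by duality\<close>


text \<open>Clamping keeps the density of the potential bounded and changes neither the sublevel set nor,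
  since the clamping values are not attained by \<open>s\<^sub>y\<close>, the level set.\<close>

definition \<kappa> where "\<kappa> t = (if t \<in> Y then real_of_ereal (max (ereal (- B)) (min (ereal B) (kp t))) else 0)"

lemma B_pos: "0 < B"
proof -
  obtain x where "x \<in> X" using \<mu>.not_empty \<mu>(2) by blast
  moreover obtain y where "y \<in> Y" using \<nu>.not_empty \<nu>(2) by blast
  ultimately show ?thesis using dy_bound[of x y] by linarith
qed

lemma ereal_\<kappa>: "t \<in> Y \<Longrightarrow> ereal (\<kappa> t) = max (ereal (- B)) (min (ereal B) (kp t))"
  unfolding \<kappa>_def by (cases "kp t") (auto simp: max_def min_def)

lemma \<kappa>_bound: "\<bar>\<kappa> t\<bar> \<le> B"
proof (cases "t \<in> Y")
  case True
  have "ereal (- B) \<le> ereal (\<kappa> t)" "ereal (\<kappa> t) \<le> ereal B"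
    unfolding ereal_\<kappa>[OF True] using B_pos by (auto simp: max_def min_def)
  then show ?thesis by simp
qed (use B_pos in \<open>simp add: \<kappa>_def\<close>)

lemma S_iff_\<kappa>: assumes "t \<in> Y" "x \<in> X" shows "x \<in> S t \<longleftrightarrow> dy s x t \<le> \<kappa> t"
proof -
  have "ereal (dy s x t) \<le> ereal B" "\<not> ereal (dy s x t) \<le> ereal (- B)"
    using dy_bound[OF assms(2,1)] by (auto simp: abs_less_iff)
  then have "x \<in> S t \<longleftrightarrow> ereal (dy s x t) \<le> ereal (\<kappa> t)"
    unfolding ereal_\<kappa>[OF assms(1)] S_def le_max_iff_disj min.bounded_iff using assms(2) by blast
  then show ?thesis by simp
qed

lemma F_rule_if_\<kappa>: assumes "t \<in> Y" "x \<in> X" "dy s x t = \<kappa> t" shows "matched x t"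
proof -
  have "ereal (dy s x t) = max (ereal (- B)) (min (ereal B) (kp t))" using ereal_\<kappa> assms by simp
  moreover have "ereal (dy s x t) < ereal B" "ereal (- B) < ereal (dy s x t)"
    using dy_bound[OF assms(2,1)] by (auto simp: abs_less_iff)
  ultimately have "ereal (dy s x t) = kp t" by (auto simp: max_def min_def split: if_splits)
  then show ?thesis using assms by (simp add: F_rule_iff)
qed

text \<open>Upper semicontinuity once more; it makes k+ a Borel function, so that the density of the
  potential can be integrated.\<close>

lemma open_kp_less: "open {t \<in> Y. kp t < ereal c}"
proof (subst open_subopen, rule ballI)
  fix y assume y: "y \<in> {t \<in> Y. kp t < ereal c}"
  then have "\<forall>\<^sub>F t in at y. t \<in> Y \<and> kp t < ereal c" using kp_less_eventually by blast
  then have "\<forall>\<^sub>F t in nhds y. t \<in> Y \<and> kp t < ereal c" using y by (simp add: eventually_nhds_conv_at)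
  then show "\<exists>T. open T \<and> y \<in> T \<and> T \<subseteq> {t \<in> Y. kp t < ereal c}" unfolding eventually_nhds by blast
qed

lemma \<kappa>_measurable[measurable]: "\<kappa> \<in> borel_measurable borel"
  unfolding borel_measurable_iff_less
proof
  fix c
  have *: "\<kappa> t < c \<longleftrightarrow> (- B < c \<and> (B < c \<or> kp t < ereal c))" if "t \<in> Y" for t
  proof -
    have "\<kappa> t < c \<longleftrightarrow> ereal (\<kappa> t) < ereal c" by simp
    also have "\<dots> \<longleftrightarrow> (- B < c \<and> (B < c \<or> kp t < ereal c))"
      unfolding ereal_\<kappa>[OF that] max_less_iff_conj min_less_iff_disj by simp
    finally show ?thesis .
  qed
  have "{t \<in> space borel. \<kappa> t < c} =
      (if - B < c then (if B < c then Y else {t \<in> Y. kp t < ereal c}) else {}) \<union> (if 0 < c then - Y else {})"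
    using * by (auto simp: \<kappa>_def split: if_splits)
  also have "\<dots> \<in> sets borel" using Y(1) open_kp_less by auto
  finally show "{t \<in> space borel. \<kappa> t < c} \<in> sets borel" .
qed

lemma \<kappa>_set_integrable: "set_integrable lborel {a..b} \<kappa>"
  unfolding set_integrable_def
  by (rule integrableI_bounded_set_indicator[where B = B]) (use \<kappa>_bound in \<open>auto simp: emeasure_lborel_Icc_eq\<close>)

lemma dy_set_integrable:
  assumes "x \<in> X" "a \<in> Y" "b \<in> Y"
  shows "set_integrable lborel {a..b} (\<lambda>t. dy s x t)"
  using interval_Y[OF assms(2,3)]
  by (intro borel_integrable_atLeastAtMost' continuous_on_subset[OF continuous_on_dy_y[OF assms(1)]]) auto

lemma s_diff_eq_integral:
  assumes x: "x \<in> X" and ab: "a \<in> Y" "b \<in> Y" "a \<le> b"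
  shows "s (x, b) - s (x, a) = (LINT t:{a..b}|lborel. dy s x t)"
proof -
  have "((\<lambda>t. dy s x t) has_integral s (x, b) - s (x, a)) {a..b}"
  proof (rule fundamental_theorem_of_calculus[OF ab(3)])
    fix t assume "t \<in> {a..b}"
    then have "t \<in> Y" using interval_Y[OF ab(1,2)] by auto
    then show "((\<lambda>t. s (x, t)) has_vector_derivative dy s x t) (at t within {a..b})"
      using s_deriv[OF x] has_real_derivative_iff_has_vector_derivative has_vector_derivative_at_within by blast
  qed
  then show ?thesis
    using set_borel_integral_eq_integral(2)[OF dy_set_integrable[OF x ab(1,2)]] by (simp add: integral_unique)
qed

text \<open>The oriented integral of \<kappa> from a base point in Y. As \<kappa> is 0 outside Y,
  the potential is defined on the whole line.\<close>

definition pot_Y where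
  "pot_Y y = (let y0 = (SOME y. y \<in> Y) in if y0 \<le> y then integral {y0..y} \<kappa> else - integral {y..y0} \<kappa>)"

lemma pot_Y_diff: assumes "a \<le> b" shows "pot_Y b - pot_Y a = (LINT t:{a..b}|lborel. \<kappa> t)"
proof -
  define y0 where "y0 = (SOME y. y \<in> Y)"
  have int: "\<kappa> integrable_on {c..d}" for c d using set_borel_integral_eq_integral(1)[OF \<kappa>_set_integrable] .
  have pot_Y: "pot_Y y = (if y0 \<le> y then integral {y0..y} \<kappa> else - integral {y..y0} \<kappa>)" for y
    unfolding pot_Y_def y0_def by (simp add: Let_def)
  have "pot_Y b - pot_Y a = integral {a..b} \<kappa>"
  proof -
    consider "y0 \<le> a" | "a < y0" "y0 \<le> b" | "b < y0" by linarith
    then show ?thesis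
    proof cases
      case 1
      then show ?thesis using Henstock_Kurzweil_Integration.integral_combine[OF 1 assms int] assms by (simp add: pot_Y)
    next
      case 2
      then show ?thesis using Henstock_Kurzweil_Integration.integral_combine[of a y0 b \<kappa>] int by (simp add: pot_Y)
    next
      case 3
      then show ?thesis using Henstock_Kurzweil_Integration.integral_combine[of a b y0 \<kappa>] int assms by (simp add: pot_Y)
    qed
  qed
  then show ?thesis using set_borel_integral_eq_integral(2)[OF \<kappa>_set_integrable] by simp
qed

lemma pot_Y_lipschitz: "B-lipschitz_on UNIV pot_Y"
proof -
  have "\<bar>pot_Y b - pot_Y a\<bar> \<le> B * (b - a)" if ab: "a \<le> b" for a b
  proof -
    have "\<bar>pot_Y b - pot_Y a\<bar> \<le> (LINT t:{a..b}|lborel. B)"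
      unfolding pot_Y_diff[OF ab] set_lebesgue_integral_def
    proof (rule order_trans[OF integral_abs_bound integral_mono])
      show "integrable lborel (\<lambda>t. \<bar>indicator {a..b} t *\<^sub>R \<kappa> t\<bar>)"
        using \<kappa>_set_integrable[of a b] by (simp add: set_integrable_def)
      show "integrable lborel (\<lambda>t. indicator {a..b} t *\<^sub>R B)" by (simp add: emeasure_lborel_Icc_eq)
      show "\<bar>indicator {a..b} t *\<^sub>R \<kappa> t\<bar> \<le> indicator {a..b} t *\<^sub>R B" for t
        using \<kappa>_bound[of t] by (simp add: indicator_def)
    qed
    also have "\<dots> = B * (b - a)" using ab by (simp add: set_lebesgue_integral_def)
    finally show ?thesis .
  qed
  note * = this
  show ?thesis
  proof (rule lipschitz_onI)
    fix a b :: real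
    show "dist (pot_Y a) (pot_Y b) \<le> B * dist a b"
      using *[of a b] *[of b a] by (cases "a \<le> b") (auto simp: dist_real_def abs_minus_commute)
  qed (use B_pos in simp)
qed

lemma pot_Y_measurable: "pot_Y \<in> borel_measurable \<nu>"
proof -
  have "pot_Y \<in> borel_measurable borel"
    by (intro borel_measurable_continuous_onI lipschitz_on_continuous_on[OF pot_Y_lipschitz])
  then show ?thesis
    unfolding measurable_cong_sets[OF \<nu>(3) refl] by (rule measurable_restrict_space1)
qed

text \<open>The conjugate of \<open>pot_Y\<close>: for almost every x it is the supremum of s(x,y) -
  \<open>pot_Y y\<close> over y in Y, attained at \<open>F0 x\<close> only, as
  \<open>dual_AE\<close> shows.\<close>

definition pot_X where "pot_X x = s (x, F0 x) - pot_Y (F0 x)"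

lemma dual_AE: "AE x in \<mu>. x \<in> X \<and> (\<forall>y\<in>Y. y \<noteq> F0 x \<longrightarrow> s (x, y) < pot_X x + pot_Y y)"
  using AE_space F0_AE F_rule_unique_AE
proof eventually_elim
  case (elim x)
  then have x: "x \<in> X" and F: "matched x (F0 x)" by (auto simp: \<mu>(2))
  then have FY: "F0 x \<in> Y" by (simp add: F_rule_iff)
  have "s (x, y) < pot_X x + pot_Y y" if y: "y \<in> Y" "y \<noteq> F0 x" for y
  proof (cases "F0 x < y")
    case True
    have "(LINT t:{F0 x..y}|lborel. dy s x t) < (LINT t:{F0 x..y}|lborel. \<kappa> t)"
    proof (rule set_lebesgue_integral_less[OF dy_set_integrable[OF x FY y(1)] \<kappa>_set_integrable True])
      fix t assume t: "F0 x < t" "t < y"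
      then have tY: "t \<in> Y" using interval_Y[OF FY y(1)] by simp
      then have "dy s x t \<le> \<kappa> t" using elim t S_iff_\<kappa>[OF tY x] by simp
      \<comment> \<open>Equality would match x with t as well as with \<open>F0 x\<close>, which
        almost every x excludes.\<close>
      moreover have "dy s x t \<noteq> \<kappa> t" using F_rule_if_\<kappa>[OF tY x] F elim t by blast
      ultimately show "dy s x t < \<kappa> t" by simp
    qed
    then show ?thesis
      using s_diff_eq_integral[OF x FY y(1)] pot_Y_diff[of "F0 x" y] True unfolding pot_X_def by simp
  next
    case False
    then have less: "y < F0 x" using y by simp
    have "(LINT t:{y..F0 x}|lborel. \<kappa> t) < (LINT t:{y..F0 x}|lborel. dy s x t)"
    proof (rule set_lebesgue_integral_less[OF \<kappa>_set_integrable dy_set_integrable[OF x y(1) FY] less])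
      fix t assume t: "y < t" "t < F0 x"
      then have tY: "t \<in> Y" using interval_Y[OF y(1) FY] by simp
      then show "\<kappa> t < dy s x t" using elim t S_iff_\<kappa>[OF tY x] by auto
    qed
    then show ?thesis
      using s_diff_eq_integral[OF x y(1) FY] pot_Y_diff[of y "F0 x"] less unfolding pot_X_def by simp
  qed
  then show ?case using x by blast
qed

section \<open>The push-forward of \<mu>\<close>

text \<open>Comparison of distribution functions: up to a null set, \<open>F0 x\<close> \<le> y
  means that x lies in \<open>S y\<close>, a set of mass \<nu>(-\<infinity>,y), and this equals
  \<nu>(-\<infinity>,y] because \<nu> has no atoms. The detour through Borel measures on the line
  makes uniqueness of distribution functions applicable.\<close>

lemma distr_F0: "distr \<mu> \<nu> F0 = \<nu>"
proof -
  have sub: "id \<in> measurable \<nu> borel"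
    unfolding measurable_cong_sets[OF \<nu>(3) refl] by (intro measurable_restrict_space1) simp
  have F0: "F0 \<in> borel_measurable \<mu>" using measurable_comp[OF F0_measurable sub] by simp
  have le_sets: "{x \<in> space \<mu>. F0 x \<le> y} \<in> sets \<mu>" for y using F0 by measurable
  have ray_le: "{t \<in> Y. t \<le> y} \<in> sets \<nu>" for y using Y(1) by (auto simp: sets_\<nu>_iff intro: borel_closed sets.Int Collect_conj_eq)
  have inner: "measure \<mu> {x \<in> space \<mu>. F0 x \<le> y} = measure \<nu> {t \<in> Y. t \<le> y}" for y
  proof -
    \<comment> \<open>A point y outside Y has the whole interval Y on one side.\<close>
    consider "y \<in> Y" | "\<forall>t\<in>Y. y < t" | "\<forall>t\<in>Y. t < y"
      using interval_Y by (metis linorder_less_linear less_imp_le)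
    then show ?thesis
    proof cases
      case 1
      have "measure \<mu> {x \<in> space \<mu>. F0 x \<le> y} = measure \<mu> (S y)"
      proof (rule \<mu>.finite_measure_eq_AE)
        show "AE x in \<mu>. x \<in> {x \<in> space \<mu>. F0 x \<le> y} \<longleftrightarrow> x \<in> S y"
          using AE_space F0_AE by eventually_elim (use 1 in \<open>force simp: not_le\<close>)
      qed (use le_sets S_sets 1 in auto)
      also have "\<dots> = measure \<nu> {t \<in> Y. t < y}" using measure_S[OF 1] by (simp add: G_def)
      also have "\<dots> = measure \<nu> ({t \<in> Y. t < y} \<union> {y})"
        using ray_sets no_atoms[OF 1] 1 by (intro measure_Un_null_set[symmetric]) (auto simp: sets_\<nu>_iff)
      also have "{t \<in> Y. t < y} \<union> {y} = {t \<in> Y. t \<le> y}" using 1 by auto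
      finally show ?thesis .
    next
      case 2
      then have "{x \<in> space \<mu>. F0 x \<le> y} = {}" "{t \<in> Y. t \<le> y} = {}"
        using F0_in_Y \<mu>(2) by (force simp: not_le)+
      then show ?thesis by (simp only: measure_empty)
    next
      case 3
      then have "{x \<in> space \<mu>. F0 x \<le> y} = space \<mu>" "{t \<in> Y. t \<le> y} = space \<nu>"
        using F0_in_Y \<mu>(2) \<nu>(2) by (force simp: less_imp_le)+
      then show ?thesis by (simp only: \<mu>.prob_space \<nu>.prob_space)
    qed
  qed
  interpret M: real_distribution "distr \<mu> borel F0" using \<mu>.real_distribution_distr[OF F0] .
  interpret N: real_distribution "distr \<nu> borel id" using \<nu>.real_distribution_distr[OF sub] .
  have eq: "distr \<mu> borel F0 = distr \<nu> borel id"
  proof (rule cdf_unique[OF M.real_distribution_axioms N.real_distribution_axioms], rule ext)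
    fix y
    have "F0 -` {..y} \<inter> space \<mu> = {x \<in> space \<mu>. F0 x \<le> y}" "id -` {..y} \<inter> space \<nu> = {t \<in> Y. t \<le> y}"
      using \<nu>(2) by auto
    then show "cdf (distr \<mu> borel F0) y = cdf (distr \<nu> borel id) y"
      unfolding cdf_def using inner[of y] F0 sub by (simp add: measure_distr)
  qed
  show ?thesis
  proof (rule measure_eqI)
    fix A assume "A \<in> sets (distr \<mu> \<nu> F0)"
    then have A: "A \<in> sets \<nu>" "A \<in> sets borel" "A \<subseteq> Y" by (auto simp: sets_\<nu>_iff)
    have "emeasure (distr \<mu> \<nu> F0) A = emeasure (distr \<mu> borel F0) A"
      using A F0 F0_measurable by (simp add: emeasure_distr)
    also have "\<dots> = emeasure \<nu> (id -` A \<inter> space \<nu>)" unfolding eq using A sub by (simp add: emeasure_distr)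
    also have "id -` A \<inter> space \<nu> = A" using A \<nu>(2) by auto
    finally show "emeasure (distr \<mu> \<nu> F0) A = emeasure \<nu> A" .
  qed simp
qed


section \<open>Transport plans and the dual bound\<close>

abbreviation R where "R \<equiv> restrict_space borel (X \<times> Y) :: ('a \<times> real) measure"

lemma s_measurable: "s \<in> borel_measurable R"
  by (rule borel_measurable_continuous_on_restrict[OF s_continuous])

lemma space_R: "space R = X \<times> Y" by (simp add: space_restrict_space)

lemma fst_measurable_R: "fst \<in> measurable R \<mu>"
  unfolding measurable_cong_sets[OF refl \<mu>(3)]
  by (intro measurable_restrict_space2 measurable_restrict_space1)
    (auto simp: space_R intro!: borel_measurable_continuous_onI continuous_intros)

lemma snd_measurable_R: "snd \<in> measurable R \<nu>"
  unfolding measurable_cong_sets[OF refl \<nu>(3)]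
  by (intro measurable_restrict_space2 measurable_restrict_space1)
    (auto simp: space_R intro!: borel_measurable_continuous_onI continuous_intros)

lemma Pair_measurable_R: assumes F: "F \<in> measurable \<mu> \<nu>" shows "(\<lambda>x. (x, F x)) \<in> measurable \<mu> R"
proof (rule measurable_restrict_space2)
  show "(\<lambda>x. (x, F x)) \<in> space \<mu> \<rightarrow> X \<times> Y"
    using measurable_space[OF F] \<mu>(2) \<nu>(2) by auto
  have id1: "(\<lambda>x. x) \<in> borel_measurable \<mu>"
    unfolding measurable_cong_sets[OF \<mu>(3) refl] by (intro measurable_restrict_space1) simp
  have id2: "(\<lambda>x. x) \<in> borel_measurable \<nu>"
    unfolding measurable_cong_sets[OF \<nu>(3) refl] by (intro measurable_restrict_space1) simp
  show "(\<lambda>x. (x, F x)) \<in> borel_measurable \<mu>"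
    using measurable_comp[OF F id2] id1 by (intro borel_measurable_Pair) (auto simp: comp_def)
qed

lemma plan_measurable:
  assumes "\<gamma> \<in> plans"
  shows "sets \<gamma> = sets R" "space \<gamma> = X \<times> Y" "fst \<in> measurable \<gamma> \<mu>" "snd \<in> measurable \<gamma> \<nu>"
    "distr \<gamma> \<mu> fst = \<mu>" "distr \<gamma> \<nu> snd = \<nu>" "prob_space \<gamma>"
proof -
  show sets: "sets \<gamma> = sets R" and d1: "distr \<gamma> \<mu> fst = \<mu>" and "distr \<gamma> \<nu> snd = \<nu>"
    using assms unfolding transport_plans_def by (auto simp: \<mu>(2) \<nu>(2))
  show space: "space \<gamma> = X \<times> Y" using sets_eq_imp_space_eq[OF sets] space_R by simp
  show m: "fst \<in> measurable \<gamma> \<mu>" "snd \<in> measurable \<gamma> \<nu>"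
    using fst_measurable_R snd_measurable_R by (simp_all add: measurable_cong_sets[OF sets refl])
  have "emeasure \<gamma> (space \<gamma>) = emeasure (distr \<gamma> \<mu> fst) (space \<mu>)"
  proof -
    have "fst -` space \<mu> \<inter> space \<gamma> = space \<gamma>" using measurable_space[OF m(1)] by blast
    then show ?thesis using m(1) by (simp add: emeasure_distr)
  qed
  then show "prob_space \<gamma>" unfolding d1 by (intro prob_spaceI) (simp add: \<mu>.emeasure_space_1)
qed

lemma graph_plan_F0: "graph F0 \<in> plans"
proof -
  have m: "(\<lambda>x. (x, F0 x)) \<in> measurable \<mu> R" by (rule Pair_measurable_R[OF F0_measurable])
  have "distr (distr \<mu> R (\<lambda>x. (x, F0 x))) \<mu> fst = \<mu>"
    using distr_distr[OF fst_measurable_R m] by (simp add: comp_def)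
  moreover have "distr (distr \<mu> R (\<lambda>x. (x, F0 x))) \<nu> snd = \<nu>"
    using distr_distr[OF snd_measurable_R m] distr_F0 by (simp add: comp_def)
  ultimately show ?thesis unfolding transport_plans_def graph_plan_def \<mu>(2) \<nu>(2) by simp
qed

text \<open>Bounded slope does not bound \<open>pot_Y\<close> if Y is unbounded. But testing the
  dual inequality of x at \<open>F0 x0\<close>, and that of a fixed x0 at \<open>F0 x\<close>,
  bounds the difference of the potential at the two images by 2 M, where M bounds |s|. The statement
  for \<nu> follows since \<nu> is the image of \<mu>.\<close>

lemma pot_Y_bounded: obtains K where "AE x in \<mu>. \<bar>pot_Y (F0 x)\<bar> \<le> K" "AE y in \<nu>. \<bar>pot_Y y\<bar> \<le> K"
proof -
  obtain M where M: "\<And>z. z \<in> X \<times> Y \<Longrightarrow> \<bar>s z\<bar> \<le> M" using s_bounded unfolding bounded_iff by auto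
  have ex: "\<exists>x. x \<in> X \<and> (\<forall>y\<in>Y. y \<noteq> F0 x \<longrightarrow> s (x, y) < pot_X x + pot_Y y)"
  proof (rule ccontr)
    assume none: "\<not> ?thesis"
    have "AE x in \<mu>. False" using dual_AE by eventually_elim (use none in blast)
    then show False by (simp add: \<mu>.AE_False)
  qed
  have bd: "pot_Y (F0 x) \<le> pot_Y y + 2 * M" if "x \<in> X" "\<forall>y\<in>Y. y \<noteq> F0 x \<longrightarrow> s (x, y) < pot_X x + pot_Y y" "y \<in> Y" for x y
  proof (cases "y = F0 x")
    case True
    then show ?thesis using M[of "(x, y)"] that by simp
  next
    case False
    then show ?thesis using that M[of "(x, y)"] M[of "(x, F0 x)"] F0_in_Y[OF that(1)] unfolding pot_X_def by fastforce
  qed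
  obtain x0 where x0: "x0 \<in> X" "\<forall>y\<in>Y. y \<noteq> F0 x0 \<longrightarrow> s (x0, y) < pot_X x0 + pot_Y y" using ex by blast
  define K where "K = \<bar>pot_Y (F0 x0)\<bar> + 2 * M"
  have K: "AE x in \<mu>. \<bar>pot_Y (F0 x)\<bar> \<le> K"
    using dual_AE
  proof eventually_elim
    case (elim x)
    then show ?case using bd[of x "F0 x0"] bd[of x0 "F0 x"] x0 F0_in_Y[of x] F0_in_Y[of x0] unfolding K_def by auto
  qed
  have "AE y in distr \<mu> \<nu> F0. \<bar>pot_Y y\<bar> \<le> K"
    using K pot_Y_measurable F0_measurable by (subst AE_distr_iff) auto
  then show thesis using K that unfolding distr_F0 by blast
qed

lemma pot_X_measurable: "pot_X \<in> borel_measurable \<mu>"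
proof -
  have "(\<lambda>x. s (x, F0 x)) \<in> borel_measurable \<mu>"
    using measurable_comp[OF Pair_measurable_R[OF F0_measurable] s_measurable] by (simp add: comp_def)
  moreover have "(\<lambda>x. pot_Y (F0 x)) \<in> borel_measurable \<mu>"
    using measurable_comp[OF F0_measurable pot_Y_measurable] by (simp add: comp_def)
  ultimately show ?thesis unfolding pot_X_def by (rule borel_measurable_diff)
qed

lemma pot_Y_integrable: "integrable \<nu> pot_Y"
proof -
  obtain K where "AE y in \<nu>. \<bar>pot_Y y\<bar> \<le> K" using pot_Y_bounded by blast
  then show ?thesis using pot_Y_measurable by (intro \<nu>.integrable_const_bound[of _ K]) auto
qed

lemma pot_X_integrable: "integrable \<mu> pot_X"
proof -
  obtain K where K: "AE x in \<mu>. \<bar>pot_Y (F0 x)\<bar> \<le> K" using pot_Y_bounded by blast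
  obtain M where M: "\<And>z. z \<in> X \<times> Y \<Longrightarrow> \<bar>s z\<bar> \<le> M" using s_bounded unfolding bounded_iff by auto
  have "AE x in \<mu>. norm (pot_X x) \<le> M + K"
    using K AE_space
  proof eventually_elim
    case (elim x)
    then show ?case using M[of "(x, F0 x)"] F0_in_Y[of x] unfolding pot_X_def \<mu>(2) by (auto simp: abs_le_iff)
  qed
  then show ?thesis by (rule \<mu>.integrable_const_bound[OF _ pot_X_measurable])
qed

lemma s_integrable: assumes "\<gamma> \<in> plans" shows "integrable \<gamma> s"
proof -
  interpret \<gamma>: prob_space \<gamma> using plan_measurable[OF assms] by blast
  obtain M where M: "\<And>z. z \<in> X \<times> Y \<Longrightarrow> \<bar>s z\<bar> \<le> M" using s_bounded unfolding bounded_iff by auto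
  show ?thesis
  proof (rule \<gamma>.integrable_const_bound[of _ M])
    show "AE z in \<gamma>. norm (s z) \<le> M" using M plan_measurable(2)[OF assms] by (intro AE_I2) auto
    show "s \<in> borel_measurable \<gamma>" using s_measurable by (simp add: measurable_cong_sets[OF plan_measurable(1)[OF assms] refl])
  qed
qed

lemma dual_integral:
  assumes g: "\<gamma> \<in> plans"
  shows "integrable \<gamma> (\<lambda>z. pot_X (fst z) + pot_Y (snd z))"
    "(\<integral>z. pot_X (fst z) + pot_Y (snd z) \<partial>\<gamma>) = (\<integral>x. pot_X x \<partial>\<mu>) + (\<integral>y. pot_Y y \<partial>\<nu>)"
proof -
  note p = plan_measurable[OF g]
  have iu: "integrable \<gamma> (\<lambda>z. pot_X (fst z))" and iv: "integrable \<gamma> (\<lambda>z. pot_Y (snd z))"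
    using integrable_distr[OF p(3), of pot_X] integrable_distr[OF p(4), of pot_Y] pot_X_integrable pot_Y_integrable p(5,6) by simp_all
  then show "integrable \<gamma> (\<lambda>z. pot_X (fst z) + pot_Y (snd z))" by simp
  have "(\<integral>z. pot_X (fst z) \<partial>\<gamma>) = (\<integral>x. pot_X x \<partial>\<mu>)" "(\<integral>z. pot_Y (snd z) \<partial>\<gamma>) = (\<integral>y. pot_Y y \<partial>\<nu>)"
    using integral_distr[OF p(3) pot_X_measurable] integral_distr[OF p(4) pot_Y_measurable] p(5,6) by simp_all
  then show "(\<integral>z. pot_X (fst z) + pot_Y (snd z) \<partial>\<gamma>) = (\<integral>x. pot_X x \<partial>\<mu>) + (\<integral>y. pot_Y y \<partial>\<nu>)" using iu iv by simp
qed

text \<open>In \<open>dual_AE\<close> the quantifier over y stands inside the almost everywhere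
  statement, so the exceptional set is contained in a \<mu>-null set times Y, and every plan
  neglects it by its first marginal.\<close>

lemma dual_plan_AE:
  assumes g: "\<gamma> \<in> plans"
  shows "AE z in \<gamma>. s z \<le> pot_X (fst z) + pot_Y (snd z) \<and> (s z = pot_X (fst z) + pot_Y (snd z) \<longrightarrow> snd z = F0 (fst z))"
proof -
  note p = plan_measurable[OF g]
  have "AE x in distr \<gamma> \<mu> fst. x \<in> X \<and> (\<forall>y\<in>Y. y \<noteq> F0 x \<longrightarrow> s (x, y) < pot_X x + pot_Y y)"
    unfolding p(5) by (rule dual_AE)
  then have "AE z in \<gamma>. fst z \<in> X \<and> (\<forall>y\<in>Y. y \<noteq> F0 (fst z) \<longrightarrow> s (fst z, y) < pot_X (fst z) + pot_Y y)"
    by (rule AE_distrD[OF p(3)])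
  then show ?thesis using AE_space
  proof eventually_elim
    case (elim z)
    then have "snd z \<in> Y" using p(2) by auto
    show ?case
    proof (cases "snd z = F0 (fst z)")
      case True
      then have "s z = pot_X (fst z) + pot_Y (snd z)" unfolding pot_X_def by (metis diff_add_cancel prod.collapse)
      then show ?thesis using True by simp
    next
      case False
      then have "s (fst z, snd z) < pot_X (fst z) + pot_Y (snd z)" using elim \<open>snd z \<in> Y\<close> by blast
      then show ?thesis by simp
    qed
  qed
qed

lemma integral_graph_plan_F0: "integral\<^sup>L (graph F0) s = (\<integral>x. pot_X x \<partial>\<mu>) + (\<integral>y. pot_Y y \<partial>\<nu>)"
proof -
  have m: "(\<lambda>x. (x, F0 x)) \<in> measurable \<mu> R" by (rule Pair_measurable_R[OF F0_measurable])
  have "integral\<^sup>L (graph F0) s = (\<integral>x. s (x, F0 x) \<partial>\<mu>)"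
    unfolding graph_plan_def \<mu>(2) \<nu>(2) by (rule integral_distr[OF m s_measurable])
  also have "\<dots> = (\<integral>x. pot_X (fst (x, F0 x)) + pot_Y (snd (x, F0 x)) \<partial>\<mu>)" by (simp add: pot_X_def)
  also have "\<dots> = (\<integral>z. pot_X (fst z) + pot_Y (snd z) \<partial>graph F0)"
  proof -
    have "(\<lambda>z. pot_X (fst z) + pot_Y (snd z)) \<in> borel_measurable R"
      using measurable_comp[OF fst_measurable_R pot_X_measurable] measurable_comp[OF snd_measurable_R pot_Y_measurable]
      by (auto simp: comp_def)
    then show ?thesis unfolding graph_plan_def \<mu>(2) \<nu>(2) by (rule integral_distr[OF m, symmetric])
  qed
  also have "\<dots> = (\<integral>x. pot_X x \<partial>\<mu>) + (\<integral>y. pot_Y y \<partial>\<nu>)" by (rule dual_integral(2)[OF graph_plan_F0])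
  finally show ?thesis .
qed

text \<open>The integral of the sum of the potentials depends on the marginals only, so it bounds
  every plan, and the plan on the graph of \<open>F0\<close> attains it. Another plan attaining it
  has dual gap 0 almost everywhere and is therefore concentrated on that graph.\<close>

lemma unique_maximizer_F0: "unique_maximizer \<mu> \<nu> s (graph F0)"
  unfolding unique_maximizer_def
proof (intro conjI ballI impI)
  show "graph F0 \<in> plans" by (rule graph_plan_F0)
next
  fix \<gamma> assume g: "\<gamma> \<in> plans"
  have "integral\<^sup>L \<gamma> s \<le> (\<integral>z. pot_X (fst z) + pot_Y (snd z) \<partial>\<gamma>)"
    by (rule integral_mono_AE[OF s_integrable[OF g] dual_integral(1)[OF g]])
      (use dual_plan_AE[OF g] in \<open>auto elim: eventually_mono\<close>)
  then show "integral\<^sup>L \<gamma> s \<le> integral\<^sup>L (graph F0) s"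
    unfolding integral_graph_plan_F0 dual_integral(2)[OF g] .
next
  fix \<gamma> assume g: "\<gamma> \<in> plans" and eq: "integral\<^sup>L \<gamma> s = integral\<^sup>L (graph F0) s"
  note p = plan_measurable[OF g]
  let ?d = "\<lambda>z. (pot_X (fst z) + pot_Y (snd z)) - s z"
  have int: "integrable \<gamma> ?d" using s_integrable[OF g] dual_integral(1)[OF g] by simp
  have nonneg: "AE z in \<gamma>. 0 \<le> ?d z" using dual_plan_AE[OF g] by eventually_elim simp
  have "integral\<^sup>L \<gamma> ?d = (\<integral>z. pot_X (fst z) + pot_Y (snd z) \<partial>\<gamma>) - integral\<^sup>L \<gamma> s"
    by (rule Bochner_Integration.integral_diff[OF dual_integral(1)[OF g] s_integrable[OF g]])
  then have "integral\<^sup>L \<gamma> ?d = 0" using eq integral_graph_plan_F0 dual_integral(2)[OF g] by simp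
  then have "AE z in \<gamma>. ?d z = 0" using integral_nonneg_eq_0_iff_AE[OF int nonneg] by simp
  then have AE: "AE z in \<gamma>. z = (fst z, F0 (fst z))"
    using dual_plan_AE[OF g] by eventually_elim (simp add: prod_eq_iff)
  have m: "(\<lambda>x. (x, F0 x)) \<in> measurable \<mu> R" by (rule Pair_measurable_R[OF F0_measurable])
  \<comment> \<open>A plan concentrated on the graph of \<open>F0\<close> is the image of its own
    first marginal.\<close>
  have "\<gamma> = distr \<gamma> R (\<lambda>z. z)" by (rule distr_id2[symmetric]) (simp add: p(1))
  also have "\<dots> = distr \<gamma> R (\<lambda>z. (fst z, F0 (fst z)))"
  proof (rule distr_cong_AE[OF refl refl AE])
    show "(\<lambda>z. z) \<in> measurable \<gamma> R" by (simp add: measurable_cong_sets[OF p(1) refl])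
    show "(\<lambda>z. (fst z, F0 (fst z))) \<in> measurable \<gamma> R" using measurable_comp[OF p(3) m] by (simp add: comp_def)
  qed
  also have "\<dots> = distr (distr \<gamma> \<mu> fst) R (\<lambda>x. (x, F0 x))" using distr_distr[OF m p(3)] by (simp add: comp_def)
  also have "\<dots> = graph F0" unfolding p(5) graph_plan_def \<mu>(2) \<nu>(2) ..
  finally show "\<gamma> = graph F0" .
qed

lemma unique_maximizer_matching_map:
  assumes F: "matching F"
  shows "unique_maximizer \<mu> \<nu> s (graph F)"
proof -
  have mF: "F \<in> measurable \<mu> \<nu>" using F unfolding matching_map_def by blast
  have "graph F = graph F0"
    unfolding graph_plan_def \<mu>(2) \<nu>(2)
    using matching_map_AE_eq[OF F]
    by (intro distr_cong_AE Pair_measurable_R mF F0_measurable) (auto elim: eventually_mono)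
  then show ?thesis using unique_maximizer_F0 by simp
qed

end

subsection \<open>The continuous version of the map\<close>

locale interval_support_transport = monotone_level_transport +
  fixes a b :: ereal
  assumes spt_eq: "spt \<nu> = {t. a \<le> ereal t \<and> ereal t \<le> b}"
begin

definition I where "I = {y. a < ereal y \<and> ereal y < b}"

lemma I_subset_spt: "I \<subseteq> spt \<nu>"
  unfolding spt_eq I_def by (auto simp: less_imp_le)

text \<open>The support is formed in the line and may stick out of Y, but not out of its closure,
  which carries full mass. An open subset of the closure of an open interval lies in that
  interval.\<close>

lemma I_subset_Y: "I \<subseteq> Y"
proof -
  have "space \<nu> \<inter> closure Y = space \<nu>" using closure_subset[of Y] \<nu>(2) by auto
  then have "spt \<nu> \<subseteq> closure Y" unfolding spt_def by (intro Inter_lower) simp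
  moreover have "open I"
    unfolding I_def by (intro open_Collect_conj open_Collect_less continuous_intros)
  ultimately have "I \<subseteq> interior (closure Y)" using I_subset_spt by (intro interior_maximal) auto
  also have "\<dots> = Y" using convex_interior_closure[of Y] Y connected_convex_1 interior_open by metis
  finally show ?thesis .
qed

text \<open>Points of Y off the support lie in null intervals with rational end points, countably
  many in all, and the end points a and b are not atoms.\<close>

lemma AE_in_I: "AE y in \<nu>. y \<in> I"
proof -
  let ?Q = "{p \<in> (\<rat> \<inter> Y) \<times> (\<rat> \<inter> Y). fst p \<le> snd p \<and> G (fst p) = G (snd p)}"
  let ?N = "(\<Union>p\<in>?Q. {fst p..<snd p}) \<union> {y \<in> Y. ereal y = a} \<union> {y \<in> Y. ereal y = b}"
  have cnt: "countable ?Q"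
    by (rule countable_subset[of _ "\<rat> \<times> \<rat>"]) (auto simp: countable_rat)
  have point: "{y \<in> Y. ereal y = c} \<in> null_sets \<nu>" for c
  proof (cases "\<exists>y\<in>Y. ereal y = c")
    case True
    then obtain y where y: "y \<in> Y" "ereal y = c" by blast
    then have "{y \<in> Y. ereal y = c} = {y}" by auto
    then show ?thesis using no_atoms[OF y(1)] y(1) by (auto simp: null_sets_def sets_\<nu>_iff)
  next
    case False
    then have "{y \<in> Y. ereal y = c} = {}" by blast
    then show ?thesis by (simp only: null_sets.empty_sets)
  qed
  have "(\<Union>p\<in>?Q. {fst p..<snd p}) \<in> null_sets \<nu>"
    by (rule null_sets_UN'[OF cnt]) (auto intro: null_sets_Ico)
  then have N: "?N \<in> null_sets \<nu>" by (intro null_sets.Un point)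
  show ?thesis
  proof (rule AE_I'[OF N], rule subsetI, rule ccontr)
    fix y assume y: "y \<in> {y \<in> space \<nu>. y \<notin> I}" "y \<notin> ?N"
    then have Y: "y \<in> Y" and "y \<notin> I" "ereal y \<noteq> a" "ereal y \<noteq> b" using \<nu>(2) by auto
    then have "y \<notin> spt \<nu>" unfolding spt_eq I_def by (auto simp: less_le)
    then obtain c d where cd: "c \<in> Y" "d \<in> Y" "c < y" "y < d" "G c = G d" using gap_if_not_spt[OF Y] by metis
    obtain q where q: "q \<in> \<rat> \<inter> Y" "c < q" "q < y" using rational_between[OF cd(1) Y cd(3)] by blast
    obtain r where r: "r \<in> \<rat> \<inter> Y" "y < r" "r < d" using rational_between[OF Y cd(2,4)] by blast
    have "G q = G r" using G_mono[of c q] G_mono[of q r] G_mono[of r d] cd q r by simp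
    then have "(q, r) \<in> ?Q" using q r by auto
    moreover have "y \<in> {fst (q, r)..<snd (q, r)}" using q r by simp
    ultimately show False using y(2) by blast
  qed
qed

lemma a_less_b: "a < b"
proof (rule ccontr)
  assume "\<not> a < b"
  then have "I = {}" unfolding I_def using less_trans by blast
  then have "AE y in \<nu>. False" using AE_in_I by simp
  then show False by simp
qed

lemma between_in_I: "a \<le> c \<Longrightarrow> c < d \<Longrightarrow> d \<le> b \<Longrightarrow> \<exists>y\<in>I. c < ereal y \<and> ereal y < d"
  using ereal_dense2[of c d] unfolding I_def by (auto intro: le_less_trans less_le_trans)

lemma S_subset_D_in_I: assumes "y \<in> I" "y' \<in> I" "y < y'" shows "S y \<subseteq> D y'"
proof (rule S_subset_D)
  show "y \<in> Y" "y' \<in> Y" using assms I_subset_Y by auto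
  obtain m where m: "m \<in> I" "ereal y < ereal m" "ereal m < ereal y'"
    using between_in_I[of "ereal y" "ereal y'"] assms unfolding I_def by (auto simp: less_imp_le)
  then show "G y < G y'" using I_subset_Y I_subset_spt assms by (intro G_less_if_spt[of m]) auto
qed

abbreviation rule where "rule \<equiv> Fbar_rule \<mu> \<nu> s a b"

lemma rule_iff:
  "rule x w \<longleftrightarrow> (\<forall>y\<in>I. x \<notin> D y) \<and> w = b \<or> (\<exists>y\<in>I. x \<in> S y \<and> x \<notin> D y \<and> w = ereal y) \<or> (\<forall>y\<in>I. x \<in> S y) \<and> w = a"
  unfolding Fbar_rule_def Let_def \<mu>(2) level_le_kp level_less_km I_def by auto

lemma rule_bounds: "rule x w \<Longrightarrow> a \<le> w \<and> w \<le> b"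
  unfolding rule_iff using a_less_b by (auto simp: I_def less_imp_le)

text \<open>A value obeying the rule is determined by its comparisons with the points of I, and
  these depend on x alone. Uniqueness follows from this; since membership in \<open>D y\<close> is
  an open condition on x, so does half of the continuity.\<close>

lemma rule_less_iff: assumes w: "rule x w" and y: "y \<in> I" shows "w < ereal y \<longleftrightarrow> x \<in> D y"
proof -
  have yab: "a < ereal y" "ereal y < b" using y by (auto simp: I_def)
  from w consider "\<forall>y\<in>I. x \<notin> D y" "w = b" | y0 where "y0 \<in> I" "x \<in> S y0" "x \<notin> D y0" "w = ereal y0"
    | "\<forall>y\<in>I. x \<in> S y" "w = a"
    unfolding rule_iff by blast
  then show ?thesis
  proof cases
    case 1
    then show ?thesis using y yab by auto
  next
    case 2
    have "x \<in> D y" if "y0 < y" using S_subset_D_in_I[OF 2(1) y that] 2(2) by blast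
    moreover have "x \<notin> D y" if "y < y0"
      using S_subset_D_in_I[OF y 2(1) that] D_subset_S[of y] y I_subset_Y 2(3) by blast
    ultimately show ?thesis using 2 by (cases y y0 rule: linorder_cases) auto
  next
    case 3
    obtain y' where y': "y' \<in> I" "ereal y' < ereal y" using between_in_I[of a "ereal y"] yab by (auto simp: less_imp_le)
    then have "x \<in> D y" using S_subset_D_in_I[of y' y] y 3(1) by auto
    then show ?thesis using 3 yab by simp
  qed
qed

lemma rule_le_if_S: assumes w: "rule x w" and y: "y \<in> I" "x \<in> S y" shows "w \<le> ereal y"
proof (rule ccontr)
  assume "\<not> w \<le> ereal y"
  then have "ereal y < w" by (simp add: not_le)
  moreover have "a \<le> ereal y" using y(1) by (simp add: I_def less_imp_le)
  ultimately obtain y' where y': "y' \<in> I" "ereal y < ereal y'" "ereal y' < w"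
    using between_in_I[of "ereal y" w] rule_bounds[OF w] by blast
  then have "x \<in> D y'" using S_subset_D_in_I[of y y'] y by auto
  then have "w < ereal y'" using rule_less_iff[OF w y'(1)] by simp
  then show False using y'(3) by simp
qed

lemma rule_exists: assumes x: "x \<in> X" shows "\<exists>w. rule x w"
proof -
  consider "\<forall>y\<in>I. x \<in> S y" | "\<forall>y\<in>I. x \<notin> S y" | y1 y2 where "y1 \<in> I" "x \<notin> S y1" "y2 \<in> I" "x \<in> S y2"
    by blast
  then show ?thesis
  proof cases
    case 1
    then show ?thesis unfolding rule_iff by blast
  next
    case 2
    then have "\<forall>y\<in>I. x \<notin> D y" using D_subset_S I_subset_Y by blast
    then show ?thesis unfolding rule_iff by blast
  next
    case 3
    have Y: "y1 \<in> Y" "y2 \<in> Y" using 3 I_subset_Y by auto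
    \<comment> \<open>The rule has to be met at every x. The one-sided continuities behind
      \<open>F0_properties\<close> hold without exceptional points, so \<open>F0 x\<close> fulfils
      the middle case here even if x is not matched with it.\<close>
    note F = F0_properties[OF x Y(1) 3(2) Y(2) 3(4)]
    have "y1 \<le> F0 x" "F0 x \<le> y2" using F(2)[OF Y(2)] F(3)[OF Y(1)] 3 by (auto simp: not_less[symmetric])
    then have "ereal y1 \<le> ereal (F0 x)" "ereal (F0 x) \<le> ereal y2" by simp_all
    then have "F0 x \<in> I"
      using 3(1,3) less_le_trans[of a "ereal y1"] le_less_trans[of _ "ereal y2" b] unfolding I_def by blast
    moreover have "x \<in> S (F0 x)" "x \<notin> D (F0 x)" using F(3)[OF F(1)] F(4) by (auto simp: D_def not_less)
    ultimately show ?thesis unfolding rule_iff by blast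
  qed
qed

lemma rule_unique: assumes "rule x w" "rule x w'" shows "w = w'"
proof -
  have False if w: "rule x w" "rule x w'" "w < w'" for w w'
  proof -
    obtain y where y: "y \<in> I" "w < ereal y" "ereal y < w'"
      using between_in_I[of w w'] w(3) rule_bounds[OF w(1)] rule_bounds[OF w(2)] by blast
    then have "w' < ereal y" using rule_less_iff[OF w(1) y(1)] rule_less_iff[OF w(2) y(1)] by simp
    then show False using y(3) by simp
  qed
  then show ?thesis using assms by (metis linorder_less_linear)
qed

lemma rule_ex1: "x \<in> X \<Longrightarrow> \<exists>!w. rule x w"
  using rule_exists rule_unique by blast

abbreviation Fb where "Fb \<equiv> Fbar \<mu> \<nu> s a b"

lemma rule_Fbar: "x \<in> X \<Longrightarrow> rule x (Fb x)"
  unfolding Fbar_def by (rule theI'[OF rule_ex1])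

lemma Fbar_eqI: "x \<in> X \<Longrightarrow> rule x w \<Longrightarrow> Fb x = w"
  using rule_unique[OF rule_Fbar] by blast

text \<open>A bound c below \<open>Fb x\<close> is separated from it by some y in I. Then x lies
  outside \<open>S y\<close>, which is an open condition and implies being outside
  \<open>D y\<close>, that is, a value at least y. Bounds above use in the same way that
  \<open>D y\<close> is open in X; bounds outside [a,b] are trivial.\<close>

lemma Fbar_continuous: "continuous_on X Fb"
  unfolding continuous_on_def
proof
  fix x assume x: "x \<in> X"
  note rx = rule_Fbar[OF x] and bx = rule_bounds[OF rule_Fbar[OF x]]
  have inX: "\<forall>\<^sub>F z in at x within X. z \<in> X" by (auto simp: eventually_at_filter)
  have lim: "((\<lambda>z. ereal (dy s z y)) \<longlongrightarrow> ereal (dy s x y)) (at x within X)" if "y \<in> I" for y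
    using continuous_on_dy_x[of y] x that I_subset_Y by (auto simp: continuous_on_def)
  show "(Fb \<longlongrightarrow> Fb x) (at x within X)"
  proof (rule order_tendstoI)
    fix c assume c: "c < Fb x"
    show "\<forall>\<^sub>F z in at x within X. c < Fb z"
    proof (cases "c < a")
      case True
      from inX show ?thesis by eventually_elim (use True rule_bounds[OF rule_Fbar] in \<open>auto intro: less_le_trans\<close>)
    next
      case False
      then have "a \<le> c" by (simp add: not_less)
      then obtain y where y: "y \<in> I" "c < ereal y" "ereal y < Fb x" using between_in_I[OF _ c] bx by blast
      have "x \<notin> S y" using rule_le_if_S[OF rx y(1)] y(3) by auto
      then have "kp y < ereal (dy s x y)" using x by (simp add: S_def not_le)
      then have "\<forall>\<^sub>F z in at x within X. kp y < ereal (dy s z y)" by (rule order_tendstoD(1)[OF lim[OF y(1)]])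
      then show ?thesis using inX
      proof eventually_elim
        case (elim z)
        then have "z \<notin> S y" by (simp add: S_def not_le)
        then have "z \<notin> D y" using D_subset_S[of y] y(1) I_subset_Y by blast
        then have "\<not> Fb z < ereal y" using rule_less_iff[OF rule_Fbar y(1), of z] elim by simp
        then show ?case using y(2) by simp
      qed
    qed
  next
    fix c assume c: "Fb x < c"
    show "\<forall>\<^sub>F z in at x within X. Fb z < c"
    proof (cases "b < c")
      case True
      from inX show ?thesis by eventually_elim (use True rule_bounds[OF rule_Fbar] in \<open>auto intro: le_less_trans\<close>)
    next
      case False
      then have "c \<le> b" by (simp add: not_less)
      then obtain y where y: "y \<in> I" "Fb x < ereal y" "ereal y < c" using between_in_I[OF _ c] bx by blast
      have "x \<in> D y" using rule_less_iff[OF rx y(1)] y(2) by simp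
      then have "ereal (dy s x y) < km y" by (simp add: D_def)
      then have "\<forall>\<^sub>F z in at x within X. ereal (dy s z y) < km y" by (rule order_tendstoD(2)[OF lim[OF y(1)]])
      then show ?thesis using inX
      proof eventually_elim
        case (elim z)
        then have "Fb z < ereal y" using rule_less_iff[OF rule_Fbar y(1), of z] by (simp add: D_def)
        then show ?case using y(3) by simp
      qed
    qed
  qed
qed

lemma Fbar_eq_F0_AE: "AE x in \<mu>. ereal (F0 x) = Fb x"
proof -
  have "AE y in distr \<mu> \<nu> F0. y \<in> I" unfolding distr_F0 by (rule AE_in_I)
  then have "AE x in \<mu>. F0 x \<in> I" by (rule AE_distrD[OF F0_measurable])
  then show ?thesis using F0_AE
  proof eventually_elim
    case (elim x)
    then have F: "F0 x \<in> Y" "x \<in> X" "ereal (dy s x (F0 x)) = kp (F0 x)" by (auto simp: F_rule_iff)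
    then have "x \<in> S (F0 x)" "x \<notin> D (F0 x)" using km_le_kp[of "F0 x"] by (auto simp: S_def D_def not_less)
    then have "rule x (ereal (F0 x))" using elim unfolding rule_iff by blast
    then show ?case using Fbar_eqI F by simp
  qed
qed

lemma matching_map_eq_Fbar_AE: assumes "matching F" shows "AE x in \<mu>. ereal (F x) = Fb x"
  using matching_map_AE_eq[OF assms] Fbar_eq_F0_AE by eventually_elim simp

lemma Fbar_in_range_AE: "AE x in \<mu>. Fb x \<in> ereal ` Y"
  using Fbar_eq_F0_AE AE_space
proof eventually_elim
  case (elim x)
  then show ?case using F0_in_Y[of x] \<mu>(2) by (metis image_eqI)
qed

text \<open>Points of I accumulate at every value in [a,b], from the right if it is less than b and
  from the left if it is b. Membership in the closure cannot be sharpened to membership in Y for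
  every x: with s(x,y) = x y on X = (0,3) and Y = (0,1), \<nu> uniform on Y and \<mu> uniform on
  (1,2), every x \<ge> 2 is sent to the end point 1.\<close>

lemma Fbar_in_closure: assumes x: "x \<in> X" shows "Fb x \<in> closure (ereal ` Y)"
  unfolding closure_iff_nhds_not_empty
proof (intro allI impI)
  fix A T :: "ereal set" assume T: "T \<subseteq> A" "open T" "Fb x \<in> T"
  note bx = rule_bounds[OF rule_Fbar[OF x]]
  have "\<exists>y\<in>I. ereal y \<in> T"
  proof (cases "Fb x < b")
    case True
    obtain c where c: "Fb x < c" "{Fb x..<c} \<subseteq> T" using open_right[OF T(2,3) True] by blast
    obtain y where "y \<in> I" "Fb x < ereal y" "ereal y < min b c"
      using between_in_I[of "Fb x" "min b c"] bx c True by auto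
    then show ?thesis using c(2) by (intro bexI[of _ y]) (auto simp: subset_iff less_imp_le)
  next
    case False
    then have Fb: "Fb x = b" using bx by simp
    obtain c where c: "c < Fb x" "{c<..Fb x} \<subseteq> T" using open_left[OF T(2,3), of a] a_less_b Fb by auto
    obtain y where "y \<in> I" "max a c < ereal y" "ereal y < Fb x"
      using between_in_I[of "max a c" "Fb x"] c Fb a_less_b by auto
    then show ?thesis using c(2) by (intro bexI[of _ y]) (auto simp: subset_iff less_imp_le)
  qed
  then show "ereal ` Y \<inter> A \<noteq> {}" using I_subset_Y T(1) by blast
qed

end

theorem theorem4:
  fixes X :: "(real ^ 'm) set" and Y :: "real set"
    and \<mu> :: "(real ^ 'm) measure" and \<nu> :: "real measure"
    and s :: "(real ^ 'm) \<times> real \<Rightarrow> real"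
  assumes "open X" "connected X" "open Y" "connected Y"
    and "prob_space \<mu>" "space \<mu> = X" "sets \<mu> = sets (restrict_space borel X)"
    and "prob_space \<nu>" "space \<nu> = Y" "sets \<nu> = sets (restrict_space borel Y)"
    and no_atoms: "\<And>y. y \<in> Y \<Longrightarrow> emeasure \<nu> {y} = 0"
    and hypersurfaces: "\<And>S. S \<subseteq> X \<Longrightarrow> lipschitz_hypersurface S \<Longrightarrow> emeasure \<mu> S = 0"
    and "C11_on (X \<times> Y) s"
    and nondegenerate: "\<And>x y. x \<in> X \<Longrightarrow> y \<in> Y \<Longrightarrow> nondegenerate_at X s x y"
  shows
    "(\<forall>y\<in>Y. K_interval \<mu> \<nu> s y \<noteq> {} \<and>
            (\<forall>k \<in> K_interval \<mu> \<nu> s y. balanced_level \<mu> \<nu> s y k) \<and>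
            (\<forall>J. is_interval J \<and> (\<forall>k\<in>J. balanced_level \<mu> \<nu> s y k) \<longrightarrow> J \<subseteq> K_interval \<mu> \<nu> s y)) \<and>
     usc_on Y (k_plus \<mu> \<nu> s) \<and> usc_on Y (\<lambda>y. - k_minus \<mu> \<nu> s y) \<and>
     (mono_on Y (\<lambda>y. level_le s X y (k_plus \<mu> \<nu> s y)) \<and>
      mono_on Y (\<lambda>y. level_le s X y (k_minus \<mu> \<nu> s y)) \<and>
      (\<forall>y\<in>Y. \<forall>y'\<in>Y. emeasure \<nu> {y..y'} > 0 \<longrightarrow>
         level_le s X y (k_plus \<mu> \<nu> s y) \<subseteq> level_less s X y' (k_minus \<mu> \<nu> s y'))
      \<longrightarrow>
      (\<forall>y\<in>Y. continuous (at_right y) (k_plus \<mu> \<nu> s)) \<and>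
      (\<forall>y\<in>Y. continuous (at_left y) (k_minus \<mu> \<nu> s)) \<and>
      countable {y \<in> Y \<inter> spt \<nu>. k_plus \<mu> \<nu> s y \<noteq> k_minus \<mu> \<nu> s y} \<and>
      (AE x in \<mu>. \<exists>!y. F_rule \<mu> \<nu> s x y) \<and>
      (\<exists>F. matching_map \<mu> \<nu> s F) \<and>
      (\<forall>F. matching_map \<mu> \<nu> s F \<longrightarrow> unique_maximizer \<mu> \<nu> s (graph_plan \<mu> \<nu> F)) \<and>
      (\<forall>a b :: ereal. connected (spt \<nu>) \<and> spt \<nu> = {t. a \<le> ereal t \<and> ereal t \<le> b} \<longrightarrow>
         (\<forall>x\<in>X. \<exists>!v. Fbar_rule \<mu> \<nu> s a b x v) \<and>
         continuous_on X (Fbar \<mu> \<nu> s a b) \<and>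
         (\<forall>F. matching_map \<mu> \<nu> s F \<longrightarrow> (AE x in \<mu>. ereal (F x) = Fbar \<mu> \<nu> s a b x)) \<and>
         (Y \<subseteq> spt \<nu> \<longrightarrow>
            (\<forall>x\<in>X. Fbar \<mu> \<nu> s a b x \<in> closure (ereal ` Y)) \<and>
            (AE x in \<mu>. Fbar \<mu> \<nu> s a b x \<in> ereal ` Y))))"
proof -
  obtain Ds M L where Ds: "\<And>z. z \<in> X \<times> Y \<Longrightarrow> GDERIV s z :> Ds z" and M: "\<And>z. z \<in> X \<times> Y \<Longrightarrow> norm (Ds z) \<le> M"
    and L: "L-lipschitz_on (X \<times> Y) Ds" and s_bounded: "bounded (s ` (X \<times> Y))"
  proof -
    obtain Ds where Ds: "\<forall>z\<in>X \<times> Y. GDERIV s z :> Ds z" "bounded (Ds ` (X \<times> Y))" "\<exists>L. L-lipschitz_on (X \<times> Y) Ds"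
      and bdd: "bounded (s ` (X \<times> Y))"
      using \<open>C11_on (X \<times> Y) s\<close> unfolding C11_on_def by blast
    obtain M where "\<forall>z\<in>X \<times> Y. norm (Ds z) \<le> M" using Ds(2) unfolding bounded_iff by blast
    with Ds bdd that show thesis by blast
  qed
  have dy: "((\<lambda>t. s (x, t)) has_real_derivative snd (Ds (x, y))) (at y)" "dy s x y = snd (Ds (x, y))"
    if "x \<in> X" "y \<in> Y" for x y
  proof -
    have "((\<lambda>t. s ((x, y) + t *\<^sub>R (0, 1))) has_real_derivative Ds (x, y) \<bullet> (0, 1)) (at 0)"
      using Ds that by (intro GDERIV_imp_DERIV_line) auto
    moreover have "Ds (x, y) \<bullet> (0, 1) = snd (Ds (x, y))" by (simp add: inner_prod_def)
    ultimately have "((\<lambda>t. s (x, t + y)) has_real_derivative snd (Ds (x, y))) (at 0)" by (simp add: add.commute)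
    then show D: "((\<lambda>t. s (x, t)) has_real_derivative snd (Ds (x, y))) (at y)"
      using DERIV_shift[of "\<lambda>t. s (x, t)" "snd (Ds (x, y))" 0 y] by simp
    show "dy s x y = snd (Ds (x, y))" unfolding dy_def by (rule DERIV_imp_deriv[OF D])
  qed
  have dy_lipschitz: "\<bar>dy s x y - dy s x' y'\<bar> \<le> L * (dist x x' + dist y y')"
    if "x \<in> X" "y \<in> Y" "x' \<in> X" "y' \<in> Y" for x y x' y'
  proof -
    have "\<bar>dy s x y - dy s x' y'\<bar> \<le> dist (Ds (x, y)) (Ds (x', y'))"
      using that dist_snd_le[of "Ds (x, y)" "Ds (x', y')"] by (simp add: dy dist_real_def)
    also have "\<dots> \<le> L * dist (x, y) (x', y')" using that by (intro lipschitz_onD[OF L]) auto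
    also have "\<dots> \<le> L * (dist x x' + dist y y')"
      using lipschitz_on_nonneg[OF L] sqrt_sum_squares_le_sum_abs[of "dist x x'" "dist y y'"]
      by (intro mult_left_mono) (auto simp: dist_Pair_Pair)
    finally show ?thesis .
  qed
  have lip_x: "L-lipschitz_on X (\<lambda>x. dy s x y)" if "y \<in> Y" for y
    by (rule lipschitz_onI) (use dy_lipschitz[OF _ that _ that] lipschitz_on_nonneg[OF L] in \<open>auto simp: dist_real_def\<close>)
  have increase: "\<exists>u c r. norm u = 1 \<and> 0 < c \<and> 0 < r \<and> ball x r \<subseteq> X \<and>
       (\<forall>z t. z \<in> ball x r \<and> z + t *\<^sub>R u \<in> ball x r \<and> 0 \<le> t \<longrightarrow> dy s z y + c * t \<le> dy s (z + t *\<^sub>R u) y)"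
    if xy: "x \<in> X" "y \<in> Y" for x y
  proof -
    obtain e where e: "norm e = 1" "\<And>p. p \<in> clarke_subdifferential X (\<lambda>x. dy s x y) x \<Longrightarrow> p \<bullet> e \<noteq> 0"
      using nondegenerate[OF xy] unfolding nondegenerate_at_def by blast
    obtain u c r where "norm u = 1" "0 < c" "0 < r" "ball x r \<subseteq> X"
      "\<And>z t. z \<in> ball x r \<Longrightarrow> z + t *\<^sub>R u \<in> ball x r \<Longrightarrow> 0 \<le> t \<Longrightarrow> dy s z y + c * t \<le> dy s (z + t *\<^sub>R u) y"
      using nondegenerate_increase[OF \<open>open X\<close> xy(1) lip_x[OF xy(2)] e] by blast
    then show ?thesis by blast
  qed
  \<comment> \<open>The gradient bound M also bounds |s_y|; M + 1 makes the inequality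
    strict.\<close>
  interpret level_transport X Y \<mu> \<nu> s L "M + 1"
  proof (rule level_transport.intro)
    show "continuous_on (X \<times> Y) s"
      using Ds has_derivative_continuous unfolding gderiv_def
      by (intro continuous_at_imp_continuous_on ballI) blast
    show "((\<lambda>t. s (x, t)) has_real_derivative dy s x y) (at y)" if "x \<in> X" "y \<in> Y" for x y
      using dy[OF that] by simp
    show "\<bar>dy s x y\<bar> < M + 1" if "x \<in> X" "y \<in> Y" for x y
      using M[of "(x, y)"] that norm_snd_le[of "snd (Ds (x, y))" "fst (Ds (x, y))"] by (simp add: dy)
    show "emeasure \<mu> {x \<in> X. dy s x y = k} = 0" if "y \<in> Y" for y k
      using that increase by (intro hypersurfaces level_set_lipschitz_hypersurface[OF lip_x]) auto
    show "\<exists>x'\<in>X. dist x' x < e \<and> dy s x y < dy s x' y" if xy: "x \<in> X" "y \<in> Y" and e: "0 < e" for x y e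
    proof -
      obtain u c r where u: "norm u = 1" "0 < c" "0 < r" "ball x r \<subseteq> X"
        and inc: "\<And>z t. z \<in> ball x r \<Longrightarrow> z + t *\<^sub>R u \<in> ball x r \<Longrightarrow> 0 \<le> t \<Longrightarrow> dy s z y + c * t \<le> dy s (z + t *\<^sub>R u) y"
        using increase[OF xy] by blast
      define t where "t = min r e / 2"
      have t: "0 < t" "t < r" "t < e" using u e by (auto simp: t_def)
      have "x + t *\<^sub>R u \<in> ball x r" using u t by (simp add: dist_norm)
      moreover from this have "dy s x y + c * t \<le> dy s (x + t *\<^sub>R u) y"
        using inc[of x t] u(3) t(1) by simp
      then have "dy s x y < dy s (x + t *\<^sub>R u) y" using mult_pos_pos[OF u(2) t(1)] by linarith
      moreover have "dist (x + t *\<^sub>R u) x < e" using u t by (simp add: dist_norm)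
      ultimately show ?thesis using u(4) by blast
    qed
  qed (use assms(1-10) no_atoms s_bounded dy_lipschitz in auto)
  have K: "\<forall>y\<in>Y. K_interval \<mu> \<nu> s y \<noteq> {} \<and>
            (\<forall>k \<in> K_interval \<mu> \<nu> s y. balanced_level \<mu> \<nu> s y k) \<and>
            (\<forall>J. is_interval J \<and> (\<forall>k\<in>J. balanced_level \<mu> \<nu> s y k) \<longrightarrow> J \<subseteq> K_interval \<mu> \<nu> s y)"
    (is "\<forall>y\<in>Y. ?P y")
  proof
    fix y assume y: "y \<in> Y"
    \<comment> \<open>The interval is the set of all balanced levels, so it contains every interval
      that consists of such levels.\<close>
    have "K_interval \<mu> \<nu> s y = {k. balanced_level \<mu> \<nu> s y k}" using K_interval_iff[OF y] by blast
    moreover have "\<exists>k. balanced_level \<mu> \<nu> s y k" using balanced_exists[OF y] balanced_level_iff[OF y] by blast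
    ultimately show "?P y" by auto
  qed
  have monotone: "monotone_level_transport X Y \<mu> \<nu> s L (M + 1)"
    if "mono_on Y (\<lambda>y. level_le s X y (k_plus \<mu> \<nu> s y))" "mono_on Y (\<lambda>y. level_le s X y (k_minus \<mu> \<nu> s y))"
      "\<forall>y\<in>Y. \<forall>y'\<in>Y. emeasure \<nu> {y..y'} > 0 \<longrightarrow>
         level_le s X y (k_plus \<mu> \<nu> s y) \<subseteq> level_less s X y' (k_minus \<mu> \<nu> s y')"
    by unfold_locales (use mono_onD[OF that(1)] mono_onD[OF that(2)] that(3) in blast)+
  show ?thesis
  proof (intro conjI K usc_kp usc_uminus_km impI)
    assume hyp: "mono_on Y (\<lambda>y. level_le s X y (k_plus \<mu> \<nu> s y)) \<and>
      mono_on Y (\<lambda>y. level_le s X y (k_minus \<mu> \<nu> s y)) \<and>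
      (\<forall>y\<in>Y. \<forall>y'\<in>Y. emeasure \<nu> {y..y'} > 0 \<longrightarrow>
         level_le s X y (k_plus \<mu> \<nu> s y) \<subseteq> level_less s X y' (k_minus \<mu> \<nu> s y'))"
    interpret monotone_level_transport X Y \<mu> \<nu> s L "M + 1" using monotone hyp by blast
    show "\<forall>y\<in>Y. continuous (at_right y) (k_plus \<mu> \<nu> s)" using continuous_kp by blast
    show "\<forall>y\<in>Y. continuous (at_left y) (k_minus \<mu> \<nu> s)" using continuous_km by blast
    show "countable {y \<in> Y \<inter> spt \<nu>. k_plus \<mu> \<nu> s y \<noteq> k_minus \<mu> \<nu> s y}" by (rule countable_kp_neq_km)
    show "AE x in \<mu>. \<exists>!y. F_rule \<mu> \<nu> s x y" by (rule F_rule_ex1_AE)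
    show "\<exists>F. matching_map \<mu> \<nu> s F" using matching_map_F0 by blast
    show "\<forall>F. matching_map \<mu> \<nu> s F \<longrightarrow> unique_maximizer \<mu> \<nu> s (graph_plan \<mu> \<nu> F)"
      using unique_maximizer_matching_map by blast
    show "\<forall>a b :: ereal. connected (spt \<nu>) \<and> spt \<nu> = {t. a \<le> ereal t \<and> ereal t \<le> b} \<longrightarrow>
         (\<forall>x\<in>X. \<exists>!v. Fbar_rule \<mu> \<nu> s a b x v) \<and>
         continuous_on X (Fbar \<mu> \<nu> s a b) \<and>
         (\<forall>F. matching_map \<mu> \<nu> s F \<longrightarrow> (AE x in \<mu>. ereal (F x) = Fbar \<mu> \<nu> s a b x)) \<and>
         (Y \<subseteq> spt \<nu> \<longrightarrow>
            (\<forall>x\<in>X. Fbar \<mu> \<nu> s a b x \<in> closure (ereal ` Y)) \<and>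
            (AE x in \<mu>. Fbar \<mu> \<nu> s a b x \<in> ereal ` Y))"
      (is "\<forall>a b. ?spt a b \<longrightarrow> ?P a b")
    proof (intro allI impI)
      fix a b :: ereal assume "?spt a b"
      then interpret interval_support_transport X Y \<mu> \<nu> s L "M + 1" a b by unfold_locales blast
      show "?P a b"
        using rule_ex1 Fbar_continuous matching_map_eq_Fbar_AE Fbar_in_closure Fbar_in_range_AE by blast
    qed
  qed
qed

end
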